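(* Let $\phi:\mathbb{N}_0\to\mathbb{C}$ be a function. Then the following are equivalent: (1) $\phi\in\mathcal{C}$. (2) There exist a constant $c\in\mathbb{C}$ and a complex Borel measure $\nu$ on $\mathbb{D}$ such that $$\phi(n)=c+\int_{\mathbb{D}}s^n\,d\nu(s)\qquad(n\ge0)$$ and $$\int_{\mathbb{D}}\frac{|1-s|}{1-|s|}\,d|\nu|(s)<\infty.$$ Moreover, for $\phi\in\mathcal{C}$, the measure $\nu$ in (2) can be chosen such that $$|c|+\int_{\mathbb{D}}\frac{|1-s|}{1-|s|}\,d|\nu|(s)\le\frac{8}{\pi}\|\phi\|_{\mathcal{C}}.$$
   Context: $\mathbb{D}=\{s\in\mathbb{C}:|s|<1\}$ and $|\nu|$ is the total variation measure of $\nu$; $s^0=1$ for all $s$. $\mathcal{C}$ is the set of functions $\phi:\mathbb{N}_0\to\mathbb{C}$ for which the Hankel matrix $h=(\phi(i+j)-\phi(i+j+1))_{i,j\ge0}$ is of trace class on $\ell^2(\mathbb{N}_0)$. For $\phi\in\mathcal{C}$ the matrix $k=(\phi(i+j+1)-\phi(i+j+2))_{i,j\ge0}$ is also of trace class, the limit $\lim_{n\to\infty}\phi(n)$ exists, and $\|\phi\|_{\mathcal{C}}=\|h\|_1+\|k\|_1+|\lim_{n\to\infty}\phi(n)|$, where $\|x\|_1=\mathrm{Tr}(|x|)$ is the trace-class norm. *)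

theory Defs
  imports "HOL-Analysis.Analysis"
begin

text \<open>Bounded operators on $\ell^2(\mathbf{N}_0)$ are represented by their matrices with respect to
  the standard orthonormal basis.\<close>

definition ell2 :: "(nat \<Rightarrow> complex) set" where
  "ell2 = {x. summable (\<lambda>n. (cmod (x n))\<^sup>2)}"

definition ell2_norm :: "(nat \<Rightarrow> complex) \<Rightarrow> real" where
  "ell2_norm x = sqrt (\<Sum>n. (cmod (x n))\<^sup>2)"

definition ell2_inner :: "(nat \<Rightarrow> complex) \<Rightarrow> (nat \<Rightarrow> complex) \<Rightarrow> complex" where
  "ell2_inner x y = (\<Sum>n. x n * cnj (y n))"

type_synonym inf_matrix = "nat \<Rightarrow> nat \<Rightarrow> complex"

definition mat_apply :: "inf_matrix \<Rightarrow> (nat \<Rightarrow> complex) \<Rightarrow> (nat \<Rightarrow> complex)" where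
  "mat_apply A x = (\<lambda>i. \<Sum>j. A i j * x j)"

definition bounded_matrix :: "inf_matrix \<Rightarrow> bool" where
  "bounded_matrix A \<longleftrightarrow>
     (\<forall>x\<in>ell2. (\<forall>i. summable (\<lambda>j. A i j * x j)) \<and> mat_apply A x \<in> ell2) \<and>
     (\<exists>K. \<forall>x\<in>ell2. ell2_norm (mat_apply A x) \<le> K * ell2_norm x)"

definition mat_adjoint :: "inf_matrix \<Rightarrow> inf_matrix" where
  "mat_adjoint A = (\<lambda>i j. cnj (A j i))"

definition mat_mult :: "inf_matrix \<Rightarrow> inf_matrix \<Rightarrow> inf_matrix" where
  "mat_mult A B = (\<lambda>i j. \<Sum>k. A i k * B k j)"

definition positive_matrix :: "inf_matrix \<Rightarrow> bool" where
  "positive_matrix A \<longleftrightarrow>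
     bounded_matrix A \<and> (\<forall>x\<in>ell2. ell2_inner (mat_apply A x) x \<in> \<real>\<^sub>\<ge>\<^sub>0)"

text \<open>The absolute value $|A| = (A^*A)^{1/2}$; the positive square root of $A^*A$ exists and is
  unique when $A$ is bounded, which is the only case in which this is used.\<close>

definition mat_abs :: "inf_matrix \<Rightarrow> inf_matrix" where
  "mat_abs A = (THE P. positive_matrix P \<and> mat_mult P P = mat_mult (mat_adjoint A) A)"

definition mat_trace :: "inf_matrix \<Rightarrow> complex" where
  "mat_trace A = (\<Sum>n. A n n)"

text \<open>The diagonal entries of $|A|$ are nonnegative reals, so summability of the diagonal says
  $\mathrm{Tr}(|A|) < \infty$ and the trace is real.\<close>

definition trace_class :: "inf_matrix \<Rightarrow> bool" where
  "trace_class A \<longleftrightarrow> bounded_matrix A \<and> summable (\<lambda>n. mat_abs A n n)"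

definition trace_norm :: "inf_matrix \<Rightarrow> real" where
  "trace_norm A = Re (mat_trace (mat_abs A))"

definition hankel_h :: "(nat \<Rightarrow> complex) \<Rightarrow> inf_matrix" where
  "hankel_h \<phi> = (\<lambda>i j. \<phi> (i + j) - \<phi> (i + j + 1))"

definition hankel_k :: "(nat \<Rightarrow> complex) \<Rightarrow> inf_matrix" where
  "hankel_k \<phi> = (\<lambda>i j. \<phi> (i + j + 1) - \<phi> (i + j + 2))"

definition class_C :: "(nat \<Rightarrow> complex) set" where
  "class_C = {\<phi>. trace_class (hankel_h \<phi>)}"

definition norm_C :: "(nat \<Rightarrow> complex) \<Rightarrow> real" where
  "norm_C \<phi> = trace_norm (hankel_h \<phi>) + trace_norm (hankel_k \<phi>) + cmod (lim \<phi>)"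

text \<open>A complex measure is a countably additive complex set function on a $\sigma$-algebra. In the
  following, the argument \<open>M\<close> only supplies the underlying space and its $\sigma$-algebra, and
  values of the set function outside \<open>sets M\<close> are irrelevant.\<close>

definition complex_measure :: "'a measure \<Rightarrow> ('a set \<Rightarrow> complex) \<Rightarrow> bool" where
  "complex_measure M \<nu> \<longleftrightarrow>
     (\<forall>A :: nat \<Rightarrow> 'a set. range A \<subseteq> sets M \<longrightarrow> disjoint_family A \<longrightarrow>
        (\<lambda>i. \<nu> (A i)) sums \<nu> (\<Union>i. A i))"

text \<open>The total variation $|\nu|(E) = \sup \sum_i |\nu(E_i)|$, the supremum being over countable
  measurable partitions of $E$.\<close>

definition total_variation :: "'a measure \<Rightarrow> ('a set \<Rightarrow> complex) \<Rightarrow> 'a measure" where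
  "total_variation M \<nu> = measure_of (space M) (sets M)
     (\<lambda>E. SUP A \<in> {A :: nat \<Rightarrow> 'a set. range A \<subseteq> sets M \<and> disjoint_family A \<and> (\<Union>i. A i) = E}.
        (\<Sum>i. ennreal (cmod (\<nu> (A i)))))"

text \<open>The positive part $\mu^+(E) = \sup \{\mu(A) : A \subseteq E\}$ in the Jordan decomposition
  $\mu = \mu^+ - (-\mu)^+$ of a finite signed measure. Truncation of negative values by
  \<open>ennreal\<close> is harmless because of $A = \emptyset$.\<close>

definition positive_part :: "'a measure \<Rightarrow> ('a set \<Rightarrow> real) \<Rightarrow> 'a measure" where
  "positive_part M \<mu> = measure_of (space M) (sets M)
     (\<lambda>E. SUP A \<in> {A \<in> sets M. A \<subseteq> E}. ennreal (\<mu> A))"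

definition complex_measure_integral ::
    "'a measure \<Rightarrow> ('a set \<Rightarrow> complex) \<Rightarrow> ('a \<Rightarrow> complex) \<Rightarrow> complex" where
  "complex_measure_integral M \<nu> f =
     (integral\<^sup>L (positive_part M (\<lambda>A. Re (\<nu> A))) f - integral\<^sup>L (positive_part M (\<lambda>A. - Re (\<nu> A))) f)
     + \<i> * (integral\<^sup>L (positive_part M (\<lambda>A. Im (\<nu> A))) f - integral\<^sup>L (positive_part M (\<lambda>A. - Im (\<nu> A))) f)"

definition disc_borel :: "complex measure" where
  "disc_borel = restrict_space borel (ball 0 1)"

definition represents :: "complex \<Rightarrow> (complex set \<Rightarrow> complex) \<Rightarrow> (nat \<Rightarrow> complex) \<Rightarrow> bool" where
  "represents c \<nu> \<phi> \<longleftrightarrow>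
     (\<forall>n. \<phi> n = c + complex_measure_integral disc_borel \<nu> (\<lambda>s. s ^ n))"

definition weighted_variation :: "(complex set \<Rightarrow> complex) \<Rightarrow> ennreal" where
  "weighted_variation \<nu> =
     (\<integral>\<^sup>+ s. ennreal (cmod (1 - s) / (1 - cmod s)) \<partial>total_variation disc_borel \<nu>)"

end

theory Submission
  imports Defs
begin

text \<open>
  Write $a_n = \phi(n) - \phi(n+1)$, so that $h = (a_{i+j})$ and $k = (a_{i+j+1})$.

  If $\phi$ is represented by $\nu$, then $a_n = \int s^n (1-s)\,d\nu$, and \<open>h\<close> is an integral of the
  rank one matrices $(s^{i+j})$, each of norm $(1-|s|^2)^{-1}$. So the trace norm of \<open>h\<close> is at most the
  weighted total mass. To make this rigorous without integrating operators, the trace norm is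
  estimated by pairing with finite contractions (\<open>hankel_nuclear\<close>), and every step is carried out
  separately for the positive parts of $\pm\mathrm{Re}\,\nu$ and $\pm\mathrm{Im}\,\nu$; each of these is
  dominated by the variation $|\nu|$.

  Conversely, the measure is written down explicitly. With
  $\Gamma(s) = \sum_n (n+1)(2n+1)\,a_n s^n$ and \<open>m\<close> the measure $dt\,du$ in the coordinates
  $s = t e^{2\pi i u}$, orthogonality of the monomials gives
  $a_n = \int s^n\, 2\,\Gamma(\bar s)(1-|s|)\,dm$, hence
  $d\nu = 2\,\Gamma(\bar s)(1-|s|)(1-s)^{-1}\,dm$ has the right differences, its integrals of $s^n$ tend
  to zero, and its weighted variation is at most $2\int |\Gamma|\,dm$. The point is the bound
  $\int |\Gamma|\,dm \<le> \frac{4}{\pi}(\|h\|_1 + \|k\|_1)$. Let $p_n$ be the coefficients of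
  $(1-z)^{-3/2}$. Their convolution square is $\frac12 (n+1)(n+2)$, and $p_n^2 \<le> \frac{4}{\pi}(n+1)$;
  here the constant comes in. Taking only the even members of the convolution square and splitting by
  the parity of the two factors gives
  $\Gamma(s) = x^T h\,x + s\,y^T k\,y$ with $x_i = p_{2i}s^i$ and $y_i = p_{2i+1}s^i$. A complex symmetric
  matrix satisfies $|x^T h\,x| \<le> \langle |h| x, x\rangle$ (\<open>symmetric_form_le_mat_abs\<close>), and integrating
  the right hand side over the disc leaves only the diagonal of $|h|$, multiplied by
  $p_{2i}^2/(2i+1) \<le> 4/\pi$. The same goes for \<open>k\<close>.

  The operator theory rests on one inequality, \<open>Loewner_Heinz\<close>: $\|Sx\| \<le> \|Px\|$ for all \<open>x\<close>, with
  \<open>S\<close> symmetric and \<open>P\<close> positive, implies $|\langle Sx, x\rangle| \<le> \langle Px, x\rangle$. It gives the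
  uniqueness of square roots, the comparison $|k| \<le> |h|$, and, applied to the antilinear symmetric
  operator $x \mapsto \overline{hx}$ on the underlying real Hilbert space, the bound on $x^T h\,x$.
\<close>

section \<open>Positive operators on a real Hilbert space\<close>

definition selfadjoint :: "('a::real_inner \<Rightarrow>\<^sub>L 'a) \<Rightarrow> bool" where
  "selfadjoint T \<longleftrightarrow> (\<forall>x y. T x \<bullet> y = x \<bullet> T y)"

definition psd :: "('a::real_inner \<Rightarrow>\<^sub>L 'a) \<Rightarrow> bool" where
  "psd T \<longleftrightarrow> selfadjoint T \<and> (\<forall>x. 0 \<le> T x \<bullet> x)"

lemma selfadjointD: "selfadjoint T \<Longrightarrow> T x \<bullet> y = x \<bullet> T y"
  by (simp add: selfadjoint_def)

lemma psdD: "psd T \<Longrightarrow> 0 \<le> T x \<bullet> x"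
  by (simp add: psd_def)

lemma psd_selfadjoint: "psd T \<Longrightarrow> selfadjoint T"
  by (simp add: psd_def)

lemma psd_Cauchy_Schwarz:
  assumes "psd T"
  shows "(T x \<bullet> y)\<^sup>2 \<le> (T x \<bullet> x) * (T y \<bullet> y)"
proof -
  define a b c where "a = T x \<bullet> x" and "b = T x \<bullet> y" and "c = T y \<bullet> y"
  have sym: "T y \<bullet> x = b"
    unfolding b_def using assms by (metis inner_commute psd_selfadjoint selfadjointD)
  have quad: "0 \<le> a + 2 * b * t + c * t\<^sup>2" for t :: real
  proof -
    have "0 \<le> T (x + t *\<^sub>R y) \<bullet> (x + t *\<^sub>R y)" using assms by (rule psdD)
    also have "\<dots> = a + 2 * b * t + c * t\<^sup>2"
      using sym by (simp add: a_def b_def c_def blinfun.add_right blinfun.scaleR_right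
          inner_add_left inner_add_right power2_eq_square algebra_simps)
    finally show ?thesis .
  qed
  have c: "c \<ge> 0" using assms by (simp add: c_def psdD)
  have "b\<^sup>2 \<le> a * c"
  proof (cases "c = 0")
    case True
    have "b = 0"
    proof (rule ccontr)
      assume "b \<noteq> 0"
      then show False using quad[of "- (a + 1) / (2 * b)"] True by simp
    qed
    then show ?thesis using True by simp
  next
    case False
    have "0 \<le> a - b\<^sup>2 / c"
      using quad[of "- b / c"] False by (simp add: field_simps power2_eq_square)
    then show ?thesis using False c by (simp add: field_simps)
  qed
  then show ?thesis by (simp add: a_def b_def c_def)
qed

lemma psd_norm_le:
  assumes "psd T" and "\<And>x. T x \<bullet> x \<le> c * (norm x)\<^sup>2" and "c \<ge> 0"
  shows "norm T \<le> c"
proof (rule norm_blinfun_bound)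
  fix x
  show "norm (T x) \<le> c * norm x"
  proof (cases "T x = 0")
    case False
    have "((norm (T x))\<^sup>2)\<^sup>2 \<le> (T x \<bullet> x) * (T (T x) \<bullet> T x)"
      using psd_Cauchy_Schwarz[OF assms(1), of x "T x"] by (simp add: power2_norm_eq_inner)
    also have "\<dots> \<le> (c * (norm x)\<^sup>2) * (c * (norm (T x))\<^sup>2)"
      by (intro mult_mono assms(2)) (auto simp: psdD[OF assms(1)] assms(3))
    finally have "(norm (T x))\<^sup>2 * (norm (T x))\<^sup>2 \<le> (c * norm x)\<^sup>2 * (norm (T x))\<^sup>2"
      by (simp add: power2_eq_square algebra_simps)
    moreover have "(norm (T x))\<^sup>2 > 0" using False by simp
    ultimately have "(norm (T x))\<^sup>2 \<le> (c * norm x)\<^sup>2"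
      by (metis mult_le_cancel_right_pos)
    then show ?thesis using assms(3) by (simp add: power2_le_iff_abs_le)
  qed (simp add: assms(3))
qed (rule assms)

lemma psd_id_minus:
  assumes "psd T" and "c \<ge> 0" and "\<And>x. c * (T x \<bullet> x) \<le> (norm x)\<^sup>2"
  shows "psd (id_blinfun - c *\<^sub>R T)"
  using assms unfolding psd_def selfadjoint_def
  by (auto simp: blinfun.diff_left blinfun.scaleR_left inner_diff_left inner_diff_right
      power2_norm_eq_inner)

lemma inner_le_norm_sq:
  fixes T :: "'a::real_inner \<Rightarrow>\<^sub>L 'a"
  shows "T x \<bullet> x \<le> norm T * (norm x)\<^sup>2"
proof -
  have "T x \<bullet> x \<le> norm (T x) * norm x" by (rule norm_cauchy_schwarz)
  also have "\<dots> \<le> (norm T * norm x) * norm x" by (intro mult_right_mono norm_blinfun) auto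
  finally show ?thesis by (simp add: power2_eq_square algebra_simps)
qed

text \<open>If $B = 1 - T$ has norm at most one, then the solution of $Y = (B + Y^2)/2$ gives the root
  $1 - Y$ of $T$. The fixed point iteration converges in norm because it is majorised by the same
  iteration for the number $1$ in place of $B$, which increases to $1$.\<close>

lemma square_root_near_identity:
  fixes B :: "'a::{real_inner, banach} \<Rightarrow>\<^sub>L 'a"
  assumes B: "selfadjoint B" "norm B \<le> 1"
  obtains Y where "selfadjoint Y" "norm Y \<le> 1" "2 *\<^sub>R Y = B + (Y o\<^sub>L Y)"
proof -
  define Y where "Y = rec_nat 0 (\<lambda>_ Z. (1/2) *\<^sub>R (B + (Z o\<^sub>L Z)))"
  define y where "y = rec_nat (0::real) (\<lambda>_ z. (1 + z\<^sup>2) / 2)"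
  have Y0: "Y 0 = 0" and YS: "Y (Suc n) = (1/2) *\<^sub>R (B + (Y n o\<^sub>L Y n))" for n
    by (simp_all add: Y_def)
  have y0: "y 0 = 0" and yS: "y (Suc n) = (1 + (y n)\<^sup>2) / 2" for n
    by (simp_all add: y_def)
  have y_bounds: "0 \<le> y n \<and> y n \<le> 1" for n
    by (induction n) (auto simp: y0 yS abs_square_le_1)
  have Y_norm: "norm (Y n) \<le> y n" for n
  proof (induction n)
    case (Suc n)
    have "norm (Y (Suc n)) \<le> (norm B + norm (Y n o\<^sub>L Y n)) / 2"
      by (simp add: YS norm_triangle_ineq)
    also have "\<dots> \<le> (1 + (y n)\<^sup>2) / 2"
      using B(2) order_trans[OF norm_blinfun_compose mult_mono[OF Suc Suc]] y_bounds[of n]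
      by (simp add: power2_eq_square algebra_simps)
    finally show ?case by (simp add: yS)
  qed (simp add: Y0 y0)
  have y_mono: "y n \<le> y (Suc n)" for n
  proof -
    have "0 \<le> (1 - y n)\<^sup>2" by simp
    then show ?thesis by (simp add: yS power2_eq_square algebra_simps)
  qed
  have step: "norm (Y (Suc n) - Y n) \<le> y (Suc n) - y n" for n
  proof (induction n)
    case (Suc n)
    let ?D = "Y (Suc n) - Y n" and ?d = "y (Suc n) - y n"
    have "Y (Suc (Suc n)) - Y (Suc n) = (1/2) *\<^sub>R ((Y (Suc n) o\<^sub>L ?D) + (?D o\<^sub>L Y n))"
      by (rule blinfun_eqI) (simp add: YS[of "Suc n"] YS[of n] blinfun.diff_left blinfun.add_left
          blinfun.scaleR_left blinfun.diff_right algebra_simps)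
    also have "norm \<dots> \<le> (norm (Y (Suc n) o\<^sub>L ?D) + norm (?D o\<^sub>L Y n)) / 2"
      by (simp add: norm_triangle_ineq)
    also have "\<dots> \<le> (y (Suc n) * ?d + ?d * y n) / 2"
      using order_trans[OF norm_blinfun_compose mult_mono[OF Y_norm[of "Suc n"] Suc]]
        order_trans[OF norm_blinfun_compose mult_mono[OF Suc Y_norm[of n]]] y_bounds y_mono[of n]
      by simp
    also have "\<dots> = y (Suc (Suc n)) - y (Suc n)"
      using yS[of "Suc n"] yS[of n] by (simp add: power2_eq_square algebra_simps diff_divide_distrib add_divide_distrib)
    finally show ?case .
  qed (use B in \<open>simp add: YS yS Y0 y0\<close>)
  have diff: "norm (Y (n + k) - Y n) \<le> y (n + k) - y n" for n k
  proof (induction k)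
    case (Suc k)
    have "norm (Y (n + Suc k) - Y n) \<le> norm (Y (Suc (n + k)) - Y (n + k)) + norm (Y (n + k) - Y n)"
      using norm_triangle_ineq[of "Y (Suc (n + k)) - Y (n + k)" "Y (n + k) - Y n"] by simp
    with step[of "n + k"] Suc show ?case by simp
  qed simp
  have "incseq y" by (rule incseq_SucI) (rule y_mono)
  have "Bseq y"
    by (rule BseqI'[of _ 1]) (simp add: y_bounds)
  moreover have "\<forall>m. \<forall>n\<ge>m. y m \<le> y n"
    using \<open>incseq y\<close> unfolding incseq_def by blast
  ultimately have "convergent y" by (rule Bseq_mono_convergent)
  then have "Cauchy y" by (rule convergent_Cauchy)
  have "Cauchy Y"
  proof (rule CauchyI')
    fix e :: real assume "e > 0"
    with \<open>Cauchy y\<close> obtain M where M: "\<And>m n. m \<ge> M \<Longrightarrow> n \<ge> M \<Longrightarrow> norm (y m - y n) < e"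
      unfolding Cauchy_iff by blast
    show "\<exists>M. \<forall>m\<ge>M. \<forall>n>m. dist (Y m) (Y n) < e"
    proof (intro exI allI impI)
      fix m n assume "m \<ge> M" "n > m"
      then obtain k where k: "n = m + k" by (metis less_imp_add_positive)
      show "dist (Y m) (Y n) < e"
        using diff[of m k] M[of n m] \<open>m \<ge> M\<close> by (simp add: k dist_norm norm_minus_commute)
    qed
  qed
  then obtain Z where Z: "Y \<longlonglongrightarrow> Z" by (auto simp: convergent_eq_Cauchy[symmetric] convergent_def)
  have sa: "selfadjoint (Y n)" for n
    using B(1) by (induction n) (auto simp: Y0 YS selfadjoint_def blinfun.add_left blinfun.scaleR_left
        inner_add_left inner_add_right)
  have "selfadjoint Z"
    unfolding selfadjoint_def
  proof (intro allI)
    fix u v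
    have "(\<lambda>n. Y n u \<bullet> v) \<longlonglongrightarrow> Z u \<bullet> v" "(\<lambda>n. u \<bullet> Y n v) \<longlonglongrightarrow> u \<bullet> Z v"
      by (intro tendsto_intros Z blinfun.tendsto)+
    moreover have "(\<lambda>n. Y n u \<bullet> v) = (\<lambda>n. u \<bullet> Y n v)"
      using sa unfolding selfadjoint_def by blast
    ultimately show "Z u \<bullet> v = u \<bullet> Z v"
      by (metis LIMSEQ_unique)
  qed
  moreover have "norm Z \<le> 1"
    by (rule LIMSEQ_le_const2[OF tendsto_norm[OF Z]]) (use Y_norm y_bounds order_trans in blast)
  moreover have "2 *\<^sub>R Z = B + (Z o\<^sub>L Z)"
  proof -
    have "(\<lambda>n. 2 *\<^sub>R Y (Suc n)) \<longlonglongrightarrow> 2 *\<^sub>R Z"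
      by (intro tendsto_intros LIMSEQ_Suc Z)
    moreover have "(\<lambda>n. B + (Y n o\<^sub>L Y n)) \<longlonglongrightarrow> B + (Z o\<^sub>L Z)"
      by (intro tendsto_intros Z bounded_bilinear.tendsto[OF bounded_bilinear_blinfun_compose])
    ultimately show ?thesis
      unfolding YS by (simp add: LIMSEQ_unique[of "\<lambda>n. B + (Y n o\<^sub>L Y n)"])
  qed
  ultimately show thesis by (rule that)
qed

lemma psd_square_root:
  fixes T :: "'a::{real_inner, banach} \<Rightarrow>\<^sub>L 'a"
  assumes T: "psd T"
  obtains P where "psd P" "P o\<^sub>L P = T"
proof (cases "norm T = 0")
  case True
  then have "psd (0::'a \<Rightarrow>\<^sub>L 'a)" "(0::'a \<Rightarrow>\<^sub>L 'a) o\<^sub>L 0 = T"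
    by (auto simp: psd_def selfadjoint_def)
  then show thesis by (rule that)
next
  case False
  define c where "c = norm T"
  have c: "c > 0" using False by (simp add: c_def)
  define B where "B = id_blinfun - (1 / c) *\<^sub>R T"
  have "psd B"
    unfolding B_def using c inner_le_norm_sq[of T]
    by (intro psd_id_minus T) (auto simp: c_def field_simps)
  moreover have "B x \<bullet> x \<le> 1 * (norm x)\<^sup>2" for x
    using psdD[OF T, of x] c by (simp add: B_def blinfun.diff_left blinfun.scaleR_left inner_diff_left
      power2_norm_eq_inner)
  ultimately have "selfadjoint B" "norm B \<le> 1"
    by (auto simp: psd_selfadjoint intro: psd_norm_le)
  then obtain Y where Y: "selfadjoint Y" "norm Y \<le> 1" "2 *\<^sub>R Y = B + (Y o\<^sub>L Y)"
    by (rule square_root_near_identity)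
  define P where "P = sqrt c *\<^sub>R (id_blinfun - Y)"
  have Yx: "2 *\<^sub>R Y x = x - (1 / c) *\<^sub>R T x + Y (Y x)" for x
    using arg_cong[OF Y(3), of "\<lambda>f. blinfun_apply f x"]
    by (simp add: B_def blinfun.diff_left blinfun.scaleR_left blinfun.add_left)
  have "P o\<^sub>L P = T"
  proof (rule blinfun_eqI)
    fix x
    have "(P o\<^sub>L P) x = c *\<^sub>R (x - 2 *\<^sub>R Y x + Y (Y x))"
      using c by (simp add: P_def blinfun.diff_left blinfun.scaleR_left blinfun.diff_right
          blinfun.scaleR_right algebra_simps scaleR_2)
    also have "\<dots> = T x" unfolding Yx using c by (simp add: algebra_simps)
    finally show "(P o\<^sub>L P) x = T x" .
  qed
  moreover have "psd P"
    unfolding psd_def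
  proof (intro conjI allI)
    show "selfadjoint P"
      using Y(1) by (simp add: selfadjoint_def P_def blinfun.diff_left blinfun.scaleR_left
          inner_diff_left inner_diff_right)
    fix x
    have "Y x \<bullet> x \<le> norm Y * (norm x)\<^sup>2" by (rule inner_le_norm_sq)
    also have "\<dots> \<le> 1 * (norm x)\<^sup>2" by (intro mult_right_mono Y(2)) auto
    finally show "0 \<le> P x \<bullet> x"
      using c by (simp add: P_def blinfun.diff_left blinfun.scaleR_left inner_diff_left
          power2_norm_eq_inner)
  qed
  ultimately show thesis using that by blast
qed

lemma psd_add_eps:
  assumes "psd P" "e \<ge> 0"
  shows "psd (P + e *\<^sub>R id_blinfun)"
  using assms by (auto simp: psd_def selfadjoint_def blinfun.add_left blinfun.scaleR_left
      inner_add_left inner_add_right)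

text \<open>The equation $(P + \<epsilon>) w = x$ is the fixed point equation of
  $w \<mapsto> w - L^{-1}((P + \<epsilon>) w - x)$, a contraction for $L = \|P\| + \<epsilon>$.\<close>

lemma psd_add_eps_surj:
  fixes P :: "'a::{real_inner, banach} \<Rightarrow>\<^sub>L 'a"
  assumes P: "psd P" and e: "e > 0"
  obtains w where "P w + e *\<^sub>R w = x"
proof -
  define L where "L = norm P + e"
  have L: "L > 0" using e by (simp add: L_def add_nonneg_pos)
  define Q where "Q = P + e *\<^sub>R id_blinfun"
  have Q: "psd Q" unfolding Q_def using P e by (intro psd_add_eps) auto
  have Qx: "Q w \<bullet> w = P w \<bullet> w + e * (norm w)\<^sup>2" for w
    by (simp add: Q_def blinfun.add_left blinfun.scaleR_left inner_add_left power2_norm_eq_inner)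
  define B where "B = id_blinfun - (1 / L) *\<^sub>R Q"
  have QL: "(1 / L) * (Q w \<bullet> w) \<le> (norm w)\<^sup>2" for w
    using inner_le_norm_sq[of P w] L by (simp add: Qx field_simps) (simp add: L_def algebra_simps)
  have "psd B"
    unfolding B_def by (rule psd_id_minus[OF Q _ QL]) (use L in auto)
  moreover have "B w \<bullet> w \<le> (1 - e / L) * (norm w)\<^sup>2" for w
    using psdD[OF P, of w] L
    by (simp add: B_def Qx blinfun.diff_left blinfun.scaleR_left inner_diff_left
        power2_norm_eq_inner field_simps)
  moreover have eL: "0 \<le> 1 - e / L" "1 - e / L < 1"
    using L e by (auto simp: L_def)
  ultimately have nB: "norm B \<le> 1 - e / L" by (intro psd_norm_le) auto
  have "\<exists>!w. B w + (1 / L) *\<^sub>R x = w"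
  proof (rule banach_fix_type[of "1 - e / L"])
    show "\<forall>u v. dist (B u + (1 / L) *\<^sub>R x) (B v + (1 / L) *\<^sub>R x) \<le> (1 - e / L) * dist u v"
    proof (intro allI)
      fix u v
      have "norm (B (u - v)) \<le> norm B * norm (u - v)" by (rule norm_blinfun)
      also have "\<dots> \<le> (1 - e / L) * norm (u - v)" by (intro mult_right_mono nB) auto
      finally show "dist (B u + (1 / L) *\<^sub>R x) (B v + (1 / L) *\<^sub>R x) \<le> (1 - e / L) * dist u v"
        by (simp add: dist_norm blinfun.diff_right)
    qed
  qed (use eL in auto)
  then obtain w where "B w + (1 / L) *\<^sub>R x = w" by blast
  then have "(1 / L) *\<^sub>R (x - Q w) = 0"
    by (simp add: B_def blinfun.diff_left blinfun.scaleR_left algebra_simps)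
  then have "P w + e *\<^sub>R w = x"
    using L by (simp add: Q_def blinfun.add_left blinfun.scaleR_left)
  then show thesis by (rule that)
qed

lemma psd_norm_le_add_eps:
  assumes P: "psd P" and e: "e \<ge> 0"
  shows "norm (P w) \<le> norm (P w + e *\<^sub>R w)"
proof -
  have "(norm (P w))\<^sup>2 \<le> (norm (P w))\<^sup>2 + 2 * e * (P w \<bullet> w) + e\<^sup>2 * (norm w)\<^sup>2"
    using psdD[OF P, of w] e by simp
  also have "\<dots> = (norm (P w + e *\<^sub>R w))\<^sup>2"
    unfolding power2_norm_eq_inner inner_add_left inner_add_right inner_scaleR_left
        inner_scaleR_right inner_commute[of w "P w"] by (simp add: power2_eq_square algebra_simps)
  finally show ?thesis by (rule power2_le_imp_le) simp
qed

text \<open>The Loewner--Heinz inequality for the square root, in the form: $S^2 \<le> P^2$ implies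
  $\pm S \<le> P$. With $Q = P + \<epsilon>$, the operator $Q^{-1} S$ is a contraction, being the adjoint of
  $S Q^{-1}$, and it is symmetric for the inner product $\langle Qx, y\rangle$. Since its powers stay bounded,
  the Cauchy--Schwarz inequality for that inner product, used repeatedly on the powers with
  exponents $2^m$, forces $|\langle Sx, x\rangle| \<le> \langle Qx, x\rangle$.\<close>

theorem Loewner_Heinz:
  fixes P S :: "'a::{real_inner, banach} \<Rightarrow>\<^sub>L 'a"
  assumes P: "psd P" and S: "selfadjoint S" and le: "\<And>x. norm (S x) \<le> norm (P x)"
  shows "\<bar>S x \<bullet> x\<bar> \<le> P x \<bullet> x"
proof -
  have eps: "\<bar>S x \<bullet> x\<bar> \<le> P x \<bullet> x + e * (norm x)\<^sup>2" if e: "e > 0" for e :: real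
  proof -
    define Q where "Q = P + e *\<^sub>R id_blinfun"
    have Qv: "Q v = P v + e *\<^sub>R v" for v
      by (simp add: Q_def blinfun.add_left blinfun.scaleR_left)
    have Q: "psd Q" unfolding Q_def using P e by (intro psd_add_eps) auto
    have "\<exists>w. Q w = v" for v
      using psd_add_eps_surj[OF P e] unfolding Qv by metis
    then obtain q where q: "Q (q v) = v" for v by metis
    \<comment> \<open>\<open>z n\<close> is the image of \<open>x\<close> under the power \<open>n\<close> of the contraction\<close>
    define z where "z = rec_nat x (\<lambda>_ v. q (S v))"
    have z0: "z 0 = x" and Qz: "Q (z (Suc n)) = S (z n)" for n
      by (simp_all add: z_def q)
    have z_bound: "norm (z n) \<le> norm x" for n
    proof (induction n)
      case (Suc n)
      define u where "u = q (z (Suc n))"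
      have "(norm (z (Suc n)))\<^sup>2 = z (Suc n) \<bullet> Q u"
        by (simp add: u_def q power2_norm_eq_inner)
      also have "\<dots> = S (z n) \<bullet> u"
        using selfadjointD[OF psd_selfadjoint[OF Q], of "z (Suc n)" u] by (simp add: Qz)
      also have "\<dots> = z n \<bullet> S u" by (rule selfadjointD[OF S])
      also have "\<dots> \<le> norm (z n) * norm (S u)" by (rule norm_cauchy_schwarz)
      also have "\<dots> \<le> norm (z n) * norm (Q u)"
        using order_trans[OF le psd_norm_le_add_eps[OF P, of e u]] e
        by (intro mult_left_mono) (auto simp: Qv)
      also have "Q u = z (Suc n)" by (simp add: u_def q)
      finally have "norm (z (Suc n)) \<le> norm (z n)"
        by (cases "z (Suc n) = 0") (auto simp: power2_eq_square)
      with Suc show ?case by simp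
    qed (simp add: z0)
    define b where "b k = Q (z 0) \<bullet> z k" for k
    have swap: "Q (z (Suc i)) \<bullet> z j = Q (z i) \<bullet> z (Suc j)" for i j
      using selfadjointD[OF S, of "z i" "z j"] selfadjointD[OF psd_selfadjoint[OF Q], of "z i" "z (Suc j)"]
      by (simp add: Qz)
    have shift: "Q (z i) \<bullet> z j = b (i + j)" for i j
      by (induction i arbitrary: j) (simp_all add: b_def swap)
    have b_bound: "\<bar>b k\<bar> \<le> norm Q * (norm x)\<^sup>2" for k
    proof -
      have "\<bar>b k\<bar> \<le> norm (Q (z 0)) * norm (z k)" unfolding b_def by (rule Cauchy_Schwarz_ineq2)
      also have "\<dots> \<le> (norm Q * norm x) * norm x"
        using norm_blinfun[of Q "z 0"] by (intro mult_mono z_bound) (auto simp: z0)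
      finally show ?thesis by (simp add: power2_eq_square algebra_simps)
    qed
    have b_CS: "(b k)\<^sup>2 \<le> b 0 * b (2 * k)" for k
      using psd_Cauchy_Schwarz[OF Q, of "z 0" "z k"] shift[of k k] shift[of 0 k] shift[of 0 0]
      by (simp add: mult_2)
    have b0: "b 0 \<ge> 0" using psdD[OF Q] by (simp add: b_def)
    \<comment> \<open>otherwise the values at the exponents $2^m$ would grow beyond every bound\<close>
    have "\<bar>b 1\<bar> \<le> b 0"
    proof (rule ccontr)
      assume "\<not> ?thesis"
      then have gt: "\<bar>b 1\<bar> > b 0" by simp
      have "b 0 > 0" using b_CS[of 1] b0 gt by (cases "b 0 = 0") auto
      define r where "r = \<bar>b 1\<bar> / b 0"
      have r: "r > 1" using gt \<open>b 0 > 0\<close> by (simp add: r_def)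
      have grow: "b 0 * r ^ (2 ^ m) \<le> \<bar>b (2 ^ m)\<bar>" for m
      proof (induction m)
        case (Suc m)
        have "b 0 * (b 0 * r ^ (2 ^ Suc m)) = (b 0 * r ^ (2 ^ m))\<^sup>2"
          by (simp add: power2_eq_square power_add mult_2 algebra_simps)
        also have "\<dots> \<le> \<bar>b (2 ^ m)\<bar>\<^sup>2"
          using b0 r by (intro power_mono Suc) auto
        also have "\<dots> \<le> b 0 * \<bar>b (2 ^ Suc m)\<bar>"
          using b_CS[of "2 ^ m"] b0 by simp (meson abs_ge_self mult_left_mono order_trans)
        finally show ?case using \<open>b 0 > 0\<close> by simp
      qed (use \<open>b 0 > 0\<close> in \<open>simp add: r_def\<close>)
      obtain n where n: "norm Q * (norm x)\<^sup>2 / b 0 < r ^ n"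
        using real_arch_pow[OF r] by blast
      also have "r ^ n \<le> r ^ (2 ^ n)"
        using r by (intro power_increasing) (auto simp: less_imp_le)
      finally have "norm Q * (norm x)\<^sup>2 < b 0 * r ^ (2 ^ n)"
        using \<open>b 0 > 0\<close> by (simp add: field_simps)
      with grow[of n] b_bound[of "2 ^ n"] show False by simp
    qed
    moreover have "b 1 = S x \<bullet> x"
      using shift[of 1 0] Qz[of 0] by (simp add: z0)
    moreover have "b 0 = P x \<bullet> x + e * (norm x)\<^sup>2"
      by (simp add: b_def z0 Qv inner_add_left power2_norm_eq_inner)
    ultimately show ?thesis by simp
  qed
  show ?thesis
  proof (rule field_le_epsilon)
    fix d :: real assume d: "d > 0"
    define N where "N = (norm x)\<^sup>2 + 1"
    have N: "N > 0" "(norm x)\<^sup>2 \<le> N" by (simp_all add: N_def add_nonneg_pos)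
    have "\<bar>S x \<bullet> x\<bar> \<le> P x \<bullet> x + d / N * (norm x)\<^sup>2" using d N by (intro eps) auto
    also have "d / N * (norm x)\<^sup>2 \<le> d / N * N" using d N by (intro mult_left_mono) auto
    finally show "\<bar>S x \<bullet> x\<bar> \<le> P x \<bullet> x + d" using N by simp
  qed
qed

lemma selfadjoint_quadratic_eq:
  assumes "selfadjoint P" "selfadjoint Q" "\<And>x. P x \<bullet> x = Q x \<bullet> x"
  shows "P = Q"
proof (rule blinfun_eqI)
  fix x
  have "P x \<bullet> y = Q x \<bullet> y" for y
    using assms(3)[of "x + y"] assms(3)[of x] assms(3)[of y] assms(1,2)[THEN selfadjointD, of y x]
    by (simp add: blinfun.add_right inner_add_left inner_add_right inner_commute)
  then show "P x = Q x" by (metis vector_eq_rdot)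
qed

text \<open>Uniqueness of positive square roots: the two operators dominate each other.\<close>

lemma psd_norm_eq_unique:
  fixes P Q :: "'a::{real_inner, banach} \<Rightarrow>\<^sub>L 'a"
  assumes "psd P" "psd Q" "\<And>x. norm (P x) = norm (Q x)"
  shows "P = Q"
proof (rule selfadjoint_quadratic_eq)
  fix x
  show "P x \<bullet> x = Q x \<bullet> x"
    using Loewner_Heinz[of P Q x] Loewner_Heinz[of Q P x] assms psdD[of P x] psdD[of Q x]
    by (auto simp: psd_selfadjoint)
qed (use assms in \<open>auto simp: psd_selfadjoint\<close>)

section \<open>The Hilbert space of square summable sequences\<close>

lemma ell2_bound:
  assumes "\<And>N. (\<Sum>n<N. (cmod (x n))\<^sup>2) \<le> C"
  shows "x \<in> ell2" "(\<Sum>n. (cmod (x n))\<^sup>2) \<le> C"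
proof -
  have "summable (\<lambda>n. (cmod (x n))\<^sup>2)"
    by (rule summableI_nonneg_bounded) (use assms in auto)
  then show "x \<in> ell2" "(\<Sum>n. (cmod (x n))\<^sup>2) \<le> C"
    by (auto simp: ell2_def intro: suminf_le_const assms)
qed

lemma ell2_mult_summable:
  assumes "x \<in> ell2" "y \<in> ell2"
  shows "summable (\<lambda>n. cmod (x n) * cmod (y n))"
proof (rule summable_comparison_test)
  show "summable (\<lambda>n. (cmod (x n))\<^sup>2 + (cmod (y n))\<^sup>2)"
    using assms by (intro summable_add) (auto simp: ell2_def)
  have "cmod (x n) * cmod (y n) \<le> (cmod (x n))\<^sup>2 + (cmod (y n))\<^sup>2" for n
    using sum_squares_bound[of "cmod (x n)" "cmod (y n)"]
      mult_nonneg_nonneg[OF norm_ge_zero norm_ge_zero, of "x n" "y n"] by linarith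
  then show "\<exists>N. \<forall>n\<ge>N. norm (cmod (x n) * cmod (y n)) \<le> (cmod (x n))\<^sup>2 + (cmod (y n))\<^sup>2"
    by simp
qed

lemma ell2_add:
  assumes "x \<in> ell2" "y \<in> ell2"
  shows "(\<lambda>n. x n + y n) \<in> ell2"
  unfolding ell2_def mem_Collect_eq
proof (rule summable_comparison_test)
  show "summable (\<lambda>n. 2 * (cmod (x n))\<^sup>2 + 2 * (cmod (y n))\<^sup>2)"
    using assms by (intro summable_add summable_mult) (auto simp: ell2_def)
  have "(cmod (x n + y n))\<^sup>2 \<le> 2 * (cmod (x n))\<^sup>2 + 2 * (cmod (y n))\<^sup>2" for n
  proof -
    have "(cmod (x n + y n))\<^sup>2 \<le> (cmod (x n) + cmod (y n))\<^sup>2"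
      by (intro power_mono norm_triangle_ineq) auto
    also have "\<dots> \<le> 2 * (cmod (x n))\<^sup>2 + 2 * (cmod (y n))\<^sup>2"
      using sum_squares_bound[of "cmod (x n)" "cmod (y n)"] by (simp add: power2_sum)
    finally show ?thesis .
  qed
  then show "\<exists>N. \<forall>n\<ge>N. norm ((cmod (x n + y n))\<^sup>2) \<le> 2 * (cmod (x n))\<^sup>2 + 2 * (cmod (y n))\<^sup>2"
    by simp
qed

lemma ell2_cmult: "x \<in> ell2 \<Longrightarrow> (\<lambda>n. c * x n) \<in> ell2"
  by (auto simp: ell2_def norm_mult power_mult_distrib intro: summable_mult)

lemma ell2_cnj: "x \<in> ell2 \<Longrightarrow> (\<lambda>n. cnj (x n)) \<in> ell2"
  by (simp add: ell2_def)

text \<open>The square summable sequences as a type, regarded as a real Hilbert space: the operator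
  $x \<mapsto> \overline{Ax}$ that is central below is only real-linear.\<close>

typedef l2 = ell2
  by (rule exI[of _ "\<lambda>_. 0"]) (simp add: ell2_def)

setup_lifting type_definition_l2

lift_definition coord :: "l2 \<Rightarrow> nat \<Rightarrow> complex" is "\<lambda>x. x" .

lemma coord_ell2 [simp]: "coord x \<in> ell2"
  by transfer

lemma l2_eqI: "(\<And>n. coord x n = coord y n) \<Longrightarrow> x = y"
  by transfer auto

lemma l2_of_ell2:
  assumes "f \<in> ell2" obtains x where "\<And>n. coord x n = f n"
  using assms by transfer auto

instantiation l2 :: real_vector
begin
lift_definition zero_l2 :: l2 is "\<lambda>_. 0" by (simp add: ell2_def)
lift_definition plus_l2 :: "l2 \<Rightarrow> l2 \<Rightarrow> l2" is "\<lambda>x y n. x n + y n" by (rule ell2_add)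
lift_definition uminus_l2 :: "l2 \<Rightarrow> l2" is "\<lambda>x n. - x n" by (simp add: ell2_def)
lift_definition minus_l2 :: "l2 \<Rightarrow> l2 \<Rightarrow> l2" is "\<lambda>x y n. x n - y n"
proof -
  fix x y :: "nat \<Rightarrow> complex" assume "x \<in> ell2" "y \<in> ell2"
  then show "(\<lambda>n. x n - y n) \<in> ell2" using ell2_add[of x "\<lambda>n. - y n"] by (simp add: ell2_def)
qed
lift_definition scaleR_l2 :: "real \<Rightarrow> l2 \<Rightarrow> l2" is "\<lambda>r x n. complex_of_real r * x n"
  by (rule ell2_cmult)
instance by standard (transfer; auto simp: algebra_simps)+
end

lemma coord_simps [simp]:
  "coord 0 n = 0" "coord (x + y) n = coord x n + coord y n" "coord (- x) n = - coord x n"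
  "coord (x - y) n = coord x n - coord y n" "coord (r *\<^sub>R x) n = complex_of_real r * coord x n"
  by (transfer; simp)+

lemma coord_sum [simp]: "coord (\<Sum>i\<in>I. f i) n = (\<Sum>i\<in>I. coord (f i) n)"
  by (induction I rule: infinite_finite_induct) auto

lemma l2_inner_summable: "summable (\<lambda>n. coord x n * cnj (coord y n))"
  by (rule summable_norm_cancel) (simp add: norm_mult ell2_mult_summable)

lemma l2_inner_summable_Re: "summable (\<lambda>n. Re (coord x n * cnj (coord y n)))"
  by (rule summable_Re[OF l2_inner_summable])

lemma l2_sq_summable: "summable (\<lambda>n. (cmod (coord x n))\<^sup>2)"
  using coord_ell2[of x] by (simp add: ell2_def)

instantiation l2 :: real_inner
begin
definition inner_l2 :: "l2 \<Rightarrow> l2 \<Rightarrow> real" where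
  "inner_l2 x y = (\<Sum>n. Re (coord x n * cnj (coord y n)))"
definition norm_l2 :: "l2 \<Rightarrow> real" where
  "norm_l2 x = sqrt (inner x x)"
definition sgn_l2 :: "l2 \<Rightarrow> l2" where
  "sgn_l2 x = inverse (norm x) *\<^sub>R x"
definition dist_l2 :: "l2 \<Rightarrow> l2 \<Rightarrow> real" where
  "dist_l2 x y = norm (x - y)"
definition [code del]: "(uniformity :: (l2 \<times> l2) filter) = (INF e\<in>{0<..}. principal {(x, y). dist x y < e})"
definition open_l2 :: "l2 set \<Rightarrow> bool" where
  [code del]: "open_l2 U \<longleftrightarrow> (\<forall>x\<in>U. eventually (\<lambda>(x', y). x' = x \<longrightarrow> y \<in> U) uniformity)"
instance
proof
  fix x y z :: l2 and r :: real
  show "inner x y = inner y x"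
    by (simp add: inner_l2_def algebra_simps)
  show "inner (x + y) z = inner x z + inner y z"
    unfolding inner_l2_def
    by (subst suminf_add[OF l2_inner_summable_Re l2_inner_summable_Re]) (simp add: algebra_simps)
  show "inner (r *\<^sub>R x) y = r * inner x y"
    unfolding inner_l2_def
    by (subst suminf_mult[OF l2_inner_summable_Re, symmetric]) (simp add: algebra_simps)
  have sq: "Re (coord x n * cnj (coord x n)) = (cmod (coord x n))\<^sup>2" for n
    by (simp add: cmod_power2) (simp add: power2_eq_square)
  show "0 \<le> inner x x"
    unfolding inner_l2_def sq by (intro suminf_nonneg l2_sq_summable) auto
  show "inner x x = 0 \<longleftrightarrow> x = 0"
    unfolding inner_l2_def sq
    by (subst suminf_eq_zero_iff[OF l2_sq_summable]) (auto intro: l2_eqI)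
  show "norm x = sqrt (inner x x)" by (rule norm_l2_def)
qed (auto simp: sgn_l2_def dist_l2_def open_l2_def uniformity_l2_def)
end

lemma norm_l2_eq: "norm x = ell2_norm (coord x)"
  by (simp add: norm_l2_def inner_l2_def ell2_norm_def cmod_power2)
     (simp add: power2_eq_square)

lemma norm_l2_power2: "(norm x)\<^sup>2 = (\<Sum>n. (cmod (coord x n))\<^sup>2)" for x :: l2
  by (simp add: norm_l2_eq ell2_norm_def suminf_nonneg l2_sq_summable)

lemma inner_l2_Re: "x \<bullet> y = Re (ell2_inner (coord x) (coord y))"
  unfolding inner_l2_def ell2_inner_def using l2_inner_summable by (rule Re_suminf[symmetric])

lemma sum_coord_le_norm: "(\<Sum>n<N. (cmod (coord x n))\<^sup>2) \<le> (norm x)\<^sup>2"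
  unfolding norm_l2_power2 by (intro sum_le_suminf l2_sq_summable) auto

lemma cmod_coord_le: "cmod (coord x n) \<le> norm x"
proof -
  have "(cmod (coord x n))\<^sup>2 \<le> (\<Sum>k<Suc n. (cmod (coord x k))\<^sup>2)"
    by (simp add: sum_nonneg)
  also have "\<dots> \<le> (norm x)\<^sup>2" by (rule sum_coord_le_norm)
  finally show ?thesis by (rule power2_le_imp_le) simp
qed

lemma bounded_linear_coord: "bounded_linear (\<lambda>x. coord x n)"
  by (rule bounded_linear_intro[where K = 1]) (auto simp: cmod_coord_le scaleR_conv_of_real)

instance l2 :: banach
proof
  fix X :: "nat \<Rightarrow> l2" assume C: "Cauchy X"
  have "Cauchy (\<lambda>m. coord (X m) n)" for n
    by (rule bounded_linear.Cauchy[OF bounded_linear_coord C])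
  then have "\<exists>l. (\<lambda>m. coord (X m) n) \<longlonglongrightarrow> l" for n
    by (simp add: convergent_eq_Cauchy)
  then obtain f where f: "\<And>n. (\<lambda>m. coord (X m) n) \<longlonglongrightarrow> f n" by metis
  have tail: "(\<Sum>n<N. (cmod (f n - coord (X m) n))\<^sup>2) \<le> e\<^sup>2"
    if e: "\<And>k. k \<ge> m \<Longrightarrow> norm (X k - X m) \<le> e" for m N e
  proof (rule LIMSEQ_le_const2)
    show "(\<lambda>k. \<Sum>n<N. (cmod (coord (X k) n - coord (X m) n))\<^sup>2)
        \<longlonglongrightarrow> (\<Sum>n<N. (cmod (f n - coord (X m) n))\<^sup>2)"
      by (intro tendsto_intros f)
    have "(\<Sum>n<N. (cmod (coord (X k) n - coord (X m) n))\<^sup>2) \<le> e\<^sup>2" if "k \<ge> m" for k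
      using sum_coord_le_norm[of "X k - X m" N] power_mono[OF e[OF that], of 2] by simp
    then show "\<exists>M. \<forall>k\<ge>M. (\<Sum>n<N. (cmod (coord (X k) n - coord (X m) n))\<^sup>2) \<le> e\<^sup>2" by blast
  qed
  have Cauchy': "\<exists>m. \<forall>k\<ge>m. norm (X k - X m) \<le> e" if "e > 0" for e
    using C that unfolding Cauchy_iff by (meson less_imp_le order_refl)
  obtain m where "\<forall>k\<ge>m. norm (X k - X m) \<le> 1" using Cauchy'[of 1] by auto
  then have "(\<lambda>n. f n - coord (X m) n) \<in> ell2" using ell2_bound(1)[OF tail[of m 1]] by simp
  then have "f \<in> ell2"
    using ell2_add[of "\<lambda>n. f n - coord (X m) n" "coord (X m)"] by simp
  then obtain x where x: "\<And>n. coord x n = f n" by (rule l2_of_ell2) auto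
  have "X \<longlonglongrightarrow> x"
  proof (rule LIMSEQ_I)
    fix r :: real assume r: "r > 0"
    then obtain m where m: "\<And>k. k \<ge> m \<Longrightarrow> norm (X k - X m) \<le> r / 3" using Cauchy'[of "r / 3"] by auto
    have "(norm (x - X m))\<^sup>2 \<le> (r / 3)\<^sup>2"
      using ell2_bound(2)[OF tail[OF m]] by (simp add: norm_l2_power2 x)
    then have "norm (x - X m) \<le> r / 3" by (rule power2_le_imp_le) (use r in simp)
    then have "norm (X k - x) < r" if "k \<ge> m" for k
      using m[OF that] norm_triangle_ineq[of "X k - X m" "X m - x"] r by (simp add: norm_minus_commute)
    then show "\<exists>no. \<forall>n\<ge>no. norm (X n - x) < r" by blast
  qed
  then show "convergent X" by (auto simp: convergent_def)
qed

lift_definition single :: "nat \<Rightarrow> complex \<Rightarrow> l2" is "\<lambda>j c n. if n = j then c else 0"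
proof -
  fix j :: nat and c :: complex
  have "(\<lambda>n. (cmod (if n = j then c else 0))\<^sup>2) = (\<lambda>n. if n = j then (cmod c)\<^sup>2 else 0)" by auto
  then show "(\<lambda>n. if n = j then c else 0) \<in> ell2"
    by (simp add: ell2_def sums_summable[OF sums_single])
qed

lemma coord_single [simp]: "coord (single j c) n = (if n = j then c else 0)"
  by transfer simp

lemma coord_sum_single: "coord (\<Sum>j<N. single j (x j)) n = (if n < N then x n else 0)"
  by simp

lemma norm_sum_single: "(norm (\<Sum>j<N. single j (x j)))\<^sup>2 = (\<Sum>j<N. (cmod (x j))\<^sup>2)"
proof -
  have "(norm (\<Sum>j<N. single j (x j)))\<^sup>2 = (\<Sum>n<N. (cmod (coord (\<Sum>j<N. single j (x j)) n))\<^sup>2)"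
    unfolding norm_l2_power2 by (rule suminf_finite) (auto simp: coord_sum_single simp del: coord_sum)
  then show ?thesis by (simp add: coord_sum_single del: coord_sum)
qed

lemma norm_single [simp]: "norm (single j c) = cmod c"
proof -
  have "(norm (single j c))\<^sup>2 = (\<Sum>n\<in>{j}. (cmod (coord (single j c) n))\<^sup>2)"
    unfolding norm_l2_power2 by (rule suminf_finite) auto
  then show ?thesis by (simp add: power2_eq_iff_nonneg)
qed

lemma l2_expansion: "(\<lambda>N. \<Sum>j<N. single j (coord x j)) \<longlonglongrightarrow> x"
proof (rule LIM_zero_cancel, rule tendsto_norm_zero_cancel)
  define t where "t N = (norm ((\<Sum>j<N. single j (coord x j)) - x))\<^sup>2" for N
  have "t N = (\<Sum>n. (cmod (coord x (n + N)))\<^sup>2)" for N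
  proof -
    have "t N = (\<Sum>n. if n < N then 0 else (cmod (coord x n))\<^sup>2)"
      unfolding t_def norm_l2_power2
      by (intro suminf_cong) (simp add: coord_sum_single del: coord_sum)
    also have "\<dots> = (\<Sum>n. (cmod (coord x (n + N)))\<^sup>2)"
    proof (subst suminf_split_initial_segment[where k = N])
      show "summable (\<lambda>n. if n < N then 0 else (cmod (coord x n))\<^sup>2)"
        by (rule summable_comparison_test'[OF l2_sq_summable[of x], of 0]) auto
    qed simp
    finally show ?thesis .
  qed
  then have "t \<longlonglongrightarrow> 0"
    using suminf_exist_split2[OF l2_sq_summable[of x]] by presburger
  then have "(\<lambda>N. sqrt (t N)) \<longlonglongrightarrow> sqrt 0" by (rule tendsto_real_sqrt)
  then show "(\<lambda>N. norm ((\<Sum>j<N. single j (coord x j)) - x)) \<longlonglongrightarrow> 0"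
    by (simp add: t_def)
qed

lemma l2_linear_sums:
  assumes "bounded_linear F"
  shows "(\<lambda>j. F (single j (coord x j))) sums F x"
  unfolding sums_def
  using bounded_linear.tendsto[OF assms l2_expansion[of x]]
  by (simp add: linear_sum[OF bounded_linear.linear[OF assms]])

lemma l2_linear_ext:
  assumes "bounded_linear F" "bounded_linear G" "\<And>j c. F (single j c) = G (single j c)"
  shows "F x = G x"
  using l2_linear_sums[OF assms(1), of x] l2_linear_sums[OF assms(2), of x] assms(3)
  by (simp add: sums_unique2)

lemma blinfun_l2_ext: "(\<And>j c. blinfun_apply F (single j c) = blinfun_apply G (single j c)) \<Longrightarrow> F = G"
  by (rule blinfun_eqI) (rule l2_linear_ext; simp add: blinfun.bounded_linear_right)

lift_definition cscale :: "complex \<Rightarrow> l2 \<Rightarrow> l2" is "\<lambda>c x n. c * x n"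
  by (rule ell2_cmult)

lemma coord_cscale [simp]: "coord (cscale c x) n = c * coord x n"
  by transfer simp

lemma norm_cscale [simp]: "norm (cscale c x) = cmod c * norm x"
proof -
  have "(norm (cscale c x))\<^sup>2 = (cmod c * norm x)\<^sup>2"
    by (simp add: norm_l2_power2 power_mult_distrib norm_mult suminf_mult l2_sq_summable)
  then show ?thesis by (simp add: power2_eq_iff_nonneg)
qed

lemma cscale_inner: "cscale c x \<bullet> y = x \<bullet> cscale (cnj c) y"
  by (simp add: inner_l2_def mult.assoc mult.left_commute)

lemma bounded_linear_cscale: "bounded_linear (cscale c)"
  by (rule bounded_linear_intro[where K = "cmod c"])
     (auto intro!: l2_eqI simp: algebra_simps)

lemma ell2_inner_coord: "ell2_inner (coord x) (coord y) = Complex (x \<bullet> y) (x \<bullet> cscale \<i> y)"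
proof (rule complex_eqI)
  have "x \<bullet> cscale \<i> y = (\<Sum>n. Im (coord x n * cnj (coord y n)))"
    by (simp add: inner_l2_def)
  then show "Im (ell2_inner (coord x) (coord y)) = Im (Complex (x \<bullet> y) (x \<bullet> cscale \<i> y))"
    by (simp add: ell2_inner_def Im_suminf l2_inner_summable)
qed (simp add: inner_l2_Re)

section \<open>Matrices and operators\<close>

lemma single_cscale: "single j c = cscale c (single j 1)"
  by (rule l2_eqI) simp

lemma ell2_eq_range_coord: "ell2 = range coord"
proof
  show "ell2 \<subseteq> range coord"
  proof
    fix f assume "f \<in> ell2"
    then obtain x where "\<And>n. coord x n = f n" by (rule l2_of_ell2) auto
    then have "f = coord x" by auto
    then show "f \<in> range coord" by simp
  qed
qed auto

lemma cscale_cscale [simp]: "cscale c (cscale d x) = cscale (c * d) x"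
  by (rule l2_eqI) (simp add: mult.assoc)

lemma cscale_one [simp]: "cscale 1 x = x"
  by (rule l2_eqI) simp

lemma inner_single: "z \<bullet> single j c = Re (coord z j * cnj c)"
proof -
  have "z \<bullet> single j c = (\<Sum>n\<in>{j}. Re (coord z n * cnj (coord (single j c) n)))"
    unfolding inner_l2_def by (rule suminf_finite) auto
  then show ?thesis by simp
qed

definition mat_op :: "inf_matrix \<Rightarrow> l2 \<Rightarrow>\<^sub>L l2" where
  "mat_op A = (SOME T. \<forall>x. coord (blinfun_apply T x) = mat_apply A (coord x))"

lemma bounded_matrix_summable:
  "bounded_matrix A \<Longrightarrow> summable (\<lambda>j. A i j * coord x j)"
  by (auto simp: bounded_matrix_def)

lemma coord_mat_op:
  assumes A: "bounded_matrix A"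
  shows "coord (mat_op A x) n = mat_apply A (coord x) n"
proof -
  have "\<exists>y. coord y = mat_apply A (coord x)" for x
  proof -
    have "mat_apply A (coord x) \<in> range coord"
      using A coord_ell2[of x] unfolding bounded_matrix_def ell2_eq_range_coord by blast
    then show ?thesis by auto
  qed
  then obtain F where F: "\<And>x. coord (F x) = mat_apply A (coord x)" by metis
  obtain K where K: "\<And>x. x \<in> ell2 \<Longrightarrow> ell2_norm (mat_apply A x) \<le> K * ell2_norm x"
    using A by (auto simp: bounded_matrix_def)
  have "bounded_linear F"
  proof (rule bounded_linear_intro[where K = K])
    fix x y r
    show "F (x + y) = F x + F y"
      by (rule l2_eqI) (simp add: F mat_apply_def suminf_add bounded_matrix_summable[OF A] distrib_left)
    show "F (r *\<^sub>R x) = r *\<^sub>R F x"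
      by (rule l2_eqI)
         (simp add: F mat_apply_def suminf_mult[symmetric] bounded_matrix_summable[OF A] mult.left_commute)
    show "norm (F x) \<le> norm x * K"
      using K[OF coord_ell2, of x] by (simp add: norm_l2_eq F mult.commute)
  qed
  then have "\<forall>x. coord (blinfun_apply (Blinfun F) x) = mat_apply A (coord x)"
    by (simp add: bounded_linear_Blinfun_apply F)
  then have "\<forall>x. coord (mat_op A x) = mat_apply A (coord x)"
    unfolding mat_op_def by (rule someI)
  then show ?thesis by simp
qed

lemma mat_op_single:
  assumes "bounded_matrix A"
  shows "coord (mat_op A (single j c)) n = A n j * c"
proof -
  have "mat_apply A (coord (single j c)) n = (\<Sum>k\<in>{j}. A n k * coord (single j c) k)"
    unfolding mat_apply_def by (rule suminf_finite) auto
  then show ?thesis using assms by (simp add: coord_mat_op)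
qed

lemma mat_op_cscale:
  assumes "bounded_matrix A"
  shows "mat_op A (cscale c x) = cscale c (mat_op A x)"
  using assms by (intro l2_eqI)
    (simp add: coord_mat_op mat_apply_def suminf_mult[symmetric] bounded_matrix_summable mult.left_commute)

definition op_mat :: "(l2 \<Rightarrow>\<^sub>L l2) \<Rightarrow> inf_matrix" where
  "op_mat T = (\<lambda>i j. coord (T (single j 1)) i)"

lemma op_mat_sums:
  fixes T :: "l2 \<Rightarrow>\<^sub>L l2"
  assumes T: "\<And>c x. T (cscale c x) = cscale c (T x)"
  shows "(\<lambda>j. op_mat T i j * coord x j) sums coord (T x) i"
proof -
  have "bounded_linear (\<lambda>x. coord (T x) i)"
    by (rule bounded_linear_compose[OF bounded_linear_coord blinfun.bounded_linear_right])
  from l2_linear_sums[OF this, of x] show ?thesis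
    by (simp add: op_mat_def single_cscale[of _ "coord x _"] T mult.commute)
qed

lemma mat_apply_op_mat:
  fixes T :: "l2 \<Rightarrow>\<^sub>L l2"
  assumes T: "\<And>c x. T (cscale c x) = cscale c (T x)"
  shows "mat_apply (op_mat T) (coord x) = coord (T x)"
  by (rule ext) (simp add: mat_apply_def sums_unique[OF op_mat_sums, symmetric] T)

lemma bounded_matrix_op_mat:
  fixes T :: "l2 \<Rightarrow>\<^sub>L l2"
  assumes T: "\<And>c x. T (cscale c x) = cscale c (T x)"
  shows "bounded_matrix (op_mat T)"
  unfolding bounded_matrix_def
proof (intro conjI ballI allI exI)
  fix x :: "nat \<Rightarrow> complex" assume "x \<in> ell2"
  then obtain z where z: "x = coord z" unfolding ell2_eq_range_coord by blast
  show "summable (\<lambda>j. op_mat T i j * x j)" for i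
    unfolding z using op_mat_sums[of T, OF T] by (rule sums_summable)
  show "mat_apply (op_mat T) x \<in> ell2"
    unfolding z by (simp add: mat_apply_op_mat T)
  show "ell2_norm (mat_apply (op_mat T) x) \<le> norm T * ell2_norm x"
    unfolding z using norm_blinfun[of T z] by (simp add: mat_apply_op_mat T norm_l2_eq)
qed

lemma mat_op_op_mat:
  fixes T :: "l2 \<Rightarrow>\<^sub>L l2"
  assumes T: "\<And>c x. T (cscale c x) = cscale c (T x)"
  shows "mat_op (op_mat T) = T"
  by (rule blinfun_eqI, rule l2_eqI)
     (simp add: coord_mat_op bounded_matrix_op_mat T mat_apply_op_mat)

lemma op_mat_mat_op:
  assumes "bounded_matrix A"
  shows "op_mat (mat_op A) = A"
  using assms by (intro ext) (simp add: op_mat_def mat_op_single)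

text \<open>For a complex-linear operator, positivity of the complex quadratic form already contains
  symmetry, by polarisation of the vanishing imaginary part.\<close>

lemma positive_matrix_iff_psd:
  assumes A: "bounded_matrix A"
  shows "positive_matrix A \<longleftrightarrow> psd (mat_op A)"
proof -
  let ?T = "mat_op A"
  have lin: "?T (cscale c x) = cscale c (?T x)" for c x by (rule mat_op_cscale[OF A])
  have app: "mat_apply A (coord x) = coord (?T x)" for x
    by (rule ext) (simp add: coord_mat_op[OF A])
  have all: "(\<forall>x\<in>ell2. Q x) \<longleftrightarrow> (\<forall>z. Q (coord z))" for Q
    unfolding ell2_eq_range_coord by blast
  have eq: "positive_matrix A \<longleftrightarrow> (\<forall>x. ?T x \<bullet> cscale \<i> x = 0 \<and> 0 \<le> ?T x \<bullet> x)"
    using A by (auto simp: positive_matrix_def all app ell2_inner_coord complex_nonneg_Reals_iff)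
  have rot: "x \<bullet> cscale \<i> y = - (cscale \<i> x \<bullet> y)" for x y
  proof -
    have "cscale (- \<i>) y = - cscale \<i> y" by (rule l2_eqI) simp
    then show ?thesis by (simp add: cscale_inner)
  qed
  show ?thesis
    unfolding eq psd_def
  proof (intro iffI conjI allI)
    assume *: "\<forall>x. ?T x \<bullet> cscale \<i> x = 0 \<and> 0 \<le> ?T x \<bullet> x"
    show "selfadjoint ?T"
      unfolding selfadjoint_def
    proof (intro allI)
      fix x y
      \<comment> \<open>chosen so that the polarised imaginary part is a real inner product with \<open>y\<close>\<close>
      define w where "w = cscale (- \<i>) y"
      have iw: "cscale \<i> w = y" by (simp add: w_def)
      have "?T (x + w) \<bullet> cscale \<i> (x + w) = 0" "?T x \<bullet> cscale \<i> x = 0" "?T w \<bullet> cscale \<i> w = 0"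
        using * by auto
      then have "?T x \<bullet> y + ?T w \<bullet> cscale \<i> x = 0"
        by (simp add: blinfun.add_right linear_add[OF bounded_linear.linear[OF bounded_linear_cscale]]
            inner_add_left inner_add_right iw)
      moreover have "?T w \<bullet> cscale \<i> x = - (x \<bullet> ?T y)"
      proof -
        have "?T w \<bullet> cscale \<i> x = - (cscale \<i> (?T w) \<bullet> x)" by (rule rot)
        also have "cscale \<i> (?T w) = ?T y" by (simp only: lin[symmetric] iw)
        finally show ?thesis by (simp only: inner_commute)
      qed
      ultimately show "?T x \<bullet> y = x \<bullet> ?T y" by simp
    qed
    show "0 \<le> ?T x \<bullet> x" for x using * by blast
  next
    fix x assume *: "selfadjoint ?T \<and> (\<forall>x. 0 \<le> ?T x \<bullet> x)"
    then show "0 \<le> ?T x \<bullet> x" by blast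
    have "?T x \<bullet> cscale \<i> x = x \<bullet> cscale \<i> (?T x)"
      using * by (simp add: selfadjoint_def lin)
    also have "\<dots> = - (?T x \<bullet> cscale \<i> x)" by (simp add: rot inner_commute)
    finally show "?T x \<bullet> cscale \<i> x = 0" by simp
  qed
qed

lift_definition l2_cnj :: "l2 \<Rightarrow> l2" is "\<lambda>x n. cnj (x n)"
  by (rule ell2_cnj)

lemma coord_l2_cnj [simp]: "coord (l2_cnj x) n = cnj (coord x n)"
  by transfer simp

lemma norm_l2_cnj [simp]: "norm (l2_cnj x) = norm x"
  by (simp add: norm_l2_eq ell2_norm_def)

lemma bounded_linear_l2_cnj: "bounded_linear l2_cnj"
  by (rule bounded_linear_intro[where K = 1]) (auto intro!: l2_eqI)

text \<open>For a complex symmetric matrix $A$ the antilinear map $S x = \overline{A x}$ is symmetric for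
  the real inner product, and $S^2 = \overline{A} A = A^* A$. This replaces the polar decomposition
  of $A$: as a real operator, $|A|$ is the positive square root of $S^2$.\<close>

definition anti_op :: "inf_matrix \<Rightarrow> l2 \<Rightarrow>\<^sub>L l2" where
  "anti_op A = Blinfun (\<lambda>x. l2_cnj (mat_op A x))"

lemma anti_op_apply: "anti_op A x = l2_cnj (mat_op A x)"
  unfolding anti_op_def
  by (subst bounded_linear_Blinfun_apply)
     (auto intro: bounded_linear_compose[OF bounded_linear_l2_cnj blinfun.bounded_linear_right])

lemma anti_op_cscale: "bounded_matrix A \<Longrightarrow> anti_op A (cscale c x) = cscale (cnj c) (anti_op A x)"
  by (rule l2_eqI) (simp add: anti_op_apply mat_op_cscale)

lemma norm_anti_op: "norm (anti_op A x) = norm (mat_op A x)"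
  by (simp add: anti_op_apply)

definition symmetric_matrix :: "inf_matrix \<Rightarrow> bool" where
  "symmetric_matrix A \<longleftrightarrow> (\<forall>i j. A i j = A j i)"

lemma selfadjoint_anti_op:
  assumes A: "bounded_matrix A" "symmetric_matrix A"
  shows "selfadjoint (anti_op A)"
  unfolding selfadjoint_def
proof (intro allI)
  fix x y
  have bl: "bounded_linear (\<lambda>x. anti_op A x \<bullet> y)" "bounded_linear (\<lambda>x. x \<bullet> anti_op A y)"
       "bounded_linear (\<lambda>x. y \<bullet> anti_op A x)" "bounded_linear (\<lambda>x. anti_op A y \<bullet> x)" for y
    by (intro bounded_linear_intros blinfun.bounded_linear_right)+
  show "anti_op A x \<bullet> y = x \<bullet> anti_op A y"
  proof (rule l2_linear_ext[OF bl(1) bl(2)])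
    fix j c
    show "anti_op A (single j c) \<bullet> y = single j c \<bullet> anti_op A y"
    proof (rule l2_linear_ext[OF bl(4) bl(3)])
      fix k d
      have "single j c \<bullet> anti_op A (single k d) = anti_op A (single k d) \<bullet> single j c"
        by (rule inner_commute)
      then show "anti_op A (single j c) \<bullet> single k d = single j c \<bullet> anti_op A (single k d)"
        using A by (simp add: inner_single anti_op_apply mat_op_single symmetric_matrix_def algebra_simps)
    qed
  qed
qed

lemma mat_mult_adjoint_self:
  assumes A: "bounded_matrix A" "symmetric_matrix A"
  shows "mat_mult (mat_adjoint A) A i j = coord (anti_op A (anti_op A (single j 1))) i"
proof -
  have s: "summable (\<lambda>k. A i k * coord (anti_op A (single j 1)) k)"
    by (rule bounded_matrix_summable[OF A(1)])
  have "coord (anti_op A (anti_op A (single j 1))) i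
      = (\<Sum>k. cnj (A i k * coord (anti_op A (single j 1)) k))"
    by (simp add: anti_op_apply[of A "anti_op A _"] coord_mat_op[OF A(1)] mat_apply_def
        bounded_linear.suminf[OF bounded_linear_cnj s])
  also have "\<dots> = mat_mult (mat_adjoint A) A i j"
    using A(2) by (simp add: mat_mult_def mat_adjoint_def anti_op_apply mat_op_single[OF A(1)]
        symmetric_matrix_def)
  finally show ?thesis by simp
qed

lemma mat_mult_self:
  assumes "bounded_matrix P"
  shows "mat_mult P P i j = coord (mat_op P (mat_op P (single j 1))) i"
  using assms by (simp add: mat_mult_def coord_mat_op[of P "mat_op P _"] mat_apply_def mat_op_single)

lemma mat_mult_eq_iff:
  assumes A: "bounded_matrix A" "symmetric_matrix A" and P: "bounded_matrix P"
  shows "mat_mult P P = mat_mult (mat_adjoint A) A \<longleftrightarrow>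
     mat_op P o\<^sub>L mat_op P = anti_op A o\<^sub>L anti_op A"
proof
  assume "mat_mult P P = mat_mult (mat_adjoint A) A"
  then have *: "mat_op P (mat_op P (single j 1)) = anti_op A (anti_op A (single j 1))" for j
    by (intro l2_eqI) (metis mat_mult_self[OF P] mat_mult_adjoint_self[OF A])
  show "mat_op P o\<^sub>L mat_op P = anti_op A o\<^sub>L anti_op A"
    by (rule blinfun_l2_ext, subst (1 2) single_cscale)
       (simp add: mat_op_cscale P A anti_op_cscale *)
next
  assume "mat_op P o\<^sub>L mat_op P = anti_op A o\<^sub>L anti_op A"
  then have "mat_op P (mat_op P x) = anti_op A (anti_op A x)" for x
    by (metis blinfun_apply_blinfun_compose)
  then show "mat_mult P P = mat_mult (mat_adjoint A) A"
    by (intro ext) (simp add: mat_mult_self[OF P] mat_mult_adjoint_self[OF A])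
qed

lemma norm_eq_of_squares_eq:
  assumes "selfadjoint P" "selfadjoint S" "P o\<^sub>L P = S o\<^sub>L S"
  shows "norm (P x) = norm (S x)"
proof -
  have "P (P x) = S (S x)" using assms(3) by (metis blinfun_apply_blinfun_compose)
  then have "P x \<bullet> P x = S x \<bullet> S x"
    using assms(1,2) by (simp add: selfadjointD)
  then show ?thesis by (simp add: norm_eq_sqrt_inner)
qed

text \<open>The absolute value is a definite description, so both existence and uniqueness of the positive
  root of $A^* A$ are needed before anything can be said about it.\<close>

lemma mat_abs_symmetric:
  assumes A: "bounded_matrix A" "symmetric_matrix A"
  shows "positive_matrix (mat_abs A) \<and> mat_mult (mat_abs A) (mat_abs A) = mat_mult (mat_adjoint A) A"
proof -
  let ?S = "anti_op A"
  have S: "selfadjoint ?S" by (rule selfadjoint_anti_op[OF A])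
  have "psd (?S o\<^sub>L ?S)"
    unfolding psd_def selfadjoint_def blinfun_apply_blinfun_compose
    by (metis S selfadjointD inner_ge_zero)
  then obtain P where P: "psd P" "P o\<^sub>L P = ?S o\<^sub>L ?S" by (rule psd_square_root)
  have norm_P: "norm (P x) = norm (?S x)" for x
    using P S by (intro norm_eq_of_squares_eq) (auto simp: psd_selfadjoint)
  \<comment> \<open>Uniqueness of the root makes \<open>P\<close> commute with the unimodular scalars, hence complex-linear.\<close>
  have P_\<i>: "P (cscale \<i> x) = cscale \<i> (P x)" for x
  proof -
    define P' where "P' = Blinfun (\<lambda>x. cscale (- \<i>) (P (cscale \<i> x)))"
    have P'x: "P' x = cscale (- \<i>) (P (cscale \<i> x))" for x
      unfolding P'_def
      by (subst bounded_linear_Blinfun_apply)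
         (auto intro: bounded_linear_compose[OF bounded_linear_cscale
            bounded_linear_compose[OF blinfun.bounded_linear_right bounded_linear_cscale]])
    have P'xy: "P' x \<bullet> y = P (cscale \<i> x) \<bullet> cscale \<i> y" for x y
      by (simp add: P'x cscale_inner)
    have "psd P'"
      unfolding psd_def selfadjoint_def
    proof (intro conjI allI)
      fix x y
      have "P' x \<bullet> y = cscale \<i> x \<bullet> P (cscale \<i> y)"
        unfolding P'xy by (rule selfadjointD[OF psd_selfadjoint[OF P(1)]])
      then show "P' x \<bullet> y = x \<bullet> P' y"
        using P'xy[of y x] by (simp only: inner_commute)
      show "0 \<le> P' x \<bullet> x" unfolding P'xy by (rule psdD[OF P(1)])
    qed
    moreover have "norm (P' x) = norm (P x)" for x
      by (simp add: P'x norm_P anti_op_cscale[OF A(1)])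
    ultimately have "P' = P" using P(1) by (intro psd_norm_eq_unique)
    then have "cscale (- \<i>) (P (cscale \<i> x)) = P x" using P'x[of x] by simp
    then have "cscale \<i> (cscale (- \<i>) (P (cscale \<i> x))) = cscale \<i> (P x)" by simp
    then show ?thesis by simp
  qed
  have P_lin: "P (cscale c x) = cscale c (P x)" for c x
  proof -
    have *: "cscale c x = Re c *\<^sub>R x + Im c *\<^sub>R cscale \<i> x" for x
      by (rule l2_eqI) (simp add: complex_eq_iff)
    show ?thesis by (simp add: *[of x] *[of "P x"] blinfun.add_right blinfun.scaleR_right P_\<i>)
  qed
  note bd = bounded_matrix_op_mat[of P, OF P_lin] and op = mat_op_op_mat[of P, OF P_lin]
  have ex: "positive_matrix (op_mat P) \<and> mat_mult (op_mat P) (op_mat P) = mat_mult (mat_adjoint A) A"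
    using P by (simp add: positive_matrix_iff_psd[OF bd] mat_mult_eq_iff[OF A bd] op)
  have uniq: "Q = op_mat P"
    if "positive_matrix Q \<and> mat_mult Q Q = mat_mult (mat_adjoint A) A" for Q
  proof -
    have Q: "bounded_matrix Q" using that by (simp add: positive_matrix_def)
    have Q2: "psd (mat_op Q)" "mat_op Q o\<^sub>L mat_op Q = ?S o\<^sub>L ?S"
      using that by (simp_all add: positive_matrix_iff_psd[OF Q] mat_mult_eq_iff[OF A Q])
    then have "norm (mat_op Q x) = norm (P x)" for x
      using norm_eq_of_squares_eq[OF psd_selfadjoint[OF Q2(1)] S] by (simp add: norm_P)
    then have "mat_op Q = P" using Q2 P by (intro psd_norm_eq_unique)
    then show "Q = op_mat P" using op_mat_mat_op[OF Q] by simp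
  qed
  have "mat_abs A = op_mat P"
    unfolding mat_abs_def by (rule the_equality) (fact ex, rule uniq)
  with ex show ?thesis by simp
qed

lemma bounded_mat_abs:
  assumes "bounded_matrix A" "symmetric_matrix A"
  shows "bounded_matrix (mat_abs A)"
  using mat_abs_symmetric[OF assms] by (simp add: positive_matrix_def)

lemma psd_mat_abs:
  assumes "bounded_matrix A" "symmetric_matrix A"
  shows "psd (mat_op (mat_abs A))"
  using mat_abs_symmetric[OF assms] positive_matrix_iff_psd bounded_mat_abs[OF assms] by blast

lemma norm_mat_abs:
  assumes A: "bounded_matrix A" "symmetric_matrix A"
  shows "norm (mat_op (mat_abs A) x) = norm (anti_op A x)"
  using mat_abs_symmetric[OF A] mat_mult_eq_iff[OF A bounded_mat_abs[OF A]]
  by (intro norm_eq_of_squares_eq psd_selfadjoint psd_mat_abs selfadjoint_anti_op A) blast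

lemma mat_abs_diag:
  assumes A: "bounded_matrix A" "symmetric_matrix A"
  shows "mat_abs A n n = complex_of_real (mat_op (mat_abs A) (single n 1) \<bullet> single n 1)"
    and "0 \<le> mat_op (mat_abs A) (single n 1) \<bullet> single n 1"
proof -
  have "ell2_inner (mat_apply (mat_abs A) (coord (single n 1))) (coord (single n 1)) \<in> \<real>\<^sub>\<ge>\<^sub>0"
    using mat_abs_symmetric[OF A] by (simp add: positive_matrix_def)
  moreover have "ell2_inner (mat_apply (mat_abs A) (coord (single n 1))) (coord (single n 1))
      = mat_abs A n n"
  proof -
    have "mat_apply (mat_abs A) (coord (single n 1)) = coord (mat_op (mat_abs A) (single n 1))"
      by (rule ext) (simp add: coord_mat_op[OF bounded_mat_abs[OF A]])
    moreover have "ell2_inner (coord z) (coord (single n 1)) = (\<Sum>k\<in>{n}. coord z k * cnj (coord (single n 1) k))" for z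
      unfolding ell2_inner_def by (rule suminf_finite) auto
    ultimately show ?thesis by (simp add: mat_op_single[OF bounded_mat_abs[OF A]])
  qed
  ultimately have "mat_abs A n n \<in> \<real>\<^sub>\<ge>\<^sub>0" by simp
  then show "mat_abs A n n = complex_of_real (mat_op (mat_abs A) (single n 1) \<bullet> single n 1)"
    by (simp add: inner_single mat_op_single[OF bounded_mat_abs[OF A]] complex_nonneg_Reals_iff complex_eq_iff)
  show "0 \<le> mat_op (mat_abs A) (single n 1) \<bullet> single n 1"
    by (rule psdD[OF psd_mat_abs[OF A]])
qed

section \<open>Trace class Hankel matrices\<close>

lemma inner_sum_single: "z \<bullet> (\<Sum>i<N. single i (x i)) = Re (\<Sum>i<N. coord z i * cnj (x i))"
  by (simp only: inner_sum_right inner_single Re_sum)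

lemma coord_mat_op_sum_single:
  assumes "bounded_matrix A"
  shows "coord (mat_op A (\<Sum>j<N. single j (x j))) i = (\<Sum>j<N. A i j * x j)"
  by (simp only: blinfun.sum_right coord_sum mat_op_single[OF assms])

lemma anti_op_quadratic:
  assumes A: "bounded_matrix A"
  shows "anti_op A (\<Sum>j<N. single j (x j)) \<bullet> (\<Sum>i<N. single i (x i))
    = Re (\<Sum>i<N. \<Sum>j<N. A i j * x i * x j)"
proof -
  have "(\<Sum>i<N. coord (anti_op A (\<Sum>j<N. single j (x j))) i * cnj (x i))
      = cnj (\<Sum>i<N. \<Sum>j<N. A i j * x i * x j)"
    unfolding anti_op_apply coord_l2_cnj coord_mat_op_sum_single[OF A]
    by (simp add: sum_distrib_left mult_ac)
  then show ?thesis by (simp only: inner_sum_single cnj.sel)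
qed

lemma mat_op_quadratic:
  assumes A: "bounded_matrix A"
  shows "mat_op A (\<Sum>j<N. single j (x j)) \<bullet> (\<Sum>i<N. single i (x i))
    = Re (\<Sum>i<N. \<Sum>j<N. A i j * cnj (x i) * x j)"
  unfolding inner_sum_single coord_mat_op_sum_single[OF A]
  by (simp add: sum_distrib_left mult_ac del: Re_sum)

text \<open>The bilinear form of a symmetric matrix is dominated by the quadratic form of its absolute
  value: this is the Loewner--Heinz inequality for $S$ and $|A|$, because $\langle Sx, x\rangle$ is
  the real part of $\overline{x^T A x}$, and rotating $x$ turns that real part into the modulus.\<close>

lemma symmetric_form_le_mat_abs:
  assumes A: "bounded_matrix A" "symmetric_matrix A"
  shows "cmod (\<Sum>i<N. \<Sum>j<N. A i j * x i * x j) \<le> Re (\<Sum>i<N. \<Sum>j<N. mat_abs A i j * cnj (x i) * x j)"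
proof -
  note P = psd_mat_abs[OF A] and b = bounded_mat_abs[OF A]
  have real: "\<bar>Re (\<Sum>i<N. \<Sum>j<N. A i j * y i * y j)\<bar>
      \<le> Re (\<Sum>i<N. \<Sum>j<N. mat_abs A i j * cnj (y i) * y j)" for y
    using Loewner_Heinz[OF P selfadjoint_anti_op[OF A], of "\<Sum>j<N. single j (y j)"]
    by (simp only: anti_op_quadratic[OF A(1)] mat_op_quadratic[OF b] norm_mat_abs[OF A] order_refl)
  define q where "q = (\<Sum>i<N. \<Sum>j<N. A i j * x i * x j)"
  show ?thesis
  proof (cases "q = 0")
    case True
    then show ?thesis using real[of x] by (simp add: q_def)
  next
    case False
    \<comment> \<open>a unimodular number whose square rotates \<open>q\<close> to its modulus\<close>
    define \<zeta> where "\<zeta> = csqrt (cnj q / cmod q)"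
    have \<zeta>2: "\<zeta> * \<zeta> = cnj q / cmod q" by (simp add: \<zeta>_def flip: power2_eq_square)
    have "(cmod \<zeta>)\<^sup>2 = 1" using False arg_cong[OF \<zeta>2, of cmod]
      by (simp add: norm_mult norm_divide power2_eq_square)
    then have unit: "cnj \<zeta> * \<zeta> = 1"
      by (metis complex_norm_square mult.commute of_real_1)
    have "\<zeta> * \<zeta> * q = cmod q"
      using False by (simp add: \<zeta>2 complex_norm_square[symmetric] power2_eq_square mult.commute[of "cnj q"]
          flip: complex_norm_square)
    moreover have "(\<Sum>i<N. \<Sum>j<N. A i j * (\<zeta> * x i) * (\<zeta> * x j)) = \<zeta> * \<zeta> * q"
      by (simp add: q_def sum_distrib_left mult_ac)
    moreover have "mat_abs A i j * cnj (\<zeta> * x i) * (\<zeta> * x j) = mat_abs A i j * cnj (x i) * x j" for i j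
    proof -
      have "mat_abs A i j * cnj (\<zeta> * x i) * (\<zeta> * x j) = (cnj \<zeta> * \<zeta>) * (mat_abs A i j * cnj (x i) * x j)"
        by (simp add: mult_ac)
      then show ?thesis by (simp only: unit mult_1)
    qed
    ultimately have "\<bar>Re (complex_of_real (cmod q))\<bar>
        \<le> Re (\<Sum>i<N. \<Sum>j<N. mat_abs A i j * cnj (x i) * x j)"
      using real[of "\<lambda>i. \<zeta> * x i"] by (simp only:)
    then have "cmod q \<le> Re (\<Sum>i<N. \<Sum>j<N. mat_abs A i j * cnj (x i) * x j)"
      by (simp only: Re_complex_of_real abs_norm_cancel)
    then show ?thesis by (simp add: q_def)
  qed
qed

text \<open>The case of a basis vector.\<close>

lemma cmod_diag_le_mat_abs:
  assumes A: "bounded_matrix A" "symmetric_matrix A"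
  shows "cmod (A n n) \<le> Re (mat_abs A n n)"
proof -
  have delta: "(\<Sum>i<Suc n. \<Sum>j<Suc n. B i j * (if i = n then 1 else 0) * (if j = n then 1 else 0)) = B n n"
    for B :: inf_matrix
    by (subst sum.swap) (simp add: if_distrib[of "\<lambda>c. _ * c"] cong: if_cong)
  show ?thesis
    using symmetric_form_le_mat_abs[OF A, where N = "Suc n" and x = "\<lambda>i. if i = n then 1 else 0"]
    by (simp only: delta if_distrib[of cnj] complex_cnj_one complex_cnj_zero)
qed

lemma trace_class_symmetric:
  assumes "trace_class A" "symmetric_matrix A"
  shows "summable (\<lambda>n. Re (mat_abs A n n))" "0 \<le> Re (mat_abs A n n)"
    and "trace_norm A = (\<Sum>n. Re (mat_abs A n n))"
proof -
  have A: "bounded_matrix A" "summable (\<lambda>n. mat_abs A n n)" using assms by (auto simp: trace_class_def)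
  show "summable (\<lambda>n. Re (mat_abs A n n))" by (rule summable_Re[OF A(2)])
  show "0 \<le> Re (mat_abs A n n)" using mat_abs_diag[OF A(1) assms(2), of n] by simp
  show "trace_norm A = (\<Sum>n. Re (mat_abs A n n))"
    unfolding trace_norm_def mat_trace_def using A(2) by (rule Re_suminf)
qed

lemma trace_classI:
  assumes A: "bounded_matrix A" "symmetric_matrix A"
    and s: "summable (\<lambda>n. mat_op (mat_abs A) (single n 1) \<bullet> single n 1)"
  shows "trace_class A"
  using A summable_of_real[OF s, where ?'a = complex]
  by (simp add: trace_class_def mat_abs_diag(1)[OF A])

lemma symmetric_hankel_h: "symmetric_matrix (hankel_h \<phi>)"
  by (simp add: symmetric_matrix_def hankel_h_def add.commute)

lemma symmetric_hankel_k: "symmetric_matrix (hankel_k \<phi>)"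
  by (simp add: symmetric_matrix_def hankel_k_def add.commute)

text \<open>The matrix $k$ is $h$ without its first row, so $\|kx\| \le \|hx\|$ and hence $|k| \le |h|$
  by the Loewner--Heinz inequality.\<close>

lemma hankel_k_trace_class:
  assumes "trace_class (hankel_h \<phi>)"
  shows "trace_class (hankel_k \<phi>)"
proof -
  let ?h = "hankel_h \<phi>" and ?k = "hankel_k \<phi>"
  have h: "bounded_matrix ?h" using assms by (simp add: trace_class_def)
  have kh: "?k i = ?h (Suc i)" for i by (rule ext) (simp add: hankel_k_def hankel_h_def)
  have apply_k: "mat_apply ?k x i = mat_apply ?h x (Suc i)" for x i
    by (simp add: mat_apply_def kh)
  have ell2_k: "mat_apply ?k x \<in> ell2" "ell2_norm (mat_apply ?k x) \<le> ell2_norm (mat_apply ?h x)"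
    if "x \<in> ell2" for x
  proof -
    have s: "summable (\<lambda>n. (cmod (mat_apply ?h x n))\<^sup>2)"
      using h that by (auto simp: bounded_matrix_def ell2_def)
    then show "mat_apply ?k x \<in> ell2"
      unfolding ell2_def apply_k mem_Collect_eq by (subst summable_Suc_iff)
    show "ell2_norm (mat_apply ?k x) \<le> ell2_norm (mat_apply ?h x)"
      unfolding ell2_norm_def apply_k using suminf_split_head[OF s] by simp
  qed
  have k: "bounded_matrix ?k"
    unfolding bounded_matrix_def
  proof (intro conjI ballI allI)
    fix x i assume x: "x \<in> ell2"
    then show "summable (\<lambda>j. ?k i j * x j)" using h by (simp add: kh bounded_matrix_def)
    show "mat_apply ?k x \<in> ell2" using x by (rule ell2_k)
  next
    obtain K where "\<forall>x\<in>ell2. ell2_norm (mat_apply ?h x) \<le> K * ell2_norm x"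
      using h by (auto simp: bounded_matrix_def)
    then show "\<exists>K. \<forall>x\<in>ell2. ell2_norm (mat_apply ?k x) \<le> K * ell2_norm x"
      using ell2_k(2) by (meson order_trans)
  qed
  note hs = h symmetric_hankel_h[of \<phi>] and ks = k symmetric_hankel_k[of \<phi>]
  have norms: "norm (mat_op ?k x) \<le> norm (mat_op ?h x)" for x
  proof -
    have "coord (mat_op ?k x) = mat_apply ?k (coord x)" "coord (mat_op ?h x) = mat_apply ?h (coord x)"
      by (rule ext, simp add: coord_mat_op h k)+
    then show ?thesis using ell2_k(2)[of "coord x"] by (simp add: norm_l2_eq)
  qed
  have "\<bar>mat_op (mat_abs ?k) x \<bullet> x\<bar> \<le> mat_op (mat_abs ?h) x \<bullet> x" for x
    by (rule Loewner_Heinz)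
       (simp_all add: psd_mat_abs hs ks psd_selfadjoint norm_mat_abs norm_anti_op norms)
  moreover have "summable (\<lambda>n. mat_op (mat_abs ?h) (single n 1) \<bullet> single n 1)"
    using trace_class_symmetric(1)[OF assms hs(2)] by (simp add: mat_abs_diag(1)[OF hs])
  ultimately have "summable (\<lambda>n. mat_op (mat_abs ?k) (single n 1) \<bullet> single n 1)"
    by (intro summable_comparison_test[of "\<lambda>n. mat_op (mat_abs ?k) (single n 1) \<bullet> single n 1"
        "\<lambda>n. mat_op (mat_abs ?h) (single n 1) \<bullet> single n 1"]) auto
  with ks show ?thesis by (rule trace_classI)
qed

section \<open>The total variation of a complex measure\<close>

abbreviation measurable_partitions :: "'a measure \<Rightarrow> 'a set \<Rightarrow> (nat \<Rightarrow> 'a set) set" where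
  "measurable_partitions M E \<equiv> {A. range A \<subseteq> sets M \<and> disjoint_family A \<and> (\<Union>i. A i) = E}"

definition partition_sum :: "('a set \<Rightarrow> complex) \<Rightarrow> (nat \<Rightarrow> 'a set) \<Rightarrow> ennreal" where
  "partition_sum \<nu> A = (\<Sum>i. ennreal (cmod (\<nu> (A i))))"

definition variation :: "'a measure \<Rightarrow> ('a set \<Rightarrow> complex) \<Rightarrow> 'a set \<Rightarrow> ennreal" where
  "variation M \<nu> E = (SUP A \<in> measurable_partitions M E. partition_sum \<nu> A)"

lemma partition_sum_le_variation: "A \<in> measurable_partitions M E \<Longrightarrow> partition_sum \<nu> A \<le> variation M \<nu> E"
  unfolding variation_def by (rule SUP_upper)

lemma partitions_nonempty:
  assumes "E \<in> sets M" shows "measurable_partitions M E \<noteq> {}"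
proof -
  have "(\<lambda>n::nat. if n = 0 then E else {}) \<in> measurable_partitions M E"
    using assms by (auto simp: disjoint_family_on_def split: if_splits)
  then show ?thesis by blast
qed

lemma cmod_le_variation:
  assumes "E \<in> sets M" "A \<in> sets M" "A \<subseteq> E"
  shows "ennreal (cmod (\<nu> A)) \<le> variation M \<nu> E"
proof -
  define B where "B = (\<lambda>n::nat. if n = 0 then A else if n = 1 then E - A else {})"
  have B: "B \<in> measurable_partitions M E"
    using assms by (auto simp: B_def disjoint_family_on_def split: if_splits)
  have "ennreal (cmod (\<nu> A)) = (\<Sum>i<1. ennreal (cmod (\<nu> (B i))))" by (simp add: B_def)
  also have "\<dots> \<le> partition_sum \<nu> B"
    unfolding partition_sum_def by (rule sum_le_suminf) auto
  also have "\<dots> \<le> variation M \<nu> E" using B by (rule partition_sum_le_variation)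
  finally show ?thesis .
qed

lemma suminf_ennreal_swap: "(\<Sum>i. \<Sum>j. f i j) = (\<Sum>j. \<Sum>i. (f i j :: ennreal))"
  using nn_integral_suminf[of "\<lambda>j i. f i j" "count_space (UNIV :: nat set)"]
  by (simp add: nn_integral_count_space_nat)

lemma complex_measure_empty:
  assumes \<nu>: "complex_measure M \<nu>"
  shows "\<nu> {} = 0"
proof -
  have "(\<lambda>i::nat. \<nu> {}) sums \<nu> (\<Union>i::nat. {})"
    using \<nu> unfolding complex_measure_def
    by (elim allE[of _ "\<lambda>_. {}"] impE) (auto simp: disjoint_family_on_def)
  then have "(\<lambda>i::nat. \<nu> {}) \<longlonglongrightarrow> 0" by (intro summable_LIMSEQ_zero sums_summable)
  then show ?thesis by (simp add: LIMSEQ_const_iff)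
qed

lemma cmod_le_partition_sum:
  assumes \<nu>: "complex_measure M \<nu>" and A: "range A \<subseteq> sets M" "disjoint_family A"
  shows "ennreal (cmod (\<nu> (\<Union>i. A i))) \<le> partition_sum \<nu> A"
proof (cases "partition_sum \<nu> A = top")
  case False
  have sums: "(\<lambda>i. \<nu> (A i)) sums \<nu> (\<Union>i. A i)"
    using \<nu> A by (simp add: complex_measure_def)
  have summ: "summable (\<lambda>i. cmod (\<nu> (A i)))"
    using False unfolding partition_sum_def by (intro summable_suminf_not_top) auto
  have "cmod (\<nu> (\<Union>i. A i)) \<le> (\<Sum>i. cmod (\<nu> (A i)))"
    using summable_norm[OF summ] sums by (simp add: sums_iff)
  then have "ennreal (cmod (\<nu> (\<Union>i. A i))) \<le> ennreal (\<Sum>i. cmod (\<nu> (A i)))"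
    by (rule ennreal_leI)
  also have "\<dots> = partition_sum \<nu> A"
    unfolding partition_sum_def using summ by (intro suminf_ennreal2[symmetric]) auto
  finally show ?thesis .
qed simp

text \<open>Interleaving partitions of two disjoint sets gives superadditivity of the variation.\<close>

lemma variation_superadditive:
  assumes E: "E \<in> sets M" "F \<in> sets M" "E \<inter> F = {}"
  shows "variation M \<nu> E + variation M \<nu> F \<le> variation M \<nu> (E \<union> F)"
proof -
  have le: "partition_sum \<nu> A + partition_sum \<nu> B \<le> variation M \<nu> (E \<union> F)"
    if A: "A \<in> measurable_partitions M E" and B: "B \<in> measurable_partitions M F" for A B
  proof -
    define C where "C n = (if even n then A (n div 2) else B (n div 2))" for n :: nat
    have union: "(\<Union>n. C n) = (\<Union>n. A n) \<union> (\<Union>n. B n)"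
    proof (intro equalityI subsetI)
      fix x assume "x \<in> (\<Union>n. A n) \<union> (\<Union>n. B n)"
      then obtain n where "x \<in> A n \<or> x \<in> B n" by blast
      then have "x \<in> C (2 * n) \<or> x \<in> C (2 * n + 1)" by (simp add: C_def)
      then show "x \<in> (\<Union>n. C n)" by blast
    qed (auto simp: C_def split: if_splits)
    have dAB: "A i \<inter> B j = {}" for i j using A B E(3) by blast
    have disj: "disjoint_family C"
      unfolding disjoint_family_on_def
    proof (intro ballI impI)
      fix m n :: nat assume mn: "m \<noteq> n"
      show "C m \<inter> C n = {}"
      proof (cases "even m = even n")
        case True
        then have "m div 2 \<noteq> n div 2" using mn by presburger
        moreover have "disjoint_family A" "disjoint_family B" using A B by auto
        ultimately have "A (m div 2) \<inter> A (n div 2) = {}" "B (m div 2) \<inter> B (n div 2) = {}"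
          by (auto simp: disjoint_family_on_def)
        with True show ?thesis by (simp add: C_def)
      qed (use dAB in \<open>auto simp: C_def\<close>)
    qed
    have C: "C \<in> measurable_partitions M (E \<union> F)"
      using A B union disj by (auto simp: C_def)
    have fin: "(\<Sum>i<k. ennreal (cmod (\<nu> (A i))) + ennreal (cmod (\<nu> (B i))))
        = (\<Sum>n<2 * k. ennreal (cmod (\<nu> (C n))))" for k
      by (induction k) (auto simp: C_def add.assoc)
    have "partition_sum \<nu> A + partition_sum \<nu> B
        = (\<Sum>i. ennreal (cmod (\<nu> (A i))) + ennreal (cmod (\<nu> (B i))))"
      unfolding partition_sum_def by (rule suminf_add) auto
    also have "\<dots> \<le> partition_sum \<nu> C"
      unfolding partition_sum_def
    proof (rule suminf_le_const)
      fix k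
      show "(\<Sum>i<k. ennreal (cmod (\<nu> (A i))) + ennreal (cmod (\<nu> (B i)))) \<le> (\<Sum>n. ennreal (cmod (\<nu> (C n))))"
        unfolding fin by (rule sum_le_suminf) auto
    qed simp
    also have "\<dots> \<le> variation M \<nu> (E \<union> F)" using C by (rule partition_sum_le_variation)
    finally show ?thesis .
  qed
  note ne = partitions_nonempty[OF E(1)] partitions_nonempty[OF E(2)]
  show ?thesis
    unfolding variation_def[of M \<nu> E] variation_def[of M \<nu> F]
    unfolding ennreal_SUP_add_left[OF ne(1), symmetric] ennreal_SUP_add_right[OF ne(2)]
    by (intro SUP_least le)
qed

lemma variation_mono:
  assumes "E \<in> sets M" "F \<in> sets M" "E \<subseteq> F"
  shows "variation M \<nu> E \<le> variation M \<nu> F"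
proof -
  have "variation M \<nu> E \<le> variation M \<nu> E + variation M \<nu> (F - E)" by simp
  also have "\<dots> \<le> variation M \<nu> (E \<union> (F - E))"
    using assms by (intro variation_superadditive) auto
  also have "E \<union> (F - E) = F" using assms by blast
  finally show ?thesis .
qed

text \<open>One inequality follows from superadditivity and monotonicity, the other by cutting a partition of
  the union along the given sets.\<close>

lemma variation_countably_additive:
  assumes \<nu>: "complex_measure M \<nu>" and E: "range E \<subseteq> sets M" "disjoint_family E"
  shows "(\<Sum>j. variation M \<nu> (E j)) = variation M \<nu> (\<Union>j. E j)"
proof (rule antisym)
  have U: "(\<Union>j. E j) \<in> sets M" using E(1) by blast
  have fin: "(\<Sum>j<n. variation M \<nu> (E j)) \<le> variation M \<nu> (\<Union>j<n. E j)" for n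
  proof (induction n)
    case (Suc n)
    have "(\<Sum>j<Suc n. variation M \<nu> (E j)) \<le> variation M \<nu> (\<Union>j<n. E j) + variation M \<nu> (E n)"
      using Suc by (simp add: add_right_mono)
    also have "\<dots> \<le> variation M \<nu> ((\<Union>j<n. E j) \<union> E n)"
    proof (rule variation_superadditive)
      have "E j \<inter> E n = {}" if "j < n" for j
        using that E(2) by (intro disjoint_family_onD[of E UNIV]) auto
      then show "(\<Union>j<n. E j) \<inter> E n = {}" by blast
    qed (use E(1) in auto)
    also have "(\<Union>j<n. E j) \<union> E n = (\<Union>j<Suc n. E j)" by (auto simp: less_Suc_eq)
    finally show ?case .
  qed simp
  show "(\<Sum>j. variation M \<nu> (E j)) \<le> variation M \<nu> (\<Union>j. E j)"
  proof (rule suminf_le_const)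
    fix n
    have "variation M \<nu> (\<Union>j<n. E j) \<le> variation M \<nu> (\<Union>j. E j)"
      using E(1) by (intro variation_mono U) auto
    with fin[of n] show "(\<Sum>j<n. variation M \<nu> (E j)) \<le> variation M \<nu> (\<Union>j. E j)"
      by (rule order_trans)
  qed simp
  show "variation M \<nu> (\<Union>j. E j) \<le> (\<Sum>j. variation M \<nu> (E j))"
    unfolding variation_def[of M \<nu> "\<Union>j. E j"]
  proof (rule SUP_least)
    fix A assume A: "A \<in> measurable_partitions M (\<Union>j. E j)"
    then have Am: "\<And>i. A i \<in> sets M" "disjoint_family A" "(\<Union>i. A i) = (\<Union>j. E j)" by auto
    have Em: "\<And>j. E j \<in> sets M" using E(1) by auto
    have "partition_sum \<nu> A \<le> (\<Sum>i. partition_sum \<nu> (\<lambda>j. A i \<inter> E j))"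
      unfolding partition_sum_def[of \<nu> A]
    proof (rule suminf_le)
      fix i
      have "A i = (\<Union>j. A i \<inter> E j)" using Am(3) by blast
      moreover have "ennreal (cmod (\<nu> (\<Union>j. A i \<inter> E j))) \<le> partition_sum \<nu> (\<lambda>j. A i \<inter> E j)"
      proof (rule cmod_le_partition_sum[OF \<nu>])
        show "disjoint_family (\<lambda>j. A i \<inter> E j)"
          using E(2) by (rule disjoint_family_subset) blast
      qed (use Am(1) Em in blast)
      ultimately show "ennreal (cmod (\<nu> (A i))) \<le> partition_sum \<nu> (\<lambda>j. A i \<inter> E j)" by simp
    qed auto
    also have "\<dots> = (\<Sum>j. partition_sum \<nu> (\<lambda>i. A i \<inter> E j))"
      unfolding partition_sum_def by (rule suminf_ennreal_swap)
    also have "\<dots> \<le> (\<Sum>j. variation M \<nu> (E j))"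
    proof (intro suminf_le partition_sum_le_variation)
      fix j
      have "(\<Union>i. A i \<inter> E j) = E j" using Am(3) by blast
      moreover have "disjoint_family (\<lambda>i. A i \<inter> E j)"
        using Am(2) by (rule disjoint_family_subset) blast
      ultimately show "(\<lambda>i. A i \<inter> E j) \<in> measurable_partitions M (E j)"
        using Am(1) Em by blast
    qed auto
    finally show "partition_sum \<nu> A \<le> (\<Sum>j. variation M \<nu> (E j))" .
  qed
qed

lemma total_variation_eq:
  "total_variation M \<nu> = measure_of (space M) (sets M) (variation M \<nu>)"
  unfolding total_variation_def variation_def partition_sum_def ..

lemma space_total_variation [simp]: "space (total_variation M \<nu>) = space M"
  and sets_total_variation [simp, measurable_cong]: "sets (total_variation M \<nu>) = sets M"
  by (simp_all add: total_variation_def sets.space_closed)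

lemma space_positive_part [simp]: "space (positive_part M \<mu>) = space M"
  and sets_positive_part [simp, measurable_cong]: "sets (positive_part M \<mu>) = sets M"
  by (simp_all add: positive_part_def sets.space_closed)

lemma emeasure_total_variation:
  assumes \<nu>: "complex_measure M \<nu>" and E: "E \<in> sets M"
  shows "emeasure (total_variation M \<nu>) E = variation M \<nu> E"
  unfolding total_variation_eq
proof (rule emeasure_measure_of_sigma[OF sets.sigma_algebra_axioms _ _ E])
  have "partition_sum \<nu> A = 0" if "A \<in> measurable_partitions M {}" for A
  proof -
    have "A i = {}" for i using that by blast
    then show ?thesis by (simp add: partition_sum_def complex_measure_empty[OF \<nu>])
  qed
  then have "variation M \<nu> {} \<le> 0"
    unfolding variation_def by (intro SUP_least) simp
  then show "positive (sets M) (variation M \<nu>)" by (simp add: positive_def)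
  show "countably_additive (sets M) (variation M \<nu>)"
    by (rule countably_additiveI) (rule variation_countably_additive[OF \<nu>])
qed

lemma positive_part_le_total_variation:
  assumes \<nu>: "complex_measure M \<nu>" and \<mu>: "\<And>A. \<mu> A \<le> cmod (\<nu> A)"
  shows "nn_integral (positive_part M \<mu>) f \<le> nn_integral (total_variation M \<nu>) f"
proof (rule nn_integral_mono_measure)
  show "positive_part M \<mu> \<le> total_variation M \<nu>"
  proof (subst le_measure)
    show "\<forall>E\<in>sets (positive_part M \<mu>). emeasure (positive_part M \<mu>) E \<le> emeasure (total_variation M \<nu>) E"
    proof
      fix E assume "E \<in> sets (positive_part M \<mu>)"
      then have E: "E \<in> sets M" by simp
      have "emeasure (positive_part M \<mu>) E \<le> (SUP A \<in> {A \<in> sets M. A \<subseteq> E}. ennreal (\<mu> A))"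
        unfolding positive_part_def by (simp add: emeasure_measure_of_conv)
      also have "\<dots> \<le> variation M \<nu> E"
        using E \<mu> by (intro SUP_least) (auto intro: order_trans[OF ennreal_leI[OF \<mu>] cmod_le_variation])
      finally show "emeasure (positive_part M \<mu>) E \<le> emeasure (total_variation M \<nu>) E"
        by (simp add: emeasure_total_variation[OF \<nu> E])
    qed
  qed simp
qed simp

section \<open>Complex measures with a density\<close>

text \<open>On every set of a partition the integral of the density is bounded by the integral of its
  modulus, so the supremum over partitions is bounded by the latter.\<close>

lemma total_variation_density_le:
  fixes g :: "'a \<Rightarrow> complex"
  assumes g: "integrable M g"
  shows "total_variation M (\<lambda>E. \<integral>x. indicator E x *\<^sub>R g x \<partial>M) \<le> density M (\<lambda>x. ennreal (cmod (g x)))"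
proof (subst le_measure)
  let ?\<nu> = "\<lambda>E. \<integral>x. indicator E x *\<^sub>R g x \<partial>M"
  have [measurable]: "g \<in> borel_measurable M" using g by simp
  show "\<forall>E\<in>sets (total_variation M ?\<nu>). emeasure (total_variation M ?\<nu>) E
      \<le> emeasure (density M (\<lambda>x. ennreal (cmod (g x)))) E"
  proof
    fix E assume "E \<in> sets (total_variation M ?\<nu>)"
    then have E: "E \<in> sets M" by simp
    have "emeasure (total_variation M ?\<nu>) E \<le> variation M ?\<nu> E"
      unfolding total_variation_eq by (simp add: emeasure_measure_of_conv)
    also have "\<dots> \<le> emeasure (density M (\<lambda>x. ennreal (cmod (g x)))) E"
      unfolding variation_def
    proof (rule SUP_least)
      fix A assume "A \<in> measurable_partitions M E"
      then have A: "\<And>i. A i \<in> sets M" "disjoint_family A" "(\<Union>i. A i) = E" by auto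
      have "ennreal (cmod (?\<nu> (A i))) \<le> emeasure (density M (\<lambda>x. ennreal (cmod (g x)))) (A i)" for i
      proof -
        have "ennreal (cmod (?\<nu> (A i))) \<le> (\<integral>\<^sup>+x. ennreal (norm (indicator (A i) x *\<^sub>R g x)) \<partial>M)"
          by (rule integral_norm_bound_ennreal) (intro integrable_mult_indicator g A(1))
        also have "\<dots> = (\<integral>\<^sup>+x. ennreal (cmod (g x)) * indicator (A i) x \<partial>M)"
          by (intro nn_integral_cong) (auto split: split_indicator)
        also have "\<dots> = emeasure (density M (\<lambda>x. ennreal (cmod (g x)))) (A i)"
          using A(1) by (subst emeasure_density) auto
        finally show ?thesis .
      qed
      then have "partition_sum ?\<nu> A \<le> (\<Sum>i. emeasure (density M (\<lambda>x. ennreal (cmod (g x)))) (A i))"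
        unfolding partition_sum_def by (intro suminf_le) auto
      also have "\<dots> = emeasure (density M (\<lambda>x. ennreal (cmod (g x)))) E"
        using A by (subst suminf_emeasure) auto
      finally show "partition_sum ?\<nu> A \<le> emeasure (density M (\<lambda>x. ennreal (cmod (g x)))) E" .
    qed
    finally show "emeasure (total_variation M ?\<nu>) E \<le> emeasure (density M (\<lambda>x. ennreal (cmod (g x)))) E" .
  qed
qed simp

lemma complex_measure_density:
  fixes g :: "'a \<Rightarrow> complex"
  assumes g: "integrable M g"
  shows "complex_measure M (\<lambda>E. \<integral>x. indicator E x *\<^sub>R g x \<partial>M)"
  unfolding complex_measure_def
proof (intro allI impI)
  fix A :: "nat \<Rightarrow> 'a set" assume A: "range A \<subseteq> sets M" "disjoint_family A"
  have lim: "(\<lambda>i. indicator (A i) x *\<^sub>R g x) sums (indicator (\<Union>i. A i) x *\<^sub>R g x)" for x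
  proof -
    have "(\<lambda>i. indicator (A i) x :: real) sums indicator (\<Union>i. A i) x"
    proof (cases "x \<in> (\<Union>i. A i)")
      case True
      then obtain i where i: "x \<in> A i" by blast
      then have "indicator (A j) x = (if j = i then 1 else 0 :: real)" for j
        using A(2) by (auto simp: disjoint_family_on_def indicator_def)
      moreover have "(\<lambda>j. if j = i then 1 else 0 :: real) sums 1" by (rule sums_single)
      ultimately show ?thesis using True by simp
    qed (simp add: indicator_def)
    then show ?thesis by (rule sums_scaleR_left)
  qed
  have "(\<lambda>n. \<integral>x. (\<Sum>i<n. indicator (A i) x *\<^sub>R g x) \<partial>M) \<longlonglongrightarrow> (\<integral>x. indicator (\<Union>i. A i) x *\<^sub>R g x \<partial>M)"
  proof (rule integral_dominated_convergence[where w = "\<lambda>x. norm (g x)"])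
    have [measurable]: "g \<in> borel_measurable M" "\<And>i. A i \<in> sets M" using g A(1) by auto
    show "(\<lambda>x. indicator (\<Union>i. A i) x *\<^sub>R g x) \<in> borel_measurable M" by measurable
    show "(\<lambda>x. \<Sum>i<n. indicator (A i) x *\<^sub>R g x) \<in> borel_measurable M" for n by measurable
    show "AE x in M. (\<lambda>n. \<Sum>i<n. indicator (A i) x *\<^sub>R g x) \<longlonglongrightarrow> indicator (\<Union>i. A i) x *\<^sub>R g x"
      using lim by (simp add: sums_def)
    have "norm (\<Sum>i<n. indicator (A i) x *\<^sub>R g x) \<le> norm (g x)" for n x
    proof -
      have "(\<Sum>i<n. indicator (A i) x *\<^sub>R g x) = indicator (\<Union>i<n. A i) x *\<^sub>R g x"
        using A(2) by (subst indicator_UN_disjoint)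
          (auto simp: disjoint_family_on_def scaleR_sum_left)
      then show ?thesis by (auto split: split_indicator)
    qed
    then show "AE x in M. norm (\<Sum>i<n. indicator (A i) x *\<^sub>R g x) \<le> norm (g x)" for n by simp
  qed (use g in auto)
  moreover have "(\<integral>x. (\<Sum>i<n. indicator (A i) x *\<^sub>R g x) \<partial>M) = (\<Sum>i<n. \<integral>x. indicator (A i) x *\<^sub>R g x \<partial>M)" for n
    using A(1) by (intro Bochner_Integration.integral_sum integrable_mult_indicator g) auto
  ultimately show "(\<lambda>i. \<integral>x. indicator (A i) x *\<^sub>R g x \<partial>M) sums (\<integral>x. indicator (\<Union>i. A i) x *\<^sub>R g x \<partial>M)"
    by (simp add: sums_def)
qed

text \<open>The supremum defining the positive part is attained at the part of the set on which the density
  is positive.\<close>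

lemma positive_part_density:
  fixes g :: "'a \<Rightarrow> real"
  assumes g: "integrable M g"
  shows "positive_part M (\<lambda>E. \<integral>x. indicator E x *\<^sub>R g x \<partial>M) = density M (\<lambda>x. ennreal (g x))"
proof -
  let ?\<mu> = "\<lambda>E. \<integral>x. indicator E x *\<^sub>R g x \<partial>M"
  have [measurable]: "g \<in> borel_measurable M" using g by simp
  have sup: "(SUP A \<in> {A \<in> sets M. A \<subseteq> E}. ennreal (?\<mu> A)) = emeasure (density M (\<lambda>x. ennreal (g x))) E"
    if E: "E \<in> sets M" for E
  proof (rule antisym)
    have le: "ennreal (?\<mu> A) \<le> emeasure (density M (\<lambda>x. ennreal (g x))) A" if A: "A \<in> sets M" for A
    proof -
      have int: "integrable M (\<lambda>x. indicator A x *\<^sub>R max 0 (g x))"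
        using g A by (intro integrable_mult_indicator integrable_max) auto
      have "?\<mu> A \<le> (\<integral>x. indicator A x *\<^sub>R max 0 (g x) \<partial>M)"
        using int integrable_mult_indicator[OF A g] by (intro integral_mono) (auto split: split_indicator)
      then have "ennreal (?\<mu> A) \<le> ennreal (\<integral>x. indicator A x *\<^sub>R max 0 (g x) \<partial>M)" by (rule ennreal_leI)
      also have "\<dots> = (\<integral>\<^sup>+x. ennreal (indicator A x *\<^sub>R max 0 (g x)) \<partial>M)"
        using int by (intro nn_integral_eq_integral[symmetric]) auto
      also have "\<dots> = (\<integral>\<^sup>+x. ennreal (g x) * indicator A x \<partial>M)"
        by (intro nn_integral_cong) (auto split: split_indicator simp: max_def ennreal_neg)
      also have "\<dots> = emeasure (density M (\<lambda>x. ennreal (g x))) A"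
        using A by (simp add: emeasure_density)
      finally show ?thesis .
    qed
    show "(SUP A \<in> {A \<in> sets M. A \<subseteq> E}. ennreal (?\<mu> A)) \<le> emeasure (density M (\<lambda>x. ennreal (g x))) E"
    proof (rule SUP_least)
      fix A assume "A \<in> {A \<in> sets M. A \<subseteq> E}"
      then show "ennreal (?\<mu> A) \<le> emeasure (density M (\<lambda>x. ennreal (g x))) E"
        using E by (intro order_trans[OF le emeasure_mono]) auto
    qed
    define P where "P = {x \<in> space M. g x > 0}"
    have P: "P \<in> sets M" unfolding P_def by measurable
    have EP: "E \<inter> P \<in> sets M" using E P by blast
    have "emeasure (density M (\<lambda>x. ennreal (g x))) E = (\<integral>\<^sup>+x. ennreal (g x) * indicator E x \<partial>M)"
      using E by (simp add: emeasure_density)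
    also have "\<dots> = (\<integral>\<^sup>+x. ennreal (indicator (E \<inter> P) x *\<^sub>R g x) \<partial>M)"
      by (intro nn_integral_cong) (auto split: split_indicator simp: P_def ennreal_neg)
    also have "\<dots> = ennreal (?\<mu> (E \<inter> P))"
      by (intro nn_integral_eq_integral integrable_mult_indicator g EP)
         (auto simp: P_def split: split_indicator)
    also have "\<dots> \<le> (SUP A \<in> {A \<in> sets M. A \<subseteq> E}. ennreal (?\<mu> A))"
      using EP by (intro SUP_upper) auto
    finally show "emeasure (density M (\<lambda>x. ennreal (g x))) E \<le> (SUP A \<in> {A \<in> sets M. A \<subseteq> E}. ennreal (?\<mu> A))" .
  qed
  have "positive_part M ?\<mu> = measure_of (space M) (sets M) (emeasure (density M (\<lambda>x. ennreal (g x))))"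
    unfolding positive_part_def
  proof (rule measure_of_eq[OF sets.space_closed])
    fix E assume "E \<in> sigma_sets (space M) (sets M)"
    then have "E \<in> sets M" by (simp only: sets.sigma_sets_eq)
    then show "(SUP A \<in> {A \<in> sets M. A \<subseteq> E}. ennreal (?\<mu> A)) = emeasure (density M (\<lambda>x. ennreal (g x))) E"
      by (rule sup)
  qed
  also have "\<dots> = density M (\<lambda>x. ennreal (g x))"
    using measure_of_of_measure[of "density M (\<lambda>x. ennreal (g x))"] by simp
  finally show ?thesis .
qed

lemma complex_measure_integral_density:
  fixes g f :: "'a \<Rightarrow> complex"
  assumes g: "integrable M g" and f: "f \<in> borel_measurable M" "\<And>x. x \<in> space M \<Longrightarrow> cmod (f x) \<le> 1"
  shows "complex_measure_integral M (\<lambda>E. \<integral>x. indicator E x *\<^sub>R g x \<partial>M) f = (\<integral>x. g x * f x \<partial>M)"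
proof -
  have [measurable]: "g \<in> borel_measurable M" using g by simp
  note [measurable] = f(1)
  have pos: "integral\<^sup>L (positive_part M (\<lambda>E. \<integral>x. indicator E x *\<^sub>R u x \<partial>M)) f
      = (\<integral>x. max 0 (u x) *\<^sub>R f x \<partial>M)" "integrable M (\<lambda>x. max 0 (u x) *\<^sub>R f x)"
    if u: "integrable M u" for u :: "'a \<Rightarrow> real"
  proof -
    have [measurable]: "u \<in> borel_measurable M" using u by simp
    have "density M (\<lambda>x. ennreal (u x)) = density M (\<lambda>x. ennreal (max 0 (u x)))"
      by (intro density_cong) (auto simp: max_def ennreal_neg)
    then show "integral\<^sup>L (positive_part M (\<lambda>E. \<integral>x. indicator E x *\<^sub>R u x \<partial>M)) f
      = (\<integral>x. max 0 (u x) *\<^sub>R f x \<partial>M)"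
      unfolding positive_part_density[OF u] by (simp add: integral_density)
    show "integrable M (\<lambda>x. max 0 (u x) *\<^sub>R f x)"
    proof (rule Bochner_Integration.integrable_bound[OF integrable_norm[OF u]])
      show "AE x in M. norm (max 0 (u x) *\<^sub>R f x) \<le> norm (norm (u x))"
      proof (rule AE_I2)
        fix x assume "x \<in> space M"
        then have "\<bar>max 0 (u x)\<bar> * cmod (f x) \<le> \<bar>u x\<bar> * 1"
          by (intro mult_mono f(2)) auto
        then show "norm (max 0 (u x) *\<^sub>R f x) \<le> norm (norm (u x))" by simp
      qed
    qed simp
  qed
  have diff: "integral\<^sup>L (positive_part M (\<lambda>E. \<integral>x. indicator E x *\<^sub>R u x \<partial>M)) f
      - integral\<^sup>L (positive_part M (\<lambda>E. - (\<integral>x. indicator E x *\<^sub>R u x \<partial>M))) f = (\<integral>x. u x *\<^sub>R f x \<partial>M)"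
    "integrable M (\<lambda>x. u x *\<^sub>R f x)"
    if u: "integrable M u" for u :: "'a \<Rightarrow> real"
  proof -
    have mu: "integrable M (\<lambda>x. - u x)" using u by simp
    have neg: "(\<lambda>E. - (\<integral>x. indicator E x *\<^sub>R u x \<partial>M)) = (\<lambda>E. \<integral>x. indicator E x *\<^sub>R (- u x) \<partial>M)" by simp
    have split: "u x *\<^sub>R f x = max 0 (u x) *\<^sub>R f x - max 0 (- u x) *\<^sub>R f x" for x
      by (auto simp: max_def)
    show "integral\<^sup>L (positive_part M (\<lambda>E. \<integral>x. indicator E x *\<^sub>R u x \<partial>M)) f
      - integral\<^sup>L (positive_part M (\<lambda>E. - (\<integral>x. indicator E x *\<^sub>R u x \<partial>M))) f = (\<integral>x. u x *\<^sub>R f x \<partial>M)"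
      unfolding neg pos(1)[OF u] pos(1)[OF mu] split
      using pos(2)[OF u] pos(2)[OF mu] by simp
    show "integrable M (\<lambda>x. u x *\<^sub>R f x)"
      unfolding split using pos(2)[OF u] pos(2)[OF mu] by (rule Bochner_Integration.integrable_diff)
  qed
  have Re: "Re (\<integral>x. indicator E x *\<^sub>R g x \<partial>M) = (\<integral>x. indicator E x *\<^sub>R Re (g x) \<partial>M)"
    and Im: "Im (\<integral>x. indicator E x *\<^sub>R g x \<partial>M) = (\<integral>x. indicator E x *\<^sub>R Im (g x) \<partial>M)"
    if "E \<in> sets M" for E
    using integrable_mult_indicator[OF that g] by (simp_all flip: integral_Re integral_Im)
  have cong: "positive_part M \<mu> = positive_part M \<mu>'" if "\<And>E. E \<in> sets M \<Longrightarrow> \<mu> E = \<mu>' E" for \<mu> \<mu>'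
    unfolding positive_part_def using that
    by (intro measure_of_eq) (auto simp: sets.space_closed sets.sigma_sets_eq intro!: SUP_cong)
  have parts:
    "positive_part M (\<lambda>E. Re (\<integral>x. indicator E x *\<^sub>R g x \<partial>M)) = positive_part M (\<lambda>E. \<integral>x. indicator E x *\<^sub>R Re (g x) \<partial>M)"
    "positive_part M (\<lambda>E. - Re (\<integral>x. indicator E x *\<^sub>R g x \<partial>M)) = positive_part M (\<lambda>E. - (\<integral>x. indicator E x *\<^sub>R Re (g x) \<partial>M))"
    "positive_part M (\<lambda>E. Im (\<integral>x. indicator E x *\<^sub>R g x \<partial>M)) = positive_part M (\<lambda>E. \<integral>x. indicator E x *\<^sub>R Im (g x) \<partial>M)"
    "positive_part M (\<lambda>E. - Im (\<integral>x. indicator E x *\<^sub>R g x \<partial>M)) = positive_part M (\<lambda>E. - (\<integral>x. indicator E x *\<^sub>R Im (g x) \<partial>M))"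
    by (rule cong; simp only: Re Im)+
  have "complex_measure_integral M (\<lambda>E. \<integral>x. indicator E x *\<^sub>R g x \<partial>M) f
      = (\<integral>x. Re (g x) *\<^sub>R f x \<partial>M) + \<i> * (\<integral>x. Im (g x) *\<^sub>R f x \<partial>M)"
    unfolding complex_measure_integral_def
    using diff(1)[of "\<lambda>x. Re (g x)"] diff(1)[of "\<lambda>x. Im (g x)"] g
    by (simp only: parts integrable_Re integrable_Im)
  also have "\<dots> = (\<integral>x. Re (g x) *\<^sub>R f x + \<i> * (Im (g x) *\<^sub>R f x) \<partial>M)"
  proof (subst Bochner_Integration.integral_add)
    show "integrable M (\<lambda>x. Re (g x) *\<^sub>R f x)" using g by (intro diff(2)) simp
    have *: "integrable M (\<lambda>x. Im (g x) *\<^sub>R f x)" using g by (intro diff(2)) simp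
    then show "integrable M (\<lambda>x. \<i> * (Im (g x) *\<^sub>R f x))" by (rule integrable_mult_right)
    show "(\<integral>x. Re (g x) *\<^sub>R f x \<partial>M) + \<i> * (\<integral>x. Im (g x) *\<^sub>R f x \<partial>M)
        = (\<integral>x. Re (g x) *\<^sub>R f x \<partial>M) + (\<integral>x. \<i> * (Im (g x) *\<^sub>R f x) \<partial>M)"
      by (simp only: integral_mult_right_zero)
  qed
  also have "(\<lambda>x. Re (g x) *\<^sub>R f x + \<i> * (Im (g x) *\<^sub>R f x)) = (\<lambda>x. g x * f x)"
    by (rule ext) (simp add: complex_eq_iff algebra_simps)
  finally show ?thesis .
qed

section \<open>From a representing measure to the trace class\<close>

text \<open>A finite-dimensional form of duality with contractions: for a Hankel matrix $(a_{i+j})$ this says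
  that its trace norm is at most \<open>K\<close>, in a form that is visibly additive in \<open>a\<close>.\<close>

definition hankel_nuclear :: "real \<Rightarrow> (nat \<Rightarrow> complex) \<Rightarrow> bool" where
  "hankel_nuclear K a \<longleftrightarrow> (\<forall>N J U. (\<forall>\<alpha>. (\<Sum>j<J. (cmod (\<Sum>i<N. \<alpha> i * U i j))\<^sup>2) \<le> (\<Sum>i<N. (cmod (\<alpha> i))\<^sup>2))
     \<longrightarrow> cmod (\<Sum>i<N. \<Sum>j<J. a (i + j) * U i j) \<le> K)"

lemma hankel_nuclearD:
  assumes "hankel_nuclear K a"
    and "\<And>\<alpha>. (\<Sum>j<J. (cmod (\<Sum>i<N. \<alpha> i * U i j))\<^sup>2) \<le> (\<Sum>i<N. (cmod (\<alpha> i))\<^sup>2)"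
  shows "cmod (\<Sum>i<N. \<Sum>j<J. a (i + j) * U i j) \<le> K"
  using assms unfolding hankel_nuclear_def by blast

lemma hankel_nuclear_add:
  assumes "hankel_nuclear K a" "hankel_nuclear L b"
  shows "hankel_nuclear (K + L) (\<lambda>n. a n + b n)"
  unfolding hankel_nuclear_def
proof (intro allI impI)
  fix N J :: nat and U :: "nat \<Rightarrow> nat \<Rightarrow> complex"
  assume U: "\<forall>\<alpha>. (\<Sum>j<J. (cmod (\<Sum>i<N. \<alpha> i * U i j))\<^sup>2) \<le> (\<Sum>i<N. (cmod (\<alpha> i))\<^sup>2)"
  have "(\<Sum>i<N. \<Sum>j<J. (a (i + j) + b (i + j)) * U i j)
      = (\<Sum>i<N. \<Sum>j<J. a (i + j) * U i j) + (\<Sum>i<N. \<Sum>j<J. b (i + j) * U i j)"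
    by (simp add: distrib_right sum.distrib)
  then show "cmod (\<Sum>i<N. \<Sum>j<J. (a (i + j) + b (i + j)) * U i j) \<le> K + L"
    using hankel_nuclearD[OF assms(1) U[rule_format]] hankel_nuclearD[OF assms(2) U[rule_format]]
    by (simp only: norm_triangle_mono)
qed

lemma hankel_nuclear_cmult:
  assumes "hankel_nuclear K a" "cmod c = 1"
  shows "hankel_nuclear K (\<lambda>n. c * a n)"
  unfolding hankel_nuclear_def
proof (intro allI impI)
  fix N J :: nat and U :: "nat \<Rightarrow> nat \<Rightarrow> complex"
  assume U: "\<forall>\<alpha>. (\<Sum>j<J. (cmod (\<Sum>i<N. \<alpha> i * U i j))\<^sup>2) \<le> (\<Sum>i<N. (cmod (\<alpha> i))\<^sup>2)"
  have "(\<Sum>i<N. \<Sum>j<J. c * a (i + j) * U i j) = c * (\<Sum>i<N. \<Sum>j<J. a (i + j) * U i j)"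
    by (simp add: sum_distrib_left mult.assoc)
  then show "cmod (\<Sum>i<N. \<Sum>j<J. c * a (i + j) * U i j) \<le> K"
    using hankel_nuclearD[OF assms(1) U[rule_format]] assms(2) by (simp add: norm_mult)
qed

lemma sum_mult_Cauchy_Schwarz:
  "cmod (\<Sum>j\<in>J. x j * y j) \<le> sqrt (\<Sum>j\<in>J. (cmod (x j))\<^sup>2) * sqrt (\<Sum>j\<in>J. (cmod (y j))\<^sup>2)"
proof -
  have "cmod (\<Sum>j\<in>J. x j * y j) \<le> (\<Sum>j\<in>J. \<bar>cmod (x j)\<bar> * \<bar>cmod (y j)\<bar>)"
    by (rule order_trans[OF norm_sum]) (simp add: norm_mult)
  also have "\<dots> \<le> L2_set (\<lambda>j. cmod (x j)) J * L2_set (\<lambda>j. cmod (y j)) J"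
    by (rule L2_set_mult_ineq)
  finally show ?thesis by (simp add: L2_set_def)
qed

lemma hankel_nuclear_bilinear:
  assumes "hankel_nuclear K a"
  shows "cmod (\<Sum>i<N. \<Sum>j<J. a (i + j) * (x i * y j))
    \<le> K * (sqrt (\<Sum>i<N. (cmod (x i))\<^sup>2) * sqrt (\<Sum>j<J. (cmod (y j))\<^sup>2))"
proof -
  define X Y where "X = sqrt (\<Sum>i<N. (cmod (x i))\<^sup>2)" and "Y = sqrt (\<Sum>j<J. (cmod (y j))\<^sup>2)"
  have X2: "X\<^sup>2 = (\<Sum>i<N. (cmod (x i))\<^sup>2)" and Y2: "Y\<^sup>2 = (\<Sum>j<J. (cmod (y j))\<^sup>2)"
    by (simp_all add: X_def Y_def sum_nonneg)
  have XY: "X \<ge> 0" "Y \<ge> 0" by (simp_all add: X_def Y_def sum_nonneg)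
  show ?thesis
  proof (cases "X * Y = 0")
    case True
    then have "(\<Sum>i<N. (cmod (x i))\<^sup>2) = 0 \<or> (\<Sum>j<J. (cmod (y j))\<^sup>2) = 0"
      using X2 Y2 by auto
    then have "(\<forall>i<N. x i = 0) \<or> (\<forall>j<J. y j = 0)"
      by (simp add: sum_nonneg_eq_0_iff) blast
    then have "(\<Sum>i<N. \<Sum>j<J. a (i + j) * (x i * y j)) = 0"
      by (intro sum.neutral ballI) auto
    then show ?thesis
      unfolding X_def[symmetric] Y_def[symmetric] True by (simp only: norm_zero mult_zero_right order_refl)
  next
    case False
    then have pos: "X * Y > 0" using XY by (simp add: less_le)
    have "cmod (\<Sum>i<N. \<Sum>j<J. a (i + j) * (x i * y j / (X * Y))) \<le> K"
    proof (rule hankel_nuclearD[OF assms])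
      fix \<alpha> :: "nat \<Rightarrow> complex"
      have "(\<Sum>i<N. \<alpha> i * (x i * y j / (X * Y))) = (\<Sum>i<N. \<alpha> i * x i) * (y j / (X * Y))" for j
        by (simp add: sum_divide_distrib sum_distrib_right mult.assoc)
      then have "(\<Sum>j<J. (cmod (\<Sum>i<N. \<alpha> i * (x i * y j / (X * Y))))\<^sup>2)
          = (cmod (\<Sum>i<N. \<alpha> i * x i))\<^sup>2 * (\<Sum>j<J. (cmod (y j))\<^sup>2) / (X * Y)\<^sup>2"
        using XY by (simp add: norm_mult norm_divide power_mult_distrib power_divide
            sum_distrib_left sum_divide_distrib)
      also have "\<dots> = (cmod (\<Sum>i<N. \<alpha> i * x i))\<^sup>2 / X\<^sup>2"
        using False by (simp add: Y2[symmetric] power_mult_distrib)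
      also have "\<dots> \<le> (sqrt (\<Sum>i<N. (cmod (\<alpha> i))\<^sup>2) * X)\<^sup>2 / X\<^sup>2"
        unfolding X_def by (intro divide_right_mono power_mono sum_mult_Cauchy_Schwarz) auto
      also have "\<dots> = (\<Sum>i<N. (cmod (\<alpha> i))\<^sup>2)"
        using False by (simp add: power_mult_distrib sum_nonneg)
      finally show "(\<Sum>j<J. (cmod (\<Sum>i<N. \<alpha> i * (x i * y j / (X * Y))))\<^sup>2) \<le> (\<Sum>i<N. (cmod (\<alpha> i))\<^sup>2)" .
    qed
    moreover have "(\<Sum>i<N. \<Sum>j<J. a (i + j) * (x i * y j / (X * Y)))
        = (\<Sum>i<N. \<Sum>j<J. a (i + j) * (x i * y j)) / (X * Y)"
      by (simp add: sum_divide_distrib)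
    ultimately have "cmod (\<Sum>i<N. \<Sum>j<J. a (i + j) * (x i * y j)) / (X * Y) \<le> K"
      using XY by (simp add: norm_divide norm_mult)
    then show ?thesis using pos by (simp add: X_def Y_def divide_le_eq)
  qed
qed

lemma le_power2_if_le_mult_sqrt:
  assumes "0 \<le> s" "0 \<le> C" "s \<le> C * sqrt s"
  shows "s \<le> C\<^sup>2"
proof (cases "s = 0")
  case False
  then have "sqrt s > 0" using assms(1) by simp
  moreover have "sqrt s * sqrt s \<le> C * sqrt s" using assms by simp
  ultimately have "sqrt s \<le> C" by (metis mult_le_cancel_right_pos)
  then have "(sqrt s)\<^sup>2 \<le> C\<^sup>2" using assms by (intro power_mono) auto
  then show ?thesis using assms by simp
qed simp

lemma hankel_nuclear_ell2:
  assumes a: "hankel_nuclear K a"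
  shows "(\<lambda>j. a (i + j)) \<in> ell2"
proof (rule ell2_bound(1))
  fix J
  define s where "s = (\<Sum>j<J. (cmod (a (i + j)))\<^sup>2)"
  have s0: "s \<ge> 0" by (simp add: s_def sum_nonneg)
  have "(\<Sum>k<Suc i. \<Sum>j<J. a (k + j) * ((if k = i then 1 else 0) * cnj (a (i + j)))) = complex_of_real s"
  proof -
    have "(\<Sum>k<Suc i. \<Sum>j<J. a (k + j) * ((if k = i then 1 else 0) * cnj (a (i + j))))
        = (\<Sum>j<J. a (i + j) * cnj (a (i + j)))" by simp
    then show ?thesis unfolding s_def of_real_sum by (simp only: complex_norm_square)
  qed
  moreover have "(\<Sum>k<Suc i. (cmod (if k = i then 1 else 0))\<^sup>2) = 1" by simp
  ultimately have "s \<le> K * sqrt s"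
    using hankel_nuclear_bilinear[OF a, where N = "Suc i" and J = J and x = "\<lambda>k. if k = i then 1 else 0"
        and y = "\<lambda>j. cnj (a (i + j))"] s0
    by (simp only: complex_mod_cnj s_def[symmetric] norm_of_real abs_of_nonneg real_sqrt_one mult_1)
  moreover have "K \<ge> 0" using hankel_nuclearD[OF a, where N = 0 and J = 0 and U = "\<lambda>_ _. 0"] by simp
  ultimately have "s \<le> K\<^sup>2" using s0 by (intro le_power2_if_le_mult_sqrt)
  then show "(\<Sum>j<J. (cmod (a (i + j)))\<^sup>2) \<le> K\<^sup>2" by (simp add: s_def)
qed

lemma ell2_norm_nonneg: "x \<in> ell2 \<Longrightarrow> 0 \<le> ell2_norm x"
  by (simp add: ell2_norm_def ell2_def suminf_nonneg)

text \<open>Rank one contractions turn the duality bound into a bound of the bilinear form on finite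
  sections, and this suffices for boundedness on the whole space.\<close>

lemma hankel_nuclear_bounded:
  assumes a: "hankel_nuclear K a"
  shows "bounded_matrix (\<lambda>i j. a (i + j))"
proof -
  let ?A = "\<lambda>i j. a (i + j)"
  have summ: "summable (\<lambda>j. a (i + j) * x j)" if "x \<in> ell2" for i x
  proof (rule summable_norm_cancel)
    show "summable (\<lambda>j. norm (a (i + j) * x j))"
      using ell2_mult_summable[OF hankel_nuclear_ell2[OF a, of i] that] by (simp add: norm_mult)
  qed
  have K0: "K \<ge> 0" using hankel_nuclearD[OF a, where N = 0 and J = 0 and U = "\<lambda>_ _. 0"] by simp
  have part: "(\<Sum>i<N. (cmod (mat_apply ?A x i))\<^sup>2) \<le> (K * ell2_norm x)\<^sup>2" if x: "x \<in> ell2" for x N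
  proof -
    define z where "z i = cnj (mat_apply ?A x i)" for i
    define s where "s = (\<Sum>i<N. (cmod (mat_apply ?A x i))\<^sup>2)"
    have s0: "s \<ge> 0" by (simp add: s_def sum_nonneg)
    have "(\<lambda>J. \<Sum>i<N. z i * (\<Sum>j<J. a (i + j) * x j)) \<longlonglongrightarrow> (\<Sum>i<N. z i * mat_apply ?A x i)"
      unfolding mat_apply_def by (intro tendsto_intros summable_LIMSEQ summ x)
    moreover have "(\<Sum>i<N. z i * mat_apply ?A x i) = complex_of_real s"
      unfolding s_def of_real_sum z_def
      by (intro sum.cong refl) (simp only: complex_norm_square mult.commute)
    ultimately have lim: "(\<lambda>J. cmod (\<Sum>i<N. z i * (\<Sum>j<J. a (i + j) * x j))) \<longlonglongrightarrow> s"
      using s0 tendsto_norm[of _ "complex_of_real s"] by force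
    have "cmod (\<Sum>i<N. z i * (\<Sum>j<J. a (i + j) * x j)) \<le> K * (sqrt s * ell2_norm x)" for J
    proof -
      have "(\<Sum>i<N. z i * (\<Sum>j<J. a (i + j) * x j)) = (\<Sum>i<N. \<Sum>j<J. a (i + j) * (z i * x j))"
        by (simp add: sum_distrib_left mult.left_commute)
      also have "cmod \<dots> \<le> K * (sqrt (\<Sum>i<N. (cmod (z i))\<^sup>2) * sqrt (\<Sum>j<J. (cmod (x j))\<^sup>2))"
        by (rule hankel_nuclear_bilinear[OF a])
      also have "\<dots> \<le> K * (sqrt s * ell2_norm x)"
        using x K0 unfolding ell2_norm_def ell2_def z_def s_def complex_mod_cnj
        by (intro mult_left_mono mult_mono real_sqrt_le_mono sum_le_suminf)
           (auto intro: sum_nonneg)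
      finally show ?thesis .
    qed
    with lim have "s \<le> K * (sqrt s * ell2_norm x)" by (intro LIMSEQ_le_const2[OF lim]) blast
    then have "s \<le> (K * ell2_norm x) * sqrt s" by (simp add: mult_ac)
    moreover have "K * ell2_norm x \<ge> 0"
      using K0 ell2_norm_nonneg[OF x] by simp
    ultimately show ?thesis
      unfolding s_def[symmetric] using s0 by (intro le_power2_if_le_mult_sqrt)
  qed
  show ?thesis
    unfolding bounded_matrix_def
  proof (intro conjI ballI allI exI)
    fix x :: "nat \<Rightarrow> complex" and i assume x: "x \<in> ell2"
    show "summable (\<lambda>j. a (i + j) * x j)" using x by (rule summ)
    show "mat_apply ?A x \<in> ell2" by (rule ell2_bound(1)[OF part[OF x]])
    have "ell2_norm (mat_apply ?A x) \<le> sqrt ((K * ell2_norm x)\<^sup>2)"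
      unfolding ell2_norm_def[of "mat_apply ?A x"] by (intro real_sqrt_le_mono ell2_bound(2)[OF part[OF x]])
    also have "\<dots> = K * ell2_norm x"
      using K0 ell2_norm_nonneg[OF x] by simp
    finally show "ell2_norm (mat_apply ?A x) \<le> K * ell2_norm x" .
  qed
qed

lemma mat_abs_square:
  assumes A: "bounded_matrix A" "symmetric_matrix A"
  shows "mat_op (mat_abs A) (mat_op (mat_abs A) x) = anti_op A (anti_op A x)"
  using mat_abs_symmetric[OF A] mat_mult_eq_iff[OF A bounded_mat_abs[OF A]]
  by (metis blinfun_apply_blinfun_compose)

text \<open>With $(P + \epsilon) w_i = e_i$ for $P = |A|$, the vectors $S w_i$ are the images of the basis under
  the contraction $S (P + \epsilon)^{-1}$, an approximation to the polar part of $A$. Pairing them with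
  the columns of $A$ recovers the diagonal of $P$ up to $\epsilon$.\<close>

lemma hankel_nuclear_trace_class:
  assumes a: "hankel_nuclear K a"
  shows "trace_class (\<lambda>i j. a (i + j))"
proof -
  let ?A = "\<lambda>i j. a (i + j)"
  have A: "bounded_matrix ?A" "symmetric_matrix ?A"
    using hankel_nuclear_bounded[OF a] by (simp_all add: symmetric_matrix_def add.commute)
  define P S where "P = mat_op (mat_abs ?A)" and "S = anti_op ?A"
  have P: "psd P" and S: "selfadjoint S" and PS: "\<And>x. P (P x) = S (S x)"
    and norms: "\<And>x. norm (P x) = norm (S x)"
    unfolding P_def S_def
    by (rule psd_mat_abs[OF A] selfadjoint_anti_op[OF A] mat_abs_square[OF A] norm_mat_abs[OF A])+
  define p where "p i = P (single i 1) \<bullet> single i 1" for i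
  have p0: "p i \<ge> 0" for i unfolding p_def by (rule psdD[OF P])
  have eps: "(\<Sum>i<M. p i) \<le> K + real M * e" if e: "e > 0" for M and e :: real
  proof -
    have "\<exists>w. P w + e *\<^sub>R w = single i 1" for i
      using psd_add_eps_surj[OF P e] by metis
    then obtain w where w: "\<And>i. P (w i) + e *\<^sub>R w i = single i 1" by metis
    have p_le: "p i \<le> e + S (single i 1) \<bullet> S (w i)" for i
    proof -
      let ?e = "single i 1"
      have "S ?e \<bullet> S (w i) = S (S ?e) \<bullet> w i" using selfadjointD[OF S, of "S ?e" "w i"] by simp
      also have "\<dots> = P ?e \<bullet> P (w i)"
        using selfadjointD[OF psd_selfadjoint[OF P], of "P ?e" "w i"] by (simp add: PS)
      also have "P (w i) = ?e - e *\<^sub>R w i" using w[of i] by (simp add: eq_diff_eq)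
      also have "P ?e \<bullet> (?e - e *\<^sub>R w i) = p i - e * (?e \<bullet> P (w i))"
        using selfadjointD[OF psd_selfadjoint[OF P], of ?e "w i"] by (simp add: p_def inner_diff_right)
      finally have eq: "S ?e \<bullet> S (w i) = p i - e * (?e \<bullet> P (w i))" .
      have "?e \<bullet> P (w i) \<le> norm ?e * norm (P (w i))" by (rule norm_cauchy_schwarz)
      also have "\<dots> \<le> norm ?e * norm ?e"
        using psd_norm_le_add_eps[OF P, of e "w i"] e by (intro mult_left_mono) (auto simp: w)
      finally have "e * (?e \<bullet> P (w i)) \<le> e * 1" using e by (intro mult_left_mono) auto
      with eq show ?thesis by simp
    qed
    have sums: "(\<lambda>J. \<Sum>j<J. Re (a (i + j) * coord (S (w i)) j)) \<longlonglongrightarrow> S (single i 1) \<bullet> S (w i)" for i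
    proof -
      have "Re (coord (S (single i 1)) j * cnj (coord (S (w i)) j)) = Re (a (i + j) * coord (S (w i)) j)" for j
        by (simp add: S_def anti_op_apply mat_op_single[OF A(1)] add.commute)
      then show ?thesis
        using summable_LIMSEQ[OF l2_inner_summable_Re, of "S (single i 1)" "S (w i)"]
        by (simp only: inner_l2_def)
    qed
    have contr: "(\<Sum>j<J. (cmod (\<Sum>i<M. \<alpha> i * coord (S (w i)) j))\<^sup>2) \<le> (\<Sum>i<M. (cmod (\<alpha> i))\<^sup>2)" for J \<alpha>
    proof -
      define v where "v = (\<Sum>i<M. cscale (cnj (\<alpha> i)) (w i))"
      have "S v = (\<Sum>i<M. cscale (\<alpha> i) (S (w i)))"
        by (simp add: v_def blinfun.sum_right S_def anti_op_cscale[OF A(1)])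
      then have "(\<Sum>j<J. (cmod (\<Sum>i<M. \<alpha> i * coord (S (w i)) j))\<^sup>2) = (\<Sum>j<J. (cmod (coord (S v) j))\<^sup>2)"
        by simp
      also have "\<dots> \<le> (norm (S v))\<^sup>2" by (rule sum_coord_le_norm)
      also have "\<dots> \<le> (norm (P v + e *\<^sub>R v))\<^sup>2"
        using psd_norm_le_add_eps[OF P, of e v] e by (intro power_mono) (auto simp: norms)
      also have "P v + e *\<^sub>R v = (\<Sum>i<M. cscale (cnj (\<alpha> i)) (P (w i) + e *\<^sub>R w i))"
      proof -
        have "cscale c (x + e *\<^sub>R y) = cscale c x + e *\<^sub>R cscale c y" for c x y
          by (rule l2_eqI) (simp add: algebra_simps)
        then show ?thesis
          by (simp add: v_def blinfun.sum_right P_def mat_op_cscale[OF bounded_mat_abs[OF A]]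
              scaleR_sum_right sum.distrib)
      qed
      also have "\<dots> = (\<Sum>i<M. single i (cnj (\<alpha> i)))"
        unfolding w by (intro sum.cong refl) (rule single_cscale[symmetric])
      also have "(norm \<dots>)\<^sup>2 = (\<Sum>i<M. (cmod (\<alpha> i))\<^sup>2)"
        by (simp add: norm_sum_single)
      finally show ?thesis .
    qed
    have "(\<Sum>i<M. S (single i 1) \<bullet> S (w i)) \<le> K"
    proof (rule LIMSEQ_le_const2)
      show "(\<lambda>J. \<Sum>i<M. \<Sum>j<J. Re (a (i + j) * coord (S (w i)) j)) \<longlonglongrightarrow> (\<Sum>i<M. S (single i 1) \<bullet> S (w i))"
        by (intro tendsto_sum sums)
      have "(\<Sum>i<M. \<Sum>j<J. Re (a (i + j) * coord (S (w i)) j)) \<le> K" for J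
      proof -
        have "(\<Sum>i<M. \<Sum>j<J. Re (a (i + j) * coord (S (w i)) j))
            = Re (\<Sum>i<M. \<Sum>j<J. a (i + j) * coord (S (w i)) j)" by (simp only: Re_sum)
        also have "\<dots> \<le> cmod (\<Sum>i<M. \<Sum>j<J. a (i + j) * coord (S (w i)) j)" by (rule complex_Re_le_cmod)
        also have "\<dots> \<le> K" by (rule hankel_nuclearD[OF a contr])
        finally show ?thesis .
      qed
      then show "\<exists>J0. \<forall>J\<ge>J0. (\<Sum>i<M. \<Sum>j<J. Re (a (i + j) * coord (S (w i)) j)) \<le> K" by blast
    qed
    moreover have "(\<Sum>i<M. p i) \<le> (\<Sum>i<M. e + S (single i 1) \<bullet> S (w i))" by (intro sum_mono p_le)
    ultimately show ?thesis by (simp add: sum.distrib)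
  qed
  have "(\<Sum>i<M. p i) \<le> K" for M
  proof (rule field_le_epsilon)
    fix d :: real assume d: "d > 0"
    have "(\<Sum>i<M. p i) \<le> K + real M * (d / (real M + 1))" using d by (intro eps) auto
    also have "real M * (d / (real M + 1)) \<le> d" using d by (simp add: field_simps)
    finally show "(\<Sum>i<M. p i) \<le> K + d" by simp
  qed
  then have "summable p" using p0 by (intro summableI_nonneg_bounded)
  then show ?thesis unfolding p_def P_def by (rule trace_classI[OF A])
qed

definition disc_weight :: "complex \<Rightarrow> real" where
  "disc_weight s = cmod (1 - s) / (1 - cmod s)"

lemma disc_weight_ge_one:
  assumes "cmod s < 1" shows "1 \<le> disc_weight s"
  using assms norm_triangle_ineq2[of 1 s] by (simp add: disc_weight_def)

lemma space_disc_borel [simp]: "space disc_borel = ball 0 1"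
  by (simp add: disc_borel_def space_restrict_space)

lemma measurable_disc_borel: "f \<in> borel_measurable borel \<Longrightarrow> f \<in> borel_measurable disc_borel"
  unfolding disc_borel_def by (rule measurable_restrict_space1)

lemma disc_weight_measurable: "disc_weight \<in> borel_measurable disc_borel"
  by (rule measurable_disc_borel) (simp add: disc_weight_def[abs_def])

context
  fixes N :: "complex measure"
  assumes N: "sets N = sets disc_borel"
    and fin: "(\<integral>\<^sup>+ s. ennreal (disc_weight s) \<partial>N) < \<infinity>"
begin

lemma disc_space: "space N = ball 0 1"
  using sets_eq_imp_space_eq[OF N] by simp

lemma disc_measurable: "f \<in> borel_measurable borel \<Longrightarrow> f \<in> borel_measurable N"
  using measurable_disc_borel measurable_cong_sets[OF N refl] by blast

lemma disc_weight_integrable: "integrable N disc_weight"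
proof (rule integrableI_bounded)
  show "disc_weight \<in> borel_measurable N"
    using disc_weight_measurable measurable_cong_sets[OF N refl] by blast
  have "(\<integral>\<^sup>+ s. ennreal (norm (disc_weight s)) \<partial>N) = (\<integral>\<^sup>+ s. ennreal (disc_weight s) \<partial>N)"
    by (intro nn_integral_cong) (auto simp: disc_weight_def disc_space)
  then show "(\<integral>\<^sup>+ s. ennreal (norm (disc_weight s)) \<partial>N) < \<infinity>" using fin by simp
qed

lemma disc_integrable:
  fixes f :: "complex \<Rightarrow> complex"
  assumes "f \<in> borel_measurable borel" "\<And>s. cmod s < 1 \<Longrightarrow> cmod (f s) \<le> disc_weight s"
  shows "integrable N f"
proof (rule Bochner_Integration.integrable_bound[OF disc_weight_integrable])
  show "f \<in> borel_measurable N" using assms(1) by (rule disc_measurable)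
  show "AE s in N. norm (f s) \<le> norm (disc_weight s)"
    using assms(2) disc_space by (intro AE_I2) (auto intro: order_trans[OF _ abs_ge_self])
qed

lemma disc_power_integrable: "integrable N (\<lambda>s. s ^ n)"
proof (rule disc_integrable)
  fix s :: complex assume "cmod s < 1"
  then have "cmod (s ^ n) \<le> 1" by (simp add: norm_power power_le_one)
  also have "\<dots> \<le> disc_weight s" using \<open>cmod s < 1\<close> by (rule disc_weight_ge_one)
  finally show "cmod (s ^ n) \<le> disc_weight s" .
qed simp

text \<open>The Hankel matrix of $s^{i+j}$ is the rank one matrix $v v^T$ with $v = (s^i)_i$, of norm
  $(1 - |s|^2)^{-1}$; integrating gives the bound.\<close>

lemma hankel_nuclear_disc:
  "hankel_nuclear (\<integral>s. disc_weight s \<partial>N) (\<lambda>n. (\<integral>s. s ^ n \<partial>N) - (\<integral>s. s ^ Suc n \<partial>N))"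
  unfolding hankel_nuclear_def
proof (intro allI impI)
  fix M J :: nat and U :: "nat \<Rightarrow> nat \<Rightarrow> complex"
  assume U: "\<forall>\<alpha>. (\<Sum>j<J. (cmod (\<Sum>i<M. \<alpha> i * U i j))\<^sup>2) \<le> (\<Sum>i<M. (cmod (\<alpha> i))\<^sup>2)"
  define F where "F s = (\<Sum>i<M. \<Sum>j<J. (s ^ (i + j) - s ^ Suc (i + j)) * U i j)" for s :: complex
  have F: "cmod (F s) \<le> disc_weight s" if s: "cmod s < 1" for s
  proof -
    have geo: "(\<Sum>i<n. (cmod (s ^ i))\<^sup>2) \<le> 1 / (1 - cmod s)" for n
    proof -
      have s2: "(cmod s)\<^sup>2 < 1" using s by (simp add: power_less_one_iff)
      have "(\<Sum>i<n. (cmod (s ^ i))\<^sup>2) = (\<Sum>i<n. ((cmod s)\<^sup>2) ^ i)"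
        by (simp add: norm_power flip: power_mult) (simp add: mult.commute)
      also have "\<dots> \<le> (\<Sum>i. ((cmod s)\<^sup>2) ^ i)"
        using s2 by (intro sum_le_suminf summable_geometric) auto
      also have "\<dots> = 1 / (1 - (cmod s)\<^sup>2)" using s2 by (intro suminf_geometric) auto
      also have "\<dots> \<le> 1 / (1 - cmod s)"
        using s s2 by (intro divide_left_mono) (auto simp: power2_eq_square mult_left_le)
      finally show ?thesis .
    qed
    have "F s = (\<Sum>j<J. (\<Sum>i<M. s ^ i * U i j) * s ^ j) * (1 - s)"
    proof -
      have "F s = (\<Sum>i<M. \<Sum>j<J. (s ^ i * U i j) * s ^ j * (1 - s))"
        unfolding F_def by (intro sum.cong refl) (simp add: power_add algebra_simps)
      also have "\<dots> = (\<Sum>j<J. \<Sum>i<M. (s ^ i * U i j) * s ^ j * (1 - s))" by (rule sum.swap)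
      finally show ?thesis by (simp add: sum_distrib_right)
    qed
    then have "cmod (F s) = cmod (\<Sum>j<J. (\<Sum>i<M. s ^ i * U i j) * s ^ j) * cmod (1 - s)"
      by (simp add: norm_mult)
    also have "\<dots> \<le> (sqrt (\<Sum>j<J. (cmod (\<Sum>i<M. s ^ i * U i j))\<^sup>2) * sqrt (\<Sum>j<J. (cmod (s ^ j))\<^sup>2)) * cmod (1 - s)"
      by (intro mult_right_mono sum_mult_Cauchy_Schwarz) auto
    also have "\<dots> \<le> (sqrt (1 / (1 - cmod s)) * sqrt (1 / (1 - cmod s))) * cmod (1 - s)"
      using s by (intro mult_right_mono mult_mono real_sqrt_le_mono geo order_trans[OF U[rule_format] geo])
        (auto intro: sum_nonneg)
    also have "\<dots> = disc_weight s" using s by (simp add: disc_weight_def)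
    finally show ?thesis .
  qed
  have "(\<Sum>i<M. \<Sum>j<J. ((\<integral>s. s ^ (i + j) \<partial>N) - (\<integral>s. s ^ Suc (i + j) \<partial>N)) * U i j) = (\<integral>s. F s \<partial>N)"
    unfolding F_def using disc_power_integrable
    by (simp add: Bochner_Integration.integral_sum Bochner_Integration.integral_diff del: power_Suc)
  also have "cmod \<dots> \<le> (\<integral>s. cmod (F s) \<partial>N)" by (rule integral_norm_bound)
  also have "\<dots> \<le> (\<integral>s. disc_weight s \<partial>N)"
  proof (rule integral_mono)
    show "integrable N (\<lambda>s. cmod (F s))"
      using F by (intro integrable_norm disc_integrable) (auto simp: F_def)
  qed (use F disc_space disc_weight_integrable in auto)
  finally show "cmod (\<Sum>i<M. \<Sum>j<J. ((\<integral>s. s ^ (i + j) \<partial>N) - (\<integral>s. s ^ Suc (i + j) \<partial>N)) * U i j)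
      \<le> (\<integral>s. disc_weight s \<partial>N)" .
qed

end

theorem representable_imp_class_C:
  assumes \<nu>: "complex_measure disc_borel \<nu>" and rep: "represents c \<nu> \<phi>"
    and fin: "weighted_variation \<nu> < \<infinity>"
  shows "\<phi> \<in> class_C"
proof -
  define D where "D \<mu> n = (\<integral>s. s ^ n \<partial>positive_part disc_borel \<mu>) - (\<integral>s. s ^ Suc n \<partial>positive_part disc_borel \<mu>)"
    for \<mu> :: "complex set \<Rightarrow> real" and n
  have ex: "\<exists>K. hankel_nuclear K (D \<mu>)" if "\<And>A. \<mu> A \<le> cmod (\<nu> A)" for \<mu>
  proof -
    have "(\<integral>\<^sup>+ s. ennreal (disc_weight s) \<partial>positive_part disc_borel \<mu>) \<le> weighted_variation \<nu>"
      unfolding weighted_variation_def disc_weight_def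
      by (rule positive_part_le_total_variation[OF \<nu> that])
    then have "(\<integral>\<^sup>+ s. ennreal (disc_weight s) \<partial>positive_part disc_borel \<mu>) < \<infinity>"
      using fin by (rule le_less_trans)
    then show ?thesis
      unfolding D_def using hankel_nuclear_disc[of "positive_part disc_borel \<mu>"] by auto
  qed
  have rep': "\<phi> n = c + complex_measure_integral disc_borel \<nu> (\<lambda>s. s ^ n)" for n
    using rep by (simp add: represents_def)
  have bounds: "Re z \<le> cmod z" "- Re z \<le> cmod z" "Im z \<le> cmod z" "- Im z \<le> cmod z" for z
    using abs_Re_le_cmod[of z] abs_Im_le_cmod[of z] by linarith+
  obtain K1 K2 K3 K4 where K:
    "hankel_nuclear K1 (D (\<lambda>A. Re (\<nu> A)))" "hankel_nuclear K2 (D (\<lambda>A. - Re (\<nu> A)))"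
    "hankel_nuclear K3 (D (\<lambda>A. Im (\<nu> A)))" "hankel_nuclear K4 (D (\<lambda>A. - Im (\<nu> A)))"
    using ex bounds by metis
  have "hankel_nuclear (K1 + K2 + (K3 + K4)) (\<lambda>n. (D (\<lambda>A. Re (\<nu> A)) n + (-1) * D (\<lambda>A. - Re (\<nu> A)) n)
      + (\<i> * D (\<lambda>A. Im (\<nu> A)) n + (- \<i>) * D (\<lambda>A. - Im (\<nu> A)) n))"
    using K by (intro hankel_nuclear_add hankel_nuclear_cmult) auto
  also have "(\<lambda>n. (D (\<lambda>A. Re (\<nu> A)) n + (-1) * D (\<lambda>A. - Re (\<nu> A)) n)
      + (\<i> * D (\<lambda>A. Im (\<nu> A)) n + (- \<i>) * D (\<lambda>A. - Im (\<nu> A)) n)) = (\<lambda>n. \<phi> n - \<phi> (Suc n))"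
    by (intro ext) (simp add: rep' D_def complex_measure_integral_def algebra_simps del: power_Suc)
  finally have "trace_class (\<lambda>i j. \<phi> (i + j) - \<phi> (Suc (i + j)))"
    by (rule hankel_nuclear_trace_class)
  then show ?thesis by (simp add: class_C_def hankel_h_def)
qed

section \<open>Coefficients of $(1 - z)^{-3/2}$\<close>

definition p_coeff :: "nat \<Rightarrow> real" where
  "p_coeff n = pochhammer (3/2) n / fact n"

lemma p_coeff_nonneg: "p_coeff n \<ge> 0"
  by (simp add: p_coeff_def pochhammer_nonneg)

lemma p_coeff_convolution: "(\<Sum>k\<le>n. p_coeff k * p_coeff (n - k)) = (real n + 1) * (real n + 2) / 2"
proof -
  have poch3: "pochhammer (3::real) n = fact n * ((real n + 1) * (real n + 2) / 2)" for n
    by (induction n) (auto simp: pochhammer_Suc algebra_simps)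
  have "(\<Sum>k\<le>n. p_coeff k * p_coeff (n - k))
      = (\<Sum>k\<le>n. real (n choose k) * pochhammer (3/2) k * pochhammer (3/2) (n - k)) / fact n"
    unfolding sum_divide_distrib
    by (intro sum.cong refl) (simp add: p_coeff_def binomial_fact field_simps)
  also have "\<dots> = pochhammer (3/2 + 3/2) n / fact n"
    by (simp only: pochhammer_binomial_sum)
  finally show ?thesis by (simp add: poch3)
qed

text \<open>Logarithmic convexity of the Gamma function at the midpoint of $n + 1$ and $n + 2$; the constant
  is $\Gamma(3/2)^{-2}$.\<close>

lemma p_coeff_square_le: "(p_coeff n)\<^sup>2 \<le> 4 / pi * (real n + 1)"
proof -
  define x :: real where "x = real n + 1"
  have x: "x > 0" by (simp add: x_def)
  have G: "Gamma x > 0" "Gamma (x + 1) > 0" "Gamma (x + 1/2) > 0"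
    using x by (auto intro!: Gamma_real_pos)
  have "(ln \<circ> Gamma) ((1 - 1/2) *\<^sub>R x + (1/2) *\<^sub>R (x + 1))
      \<le> (1 - 1/2) * (ln \<circ> Gamma) x + (1/2) * (ln \<circ> Gamma) (x + 1)"
    using x by (intro convex_onD[OF log_convex_Gamma_real]) auto
  moreover have "(1 - 1/2) *\<^sub>R x + (1/2) *\<^sub>R (x + 1) = x + 1/2" by (simp add: field_simps)
  ultimately have "2 * ln (Gamma (x + 1/2)) \<le> ln (Gamma x) + ln (Gamma (x + 1))"
    by (simp add: field_simps)
  then have "ln ((Gamma (x + 1/2))\<^sup>2) \<le> ln (Gamma x * Gamma (x + 1))"
    using G by (simp add: ln_mult_pos ln_realpow)
  then have "(Gamma (x + 1/2))\<^sup>2 \<le> Gamma x * Gamma (x + 1)"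
    using G by (subst (asm) ln_le_cancel_iff) auto
  also have "Gamma (x + 1) = x * Gamma x" using x by (intro Gamma_plus1) (auto elim!: nonpos_Ints_cases)
  finally have *: "(Gamma (x + 1/2))\<^sup>2 \<le> x * (Gamma x)\<^sup>2" by (simp add: power2_eq_square mult_ac)
  have fact: "Gamma x = fact n" unfolding x_def using Gamma_fact[of n] by (simp add: add.commute)
  have "Gamma (1/2 + 1 :: real) = 1/2 * Gamma (1/2)" by (intro Gamma_plus1) (auto elim!: nonpos_Ints_cases)
  then have half: "Gamma (3/2 :: real) = sqrt pi / 2" by (simp add: Gamma_one_half_real)
  have "pochhammer (3/2 :: real) n = Gamma (3/2 + real n) / Gamma (3/2)"
    by (intro pochhammer_Gamma) (auto elim!: nonpos_Ints_cases)
  also have "3/2 + real n = x + 1/2" by (simp add: x_def)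
  finally have "p_coeff n = 2 * Gamma (x + 1/2) / (sqrt pi * fact n)"
    by (simp add: p_coeff_def half)
  then have "(p_coeff n)\<^sup>2 = 4 / pi * ((Gamma (x + 1/2))\<^sup>2 / (fact n)\<^sup>2)"
    by (simp add: power_divide power_mult_distrib)
  also have "\<dots> \<le> 4 / pi * (x * (Gamma x)\<^sup>2 / (fact n)\<^sup>2)"
    by (intro mult_left_mono divide_right_mono *) auto
  also have "\<dots> = 4 / pi * x" by (simp add: fact)
  finally show ?thesis by (simp only: x_def)
qed

section \<open>The radially uniform measure on the disc\<close>

text \<open>The image of $dt\,du$ under $(t, u) \mapsto t e^{2 \pi i u}$. Up to a factor it is the image of planar
  Lebesgue measure under $z \mapsto z^2$.\<close>

definition polar_map :: "real \<times> real \<Rightarrow> complex" where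
  "polar_map = (\<lambda>(t, u). of_real t * cis (2 * pi * u))"

definition polar_base :: "(real \<times> real) measure" where
  "polar_base = restrict_space lborel {0..<1} \<Otimes>\<^sub>M restrict_space lborel {0..1}"

definition disc_measure :: "complex measure" where
  "disc_measure = distr polar_base disc_borel polar_map"

lemma space_polar_base: "space polar_base = {0..<1} \<times> {0..1}"
  by (simp add: polar_base_def space_pair_measure space_restrict_space)

lemma finite_measure_unit_interval:
  "finite_measure (restrict_space lborel {0..<1::real})" "finite_measure (restrict_space lborel {0..1::real})"
  by (auto intro!: finite_measureI simp: emeasure_restrict_space space_restrict_space)

lemma finite_measure_polar_base: "finite_measure polar_base"
  unfolding polar_base_def by (intro finite_measure_pair_measure finite_measure_unit_interval)

lemma polar_map_measurable: "polar_map \<in> polar_base \<rightarrow>\<^sub>M disc_borel"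
  unfolding disc_borel_def
proof (rule measurable_restrict_space2)
  show "polar_map \<in> space polar_base \<rightarrow> ball 0 1"
    by (auto simp: space_polar_base polar_map_def norm_mult)
  have "(\<lambda>x. of_real (fst x) * cis (2 * pi * snd x)) \<in> borel_measurable (borel \<Otimes>\<^sub>M borel)"
    unfolding borel_prod
    by (intro borel_measurable_continuous_onI continuous_intros)
  then have *: "polar_map \<in> borel \<Otimes>\<^sub>M borel \<rightarrow>\<^sub>M borel"
    by (simp add: polar_map_def split_beta')
  have "(\<lambda>x. x) \<in> restrict_space lborel A \<rightarrow>\<^sub>M (borel :: real measure)" for A
    by (rule measurable_restrict_space1) simp
  then have "(\<lambda>x. (fst x, snd x)) \<in> polar_base \<rightarrow>\<^sub>M (borel \<Otimes>\<^sub>M borel)"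
    unfolding polar_base_def by (intro measurable_Pair measurable_compose[OF measurable_fst]
        measurable_compose[OF measurable_snd])
  from measurable_compose[OF this *] show "polar_map \<in> borel_measurable polar_base" by simp
qed

lemma sets_disc_measure [simp, measurable_cong]: "sets disc_measure = sets disc_borel"
  and space_disc_measure [simp]: "space disc_measure = ball 0 1"
  by (simp_all add: disc_measure_def disc_borel_def space_restrict_space)

lemma finite_measure_disc_measure: "finite_measure disc_measure"
  unfolding disc_measure_def
  by (rule finite_measure.finite_measure_distr[OF finite_measure_polar_base polar_map_measurable])

lemma disc_measure_measurable: "f \<in> borel_measurable borel \<Longrightarrow> f \<in> borel_measurable disc_measure"
  unfolding measurable_cong_sets[OF sets_disc_measure refl] disc_borel_def
  by (rule measurable_restrict_space1)

lemma integrable_disc_measure_bounded: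
  fixes f :: "complex \<Rightarrow> 'b::{banach, second_countable_topology}"
  assumes "f \<in> borel_measurable borel" "\<And>s. cmod s < 1 \<Longrightarrow> norm (f s) \<le> B"
  shows "integrable disc_measure f"
proof -
  interpret finite_measure disc_measure by (rule finite_measure_disc_measure)
  show ?thesis
    using assms by (intro integrable_const_bound[where B = B] AE_I2 disc_measure_measurable) auto
qed

lemma integral_unit_power: "(\<integral>t. t ^ n \<partial>restrict_space lborel {0..<1::real}) = 1 / (real n + 1)"
proof -
  have "((\<lambda>t::real. t ^ Suc n / (real n + 1)) has_vector_derivative x ^ n) (at x within {0..1})" for x
  proof -
    have "((\<lambda>t::real. t ^ Suc n / (real n + 1)) has_real_derivative (1 + real n) * (1 * x ^ n) / (real n + 1))
        (at x within {0..1})"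
      by (intro DERIV_cdivide DERIV_power_Suc DERIV_ident)
    then show ?thesis
      by (simp add: has_real_derivative_iff_has_vector_derivative add.commute del: power_Suc)
  qed
  then have "has_bochner_integral lborel (\<lambda>x. indicator {0..1} x *\<^sub>R x ^ n)
      (1 ^ Suc n / (real n + 1) - 0 ^ Suc n / (real n + 1))"
    by (intro has_bochner_integral_FTC_Icc continuous_intros) auto
  then have "(\<integral>x. indicator {0..1} x *\<^sub>R x ^ n \<partial>lborel) = 1 / (real n + 1)"
    by (auto dest: has_bochner_integral_integral_eq)
  moreover have "(\<integral>t. t ^ n \<partial>restrict_space lborel {0..<1::real}) = (\<integral>x. indicator {0..<1} x *\<^sub>R x ^ n \<partial>lborel)"
    by (subst integral_restrict_space) auto
  moreover have "(\<integral>x. indicator {0..<1} x *\<^sub>R x ^ n \<partial>lborel) = (\<integral>x. indicator {0..1} x *\<^sub>R x ^ n \<partial>(lborel :: real measure))"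
  proof (intro integral_cong_AE)
    show "AE x in (lborel :: real measure). indicat_real {0..<1} x *\<^sub>R x ^ n = indicat_real {0..1} x *\<^sub>R x ^ n"
      using AE_lborel_singleton[of "1::real"] by eventually_elim (auto split: split_indicator)
  qed measurable
  ultimately show ?thesis by simp
qed

lemma integral_cis:
  "(\<integral>u. cis (2 * pi * of_int k * u) \<partial>restrict_space lborel {0..1::real}) = (if k = 0 then 1 else 0)"
proof (cases "k = 0")
  case True
  then show ?thesis
    by (simp add: measure_restrict_space space_restrict_space)
next
  case False
  define c where "c = 2 * pi * of_int k"
  have c: "c \<noteq> 0" using False by (simp add: c_def)
  have deriv: "((\<lambda>u. cis (c * u) / (\<i> * c)) has_vector_derivative cis (c * x)) (at x within {0..1})" for x
  proof -
    have "((\<lambda>z. exp (\<i> * c * z) / (\<i> * c)) has_field_derivative exp (\<i> * c * of_real x)) (at (of_real x))"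
      using c by (auto intro!: derivative_eq_intros)
    from has_vector_derivative_real_field[OF this] show ?thesis
      by (simp add: cis_conv_exp mult.assoc)
  qed
  have "has_bochner_integral lborel (\<lambda>x. indicator {0..1} x *\<^sub>R cis (c * x)) (cis (c * 1) / (\<i> * c) - cis (c * 0) / (\<i> * c))"
    using deriv by (intro has_bochner_integral_FTC_Icc continuous_intros) auto
  moreover have "cis (c * 1) = 1"
    using cis_multiple_2pi[of "of_int k"] by (simp add: c_def)
  ultimately have "(\<integral>x. indicator {0..1} x *\<^sub>R cis (c * x) \<partial>lborel) = 0"
    by (auto dest: has_bochner_integral_integral_eq)
  then show ?thesis
    using False by (subst integral_restrict_space) (auto simp: c_def)
qed

text \<open>Monomials with different angular dependence are orthogonal.\<close>

lemma integral_disc_monomial: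
  "(\<integral>s. s ^ i * cnj s ^ j * of_real (cmod s ^ k) \<partial>disc_measure)
     = (if i = j then 1 / (of_nat (2 * i + k) + 1) else 0)"
proof -
  define f where "f s = s ^ i * cnj s ^ j * of_real (cmod s ^ k)" for s :: complex
  let ?T = "restrict_space lborel {0..<1::real}" and ?U = "restrict_space lborel {0..1::real}"
  interpret T: finite_measure ?T by (rule finite_measure_unit_interval)
  interpret U: finite_measure ?U by (rule finite_measure_unit_interval)
  interpret pair_sigma_finite ?T ?U
    by (simp add: pair_sigma_finite_def T.sigma_finite_measure_axioms U.sigma_finite_measure_axioms)
  have f: "f \<in> borel_measurable borel"
    unfolding f_def by (intro borel_measurable_continuous_onI continuous_intros)
  have bound: "norm (f s) \<le> 1" if "cmod s < 1" for s
    using that by (simp add: f_def norm_mult norm_power power_le_one mult_le_one)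
  have int: "integrable disc_measure f"
    using f bound by (rule integrable_disc_measure_bounded)
  then have int': "integrable (?T \<Otimes>\<^sub>M ?U) (\<lambda>x. f (polar_map x))"
    unfolding disc_measure_def
    by (subst (asm) integrable_distr_eq[OF polar_map_measurable])
       (use f in \<open>auto simp: polar_base_def disc_borel_def intro: measurable_restrict_space1\<close>)
  have polar: "f (polar_map (t, u)) = of_real (t ^ (i + j + k)) * cis (2 * pi * of_int (int i - int j) * u)"
    if "t \<in> space ?T" for t u
  proof -
    have t: "t \<ge> 0" using that by (simp add: space_restrict_space)
    have "f (polar_map (t, u)) = of_real (t ^ (i + j + k)) * (cis (2 * pi * u) ^ i * cnj (cis (2 * pi * u)) ^ j)"
      using t by (simp add: f_def polar_map_def norm_mult power_mult_distrib power_add)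
    also have "cis (2 * pi * u) ^ i * cnj (cis (2 * pi * u)) ^ j = cis (2 * pi * of_int (int i - int j) * u)"
      by (simp add: cis_cnj Complex.DeMoivre cis_mult algebra_simps)
    finally show ?thesis .
  qed
  have "(\<integral>s. f s \<partial>disc_measure) = (\<integral>x. f (polar_map x) \<partial>(?T \<Otimes>\<^sub>M ?U))"
    unfolding disc_measure_def polar_base_def[symmetric]
    by (rule integral_distr[OF polar_map_measurable])
       (use f in \<open>auto simp: disc_borel_def intro: measurable_restrict_space1\<close>)
  also have "\<dots> = (\<integral>t. \<integral>u. f (polar_map (t, u)) \<partial>?U \<partial>?T)"
    by (rule integral_fst'[OF int', symmetric])
  also have "\<dots> = (\<integral>t. of_real (t ^ (i + j + k)) * (if i = j then 1 else 0) \<partial>?T)"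
  proof (rule Bochner_Integration.integral_cong[OF refl])
    fix t assume t: "t \<in> space ?T"
    have "(\<integral>u. f (polar_map (t, u)) \<partial>?U)
        = of_real (t ^ (i + j + k)) * (\<integral>u. cis (2 * pi * of_int (int i - int j) * u) \<partial>?U)"
      unfolding polar[OF t] by (rule integral_mult_right_zero)
    then show "(\<integral>u. f (polar_map (t, u)) \<partial>?U) = of_real (t ^ (i + j + k)) * (if i = j then 1 else 0)"
      by (simp only: integral_cis) simp
  qed
  also have "\<dots> = (if i = j then of_real (\<integral>t. t ^ (i + j + k) \<partial>?T) else 0)"
    by (simp flip: of_real_power)
  also have "\<dots> = (if i = j then 1 / (of_nat (2 * i + k) + 1) else 0)"
    unfolding integral_unit_power by (cases "i = j") (simp_all flip: mult_2)
  finally show ?thesis by (simp add: f_def)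
qed

lemma integrable_disc_monomial:
  "integrable disc_measure (\<lambda>s. s ^ i * cnj s ^ j * complex_of_real (cmod s ^ k))"
  by (rule integrable_disc_measure_bounded[where B = 1])
     (auto intro!: borel_measurable_continuous_onI continuous_intros
       simp: norm_mult norm_power power_le_one mult_le_one)

section \<open>Square partial sums of the reproducing series\<close>

text \<open>For $A(z) = \sum_n a_n z^{2n}$, the value at $z^2$ is the second derivative of
  $\frac12 z^2 A(z)$.\<close>

definition gam :: "(nat \<Rightarrow> complex) \<Rightarrow> complex \<Rightarrow> complex" where
  "gam a s = (\<Sum>n. of_nat ((2 * n + 1) * (n + 1)) * a n * s ^ n)"

lemma summable_quadratic_geometric:
  assumes r: "0 \<le> r" "r < (1::real)"
  shows "summable (\<lambda>n. real ((2 * n + 1) * (n + 1)) * r ^ n)"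
proof -
  \<comment> \<open>the series is dominated by the square of the terms of a convergent series in \<open>x\<close>\<close>
  define x where "x = sqrt r"
  have x: "0 \<le> x" "x < 1" "r = x * x" using r by (auto simp: x_def)
  define f where "f n = real (Suc n) * x ^ n" for n
  have f: "summable f"
    using geometric_deriv_sums[of x] x unfolding f_def by (auto intro: sums_summable)
  have f0: "f n \<ge> 0" for n using x by (simp add: f_def)
  have f_le: "f n \<le> suminf f" for n
    using sum_le_suminf[OF f, of "{n}"] f0 by simp
  show ?thesis
  proof (rule summable_comparison_test')
    show "summable (\<lambda>n. 2 * suminf f * f n)" using f by (rule summable_mult)
    fix n
    have "real ((2 * n + 1) * (n + 1)) * r ^ n = (real (2 * n + 1) * real (n + 1)) * (x ^ n * x ^ n)"
      by (simp only: x(3) power_mult_distrib of_nat_mult)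
    also have "\<dots> \<le> (real (2 * (n + 1)) * real (n + 1)) * (x ^ n * x ^ n)"
      using x by (intro mult_right_mono) auto
    also have "\<dots> = 2 * (f n * f n)" by (simp add: f_def algebra_simps)
    also have "\<dots> \<le> 2 * (suminf f * f n)" using f0 f_le by (intro mult_left_mono mult_right_mono) auto
    finally show "norm (real ((2 * n + 1) * (n + 1)) * r ^ n) \<le> 2 * suminf f * f n"
      using r by simp
  qed
qed

lemma summable_gam:
  assumes B: "\<And>n. cmod (a n) \<le> B" and s: "cmod s < 1"
  shows "summable (\<lambda>n. real ((2 * n + 1) * (n + 1)) * cmod (a n) * cmod s ^ n)"
proof (rule summable_comparison_test')
  show "summable (\<lambda>n. B * (real ((2 * n + 1) * (n + 1)) * cmod s ^ n))"
    using s by (intro summable_mult summable_quadratic_geometric) auto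
  fix n
  have "cmod (a n) * (real ((2 * n + 1) * (n + 1)) * cmod s ^ n) \<le> B * (real ((2 * n + 1) * (n + 1)) * cmod s ^ n)"
    by (intro mult_right_mono B) auto
  then show "norm (real ((2 * n + 1) * (n + 1)) * cmod (a n) * cmod s ^ n) \<le> B * (real ((2 * n + 1) * (n + 1)) * cmod s ^ n)"
    by (simp add: mult_ac)
qed

text \<open>The squares $i, j < N$ lie between the triangles $i + j < N$ and $i + j < 2N$.\<close>

lemma square_sums_tendsto:
  fixes f :: "nat \<Rightarrow> nat \<Rightarrow> complex"
  assumes f: "summable (\<lambda>n. \<Sum>i\<le>n. cmod (f i (n - i)))"
  shows "(\<lambda>N. \<Sum>i<N. \<Sum>j<N. f i j) \<longlonglongrightarrow> (\<Sum>n. \<Sum>i\<le>n. f i (n - i))"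
proof -
  define T where "T N = {(i, j). i + j < N}" for N :: nat
  define g where "g N = (\<Sum>n<N. \<Sum>i\<le>n. cmod (f i (n - i)))" for N
  have tri: "(\<Sum>(i, j)\<in>T N. h i j) = (\<Sum>n<N. \<Sum>i\<le>n. h i (n - i))" for h :: "nat \<Rightarrow> nat \<Rightarrow> 'b::comm_monoid_add" and N
    unfolding T_def by (rule sum.triangle_reindex)
  have finT: "finite (T N)" for N
    by (rule finite_subset[of _ "{..<N} \<times> {..<N}"]) (auto simp: T_def)
  have sq: "T N \<subseteq> {..<N} \<times> {..<N}" "{..<N} \<times> {..<N} \<subseteq> T (2 * N)" for N
    by (auto simp: T_def)
  have bound: "cmod ((\<Sum>i<N. \<Sum>j<N. f i j) - (\<Sum>n<N. \<Sum>i\<le>n. f i (n - i))) \<le> g (2 * N) - g N" for N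
  proof -
    have "(\<Sum>i<N. \<Sum>j<N. f i j) - (\<Sum>n<N. \<Sum>i\<le>n. f i (n - i))
        = (\<Sum>(i, j)\<in>{..<N} \<times> {..<N} - T N. f i j)"
      unfolding tri[symmetric] sum.cartesian_product using sq by (intro sum_diff[symmetric]) auto
    also have "cmod \<dots> \<le> (\<Sum>(i, j)\<in>{..<N} \<times> {..<N} - T N. cmod (f i j))"
      by (rule order_trans[OF norm_sum]) (simp add: split_beta')
    also have "\<dots> \<le> (\<Sum>(i, j)\<in>T (2 * N) - T N. cmod (f i j))"
      using sq[of N] finT by (intro sum_mono2) auto
    also have "\<dots> = (\<Sum>(i, j)\<in>T (2 * N). cmod (f i j)) - (\<Sum>(i, j)\<in>T N. cmod (f i j))"
      using sq[of N] finT by (intro sum_diff) auto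
    finally show ?thesis by (simp add: tri g_def)
  qed
  have glim: "g \<longlonglongrightarrow> suminf (\<lambda>n. \<Sum>i\<le>n. cmod (f i (n - i)))"
    unfolding g_def by (rule summable_LIMSEQ[OF f])
  moreover have "(\<lambda>N. g (2 * N)) \<longlonglongrightarrow> suminf (\<lambda>n. \<Sum>i\<le>n. cmod (f i (n - i)))"
    using LIMSEQ_subseq_LIMSEQ[OF glim, of "\<lambda>N. 2 * N"] by (simp add: strict_mono_def o_def)
  ultimately have "(\<lambda>N. g (2 * N) - g N) \<longlonglongrightarrow> 0"
    using tendsto_diff by fastforce
  then have diff: "(\<lambda>N. (\<Sum>i<N. \<Sum>j<N. f i j) - (\<Sum>n<N. \<Sum>i\<le>n. f i (n - i))) \<longlonglongrightarrow> 0"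
    by (rule Lim_null_comparison[rotated]) (simp add: bound)
  have "summable (\<lambda>n. \<Sum>i\<le>n. f i (n - i))"
    by (rule summable_comparison_test'[OF f]) (rule norm_sum)
  then have "(\<lambda>N. \<Sum>n<N. \<Sum>i\<le>n. f i (n - i)) \<longlonglongrightarrow> (\<Sum>n. \<Sum>i\<le>n. f i (n - i))"
    by (rule summable_LIMSEQ)
  from tendsto_add[OF diff this] show ?thesis by simp
qed

lemma p_coeff_even_odd:
  "real ((2 * n + 1) * (n + 1)) = (\<Sum>i\<le>n. p_coeff (2 * i) * p_coeff (2 * (n - i)))
     + (\<Sum>i<n. p_coeff (2 * i + 1) * p_coeff (2 * (n - 1 - i) + 1))"
proof -
  have split: "(\<Sum>k\<le>2 * n. g k) = (\<Sum>i\<le>n. g (2 * i)) + (\<Sum>i<n. g (2 * i + 1))" for g :: "nat \<Rightarrow> real" and n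
    by (induction n) (simp_all add: algebra_simps)
  have "real ((2 * n + 1) * (n + 1)) = (\<Sum>k\<le>2 * n. p_coeff k * p_coeff (2 * n - k))"
    unfolding p_coeff_convolution by (simp add: field_simps)
  also have "\<dots> = (\<Sum>i\<le>n. p_coeff (2 * i) * p_coeff (2 * n - 2 * i))
      + (\<Sum>i<n. p_coeff (2 * i + 1) * p_coeff (2 * n - (2 * i + 1)))" by (rule split)
  also have "(\<Sum>i\<le>n. p_coeff (2 * i) * p_coeff (2 * n - 2 * i)) = (\<Sum>i\<le>n. p_coeff (2 * i) * p_coeff (2 * (n - i)))"
    by (simp add: diff_mult_distrib2)
  also have "(\<Sum>i<n. p_coeff (2 * i + 1) * p_coeff (2 * n - (2 * i + 1)))
      = (\<Sum>i<n. p_coeff (2 * i + 1) * p_coeff (2 * (n - 1 - i) + 1))"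
  proof (rule sum.cong[OF refl])
    fix i assume "i \<in> {..<n}"
    then have "2 * n - (2 * i + 1) = 2 * (n - 1 - i) + 1" by auto
    then show "p_coeff (2 * i + 1) * p_coeff (2 * n - (2 * i + 1)) = p_coeff (2 * i + 1) * p_coeff (2 * (n - 1 - i) + 1)"
      by simp
  qed
  finally show ?thesis .
qed

text \<open>Splitting the convolution square of the coefficients into even and odd indices turns \<open>gam\<close> into
  a quadratic expression in the matrices $(a_{i+j})$ and $(a_{i+j+1})$. These are the even and the odd
  diagonal block of the Hankel matrix of the sequence $a_0, 0, a_1, 0, a_2, \ldots$.\<close>

lemma gam_square_sums:
  fixes a :: "nat \<Rightarrow> complex" and s :: complex
  assumes B: "\<And>n. cmod (a n) \<le> B" and s: "cmod s < 1"
  shows "(\<lambda>N. (\<Sum>i<N. \<Sum>j<N. a (i + j) * (p_coeff (2 * i) * s ^ i) * (p_coeff (2 * j) * s ^ j))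
      + s * (\<Sum>i<N. \<Sum>j<N. a (i + j + 1) * (p_coeff (2 * i + 1) * s ^ i) * (p_coeff (2 * j + 1) * s ^ j)))
    \<longlonglongrightarrow> gam a s"
proof -
  define c where "c n = real ((2 * n + 1) * (n + 1))" for n
  define Ev where "Ev n = (\<Sum>i\<le>n. p_coeff (2 * i) * p_coeff (2 * (n - i)))" for n
  define Od where "Od n = (\<Sum>i\<le>n. p_coeff (2 * i + 1) * p_coeff (2 * (n - i) + 1))" for n
  have cS: "c (Suc n) = Ev (Suc n) + Od n" for n
    unfolding c_def p_coeff_even_odd[of "Suc n"] Ev_def Od_def by (simp only: lessThan_Suc_atMost diff_Suc_1)
  have c0: "c 0 = Ev 0" unfolding c_def p_coeff_even_odd[of 0] Ev_def by simp
  have nonneg: "Ev n \<ge> 0" "Od n \<ge> 0" for n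
    unfolding Ev_def Od_def by (auto intro!: sum_nonneg mult_nonneg_nonneg p_coeff_nonneg)
  have le: "Ev n \<le> c n" "Od n \<le> c (Suc n)" for n
    using nonneg cS c0 by (cases n; simp)+
  have summ: "summable (\<lambda>n. c n * cmod (a n) * cmod s ^ n)"
    unfolding c_def by (rule summable_gam[OF B s])
  define E where "E i j = a (i + j) * (p_coeff (2 * i) * s ^ i) * (p_coeff (2 * j) * s ^ j)" for i j
  define F where "F i j = a (i + j + 1) * (p_coeff (2 * i + 1) * s ^ i) * (p_coeff (2 * j + 1) * s ^ j)" for i j
  have Ediag: "E i (n - i) = of_real (p_coeff (2 * i) * p_coeff (2 * (n - i))) * (a n * s ^ n)" if "i \<le> n" for i n
    using that by (simp add: E_def power_add[symmetric] mult_ac)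
  have Fdiag: "F i (n - i) = of_real (p_coeff (2 * i + 1) * p_coeff (2 * (n - i) + 1)) * (a (Suc n) * s ^ n)" if "i \<le> n" for i n
    using that by (simp add: F_def power_add[symmetric] mult_ac)
  have Esum: "(\<Sum>i\<le>n. E i (n - i)) = of_real (Ev n) * (a n * s ^ n)" for n
    unfolding Ev_def of_real_sum sum_distrib_right by (intro sum.cong refl Ediag) simp
  have Fsum: "(\<Sum>i\<le>n. F i (n - i)) = of_real (Od n) * (a (Suc n) * s ^ n)" for n
    unfolding Od_def of_real_sum sum_distrib_right by (intro sum.cong refl Fdiag) simp
  have Enorm: "(\<Sum>i\<le>n. cmod (E i (n - i))) = Ev n * (cmod (a n) * cmod s ^ n)" for n
    unfolding Ev_def sum_distrib_right
    by (intro sum.cong refl) (simp add: Ediag norm_mult norm_power p_coeff_nonneg)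
  have Fnorm: "(\<Sum>i\<le>n. cmod (F i (n - i))) = Od n * (cmod (a (Suc n)) * cmod s ^ n)" for n
    unfolding Od_def sum_distrib_right
    by (intro sum.cong refl) (simp add: Fdiag norm_mult norm_power p_coeff_nonneg)
  have Esumm: "summable (\<lambda>n. \<Sum>i\<le>n. cmod (E i (n - i)))"
    unfolding Enorm
  proof (rule summable_comparison_test'[OF summ])
    fix n
    have "Ev n * (cmod (a n) * cmod s ^ n) \<le> c n * (cmod (a n) * cmod s ^ n)"
      by (intro mult_right_mono le) auto
    then show "norm (Ev n * (cmod (a n) * cmod s ^ n)) \<le> c n * cmod (a n) * cmod s ^ n"
      using nonneg by (simp add: mult.assoc)
  qed
  have Fsumm: "summable (\<lambda>n. cmod s * (\<Sum>i\<le>n. cmod (F i (n - i))))"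
    unfolding Fnorm
  proof (rule summable_comparison_test'[OF summable_Suc_iff[THEN iffD2, OF summ]])
    fix n
    have "Od n * (cmod (a (Suc n)) * cmod s ^ Suc n) \<le> c (Suc n) * (cmod (a (Suc n)) * cmod s ^ Suc n)"
      by (intro mult_right_mono le) auto
    then show "norm (cmod s * (Od n * (cmod (a (Suc n)) * cmod s ^ n))) \<le> c (Suc n) * cmod (a (Suc n)) * cmod s ^ Suc n"
      using nonneg by (simp add: mult_ac abs_mult)
  qed
  have norm_sE: "summable (\<lambda>n. of_real (Ev n) * (a n * s ^ n))"
    unfolding Esum[symmetric] by (rule summable_comparison_test'[OF Esumm]) (rule norm_sum)
  have norm_sF: "summable (\<lambda>n. s * (of_real (Od n) * (a (Suc n) * s ^ n)))"
  proof (rule summable_comparison_test'[OF Fsumm])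
    fix n
    show "norm (s * (of_real (Od n) * (a (Suc n) * s ^ n))) \<le> cmod s * (\<Sum>i\<le>n. cmod (F i (n - i)))"
      unfolding Fsum[symmetric] norm_mult by (intro mult_left_mono norm_sum) auto
  qed
  have limE: "(\<lambda>N. \<Sum>i<N. \<Sum>j<N. E i j) \<longlonglongrightarrow> (\<Sum>n. of_real (Ev n) * (a n * s ^ n))"
    using square_sums_tendsto[OF Esumm] by (simp only: Esum)
  have limF: "(\<lambda>N. s * (\<Sum>i<N. \<Sum>j<N. F i j)) \<longlonglongrightarrow> (\<Sum>n. s * (of_real (Od n) * (a (Suc n) * s ^ n)))"
  proof (cases "s = 0")
    case False
    then have "summable (\<lambda>n. \<Sum>i\<le>n. cmod (F i (n - i)))"
      using summable_cmult_iff[of "cmod s" "\<lambda>n. \<Sum>i\<le>n. cmod (F i (n - i))"] Fsumm by simp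
    from square_sums_tendsto[OF this] have "(\<lambda>N. \<Sum>i<N. \<Sum>j<N. F i j) \<longlonglongrightarrow> (\<Sum>n. of_real (Od n) * (a (Suc n) * s ^ n))"
      by (simp only: Fsum)
    then have "(\<lambda>N. s * (\<Sum>i<N. \<Sum>j<N. F i j)) \<longlonglongrightarrow> s * (\<Sum>n. of_real (Od n) * (a (Suc n) * s ^ n))"
      by (rule tendsto_mult_left)
    also have "s * (\<Sum>n. of_real (Od n) * (a (Suc n) * s ^ n)) = (\<Sum>n. s * (of_real (Od n) * (a (Suc n) * s ^ n)))"
      using norm_sF False by (intro suminf_mult[symmetric]) (simp add: summable_cmult_iff)
    finally show ?thesis .
  qed simp
  have "gam a s = (\<Sum>n. of_real (Ev n) * (a n * s ^ n)) + (\<Sum>n. s * (of_real (Od n) * (a (Suc n) * s ^ n)))"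
  proof -
    have gs: "summable (\<lambda>n. of_real (c n) * a n * s ^ n)"
    proof (rule summable_comparison_test'[OF summ])
      fix n
      have "c n \<ge> 0" by (simp add: c_def)
      then show "norm (of_real (c n) * a n * s ^ n) \<le> c n * cmod (a n) * cmod s ^ n"
        by (simp add: norm_mult norm_power)
    qed
    have "gam a s = (\<Sum>n. of_real (c n) * a n * s ^ n)"
      unfolding gam_def c_def by (simp only: of_real_of_nat_eq)
    also have "\<dots> = of_real (c 0) * a 0 + (\<Sum>n. of_real (c (Suc n)) * a (Suc n) * s ^ Suc n)"
      using suminf_split_head[OF gs] by simp
    also have "(\<lambda>n. of_real (c (Suc n)) * a (Suc n) * s ^ Suc n)
        = (\<lambda>n. of_real (Ev (Suc n)) * (a (Suc n) * s ^ Suc n) + s * (of_real (Od n) * (a (Suc n) * s ^ n)))"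
      by (rule ext) (simp add: cS algebra_simps)
    also have "(\<Sum>n. of_real (Ev (Suc n)) * (a (Suc n) * s ^ Suc n) + s * (of_real (Od n) * (a (Suc n) * s ^ n)))
        = (\<Sum>n. of_real (Ev (Suc n)) * (a (Suc n) * s ^ Suc n)) + (\<Sum>n. s * (of_real (Od n) * (a (Suc n) * s ^ n)))"
      by (rule suminf_add[symmetric, OF summable_Suc_iff[THEN iffD2, OF norm_sE] norm_sF])
    also have "of_real (c 0) * a 0 + ((\<Sum>n. of_real (Ev (Suc n)) * (a (Suc n) * s ^ Suc n)) + (\<Sum>n. s * (of_real (Od n) * (a (Suc n) * s ^ n))))
        = (\<Sum>n. of_real (Ev n) * (a n * s ^ n)) + (\<Sum>n. s * (of_real (Od n) * (a (Suc n) * s ^ n)))"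
      using suminf_split_head[OF norm_sE] by (simp add: c0)
    finally show ?thesis .
  qed
  then show ?thesis
    using tendsto_add[OF limE limF] unfolding E_def F_def by (simp only:)
qed

section \<open>From the trace class to a representing measure\<close>

lemma gam_cnj_measurable: "(\<lambda>s. gam a (cnj s)) \<in> borel_measurable borel"
  unfolding gam_def
  by (intro borel_measurable_suminf borel_measurable_continuous_onI continuous_intros)

context
  fixes \<phi> :: "nat \<Rightarrow> complex" and a :: "nat \<Rightarrow> complex"
  assumes tc: "trace_class (hankel_h \<phi>)"
  defines "a \<equiv> \<lambda>n. \<phi> n - \<phi> (Suc n)"
begin

lemma hankel_h_eq: "hankel_h \<phi> i j = a (i + j)"
  and hankel_k_eq: "hankel_k \<phi> i j = a (i + j + 1)"
  by (simp_all add: hankel_h_def hankel_k_def a_def)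

lemma hk_bounded: "bounded_matrix (hankel_h \<phi>)" "bounded_matrix (hankel_k \<phi>)"
  using tc hankel_k_trace_class[OF tc] by (auto simp: trace_class_def)

lemmas h_trace = trace_class_symmetric[OF tc symmetric_hankel_h]
lemmas k_trace = trace_class_symmetric[OF hankel_k_trace_class[OF tc] symmetric_hankel_k]

lemma trace_norms_nonneg: "trace_norm (hankel_h \<phi>) \<ge> 0" "trace_norm (hankel_k \<phi>) \<ge> 0"
  unfolding h_trace(3) k_trace(3) by (intro suminf_nonneg h_trace k_trace)+

text \<open>The diagonals of $h$ and $k$ contain all the entries of the sequence, and they are dominated by
  the diagonals of $|h|$ and $|k|$.\<close>

lemma summable_cmod_a: "summable (\<lambda>n. cmod (a n))"
proof (rule summableI_nonneg_bounded)
  fix N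
  have split: "(\<Sum>n<2 * N. cmod (a n)) = (\<Sum>n<N. cmod (a (2 * n))) + (\<Sum>n<N. cmod (a (2 * n + 1)))" for N
    by (induction N) simp_all
  have "(\<Sum>n<N. cmod (a n)) \<le> (\<Sum>n<2 * N. cmod (a n))" by (rule sum_mono2) auto
  also have "\<dots> \<le> (\<Sum>n<N. Re (mat_abs (hankel_h \<phi>) n n)) + (\<Sum>n<N. Re (mat_abs (hankel_k \<phi>) n n))"
    unfolding split
    using cmod_diag_le_mat_abs[OF hk_bounded(1) symmetric_hankel_h] cmod_diag_le_mat_abs[OF hk_bounded(2) symmetric_hankel_k]
    by (intro add_mono sum_mono) (simp_all add: hankel_h_eq hankel_k_eq mult_2)
  also have "\<dots> \<le> trace_norm (hankel_h \<phi>) + trace_norm (hankel_k \<phi>)"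
    unfolding h_trace(3) k_trace(3)
    by (intro add_mono sum_le_suminf h_trace k_trace) auto
  finally show "(\<Sum>n<N. cmod (a n)) \<le> trace_norm (hankel_h \<phi>) + trace_norm (hankel_k \<phi>)" .
qed simp

lemma a_bounded: "cmod (a n) \<le> (\<Sum>n. cmod (a n))"
  using sum_le_suminf[OF summable_cmod_a, of "{n}"] by simp

text \<open>The pointwise bound of the square sums by $|h|$ and $|k|$ integrates to their diagonals, since
  the other monomials have integral zero.\<close>

lemma nn_integral_gam_le:
  "(\<integral>\<^sup>+ s. ennreal (cmod (gam a (cnj s))) \<partial>disc_measure)
     \<le> ennreal (4 / pi * (trace_norm (hankel_h \<phi>) + trace_norm (hankel_k \<phi>)))"
proof -
  define H K where "H = mat_abs (hankel_h \<phi>)" and "K = mat_abs (hankel_k \<phi>)"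
  define C where "C = 4 / pi * (trace_norm (hankel_h \<phi>) + trace_norm (hankel_k \<phi>))"
  define e o' where "e i = p_coeff (2 * i)" and "o' i = p_coeff (2 * i + 1)" for i
  define S where "S N s = (\<Sum>i<N. \<Sum>j<N. a (i + j) * (e i * s ^ i) * (e j * s ^ j))
      + s * (\<Sum>i<N. \<Sum>j<N. a (i + j + 1) * (o' i * s ^ i) * (o' j * s ^ j))" for N and s :: complex
  define V where "V N s = (\<Sum>i<N. \<Sum>j<N. H i j * of_real (e i * e j) * (s ^ i * cnj s ^ j * of_real (cmod s ^ 0)))
      + (\<Sum>i<N. \<Sum>j<N. K i j * of_real (o' i * o' j) * (s ^ i * cnj s ^ j * of_real (cmod s ^ 1)))" for N s
  have V_int: "integrable disc_measure (V N)" for N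
    unfolding V_def by (intro Bochner_Integration.integrable_add Bochner_Integration.integrable_sum
        integrable_mult_right integrable_disc_monomial)
  have S_le: "cmod (S N (cnj s)) \<le> Re (V N s)" for N s
  proof -
    let ?x = "\<lambda>i. complex_of_real (e i) * cnj s ^ i" and ?y = "\<lambda>i. complex_of_real (o' i) * cnj s ^ i"
    have "cmod (S N (cnj s)) \<le> cmod (\<Sum>i<N. \<Sum>j<N. hankel_h \<phi> i j * ?x i * ?x j)
        + cmod (cnj s) * cmod (\<Sum>i<N. \<Sum>j<N. hankel_k \<phi> i j * ?y i * ?y j)"
      unfolding S_def hankel_h_eq hankel_k_eq norm_mult[symmetric] by (rule norm_triangle_ineq)
    also have "\<dots> \<le> Re (\<Sum>i<N. \<Sum>j<N. H i j * cnj (?x i) * ?x j)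
        + cmod (cnj s) * Re (\<Sum>i<N. \<Sum>j<N. K i j * cnj (?y i) * ?y j)"
      unfolding H_def K_def
      by (intro add_mono mult_left_mono symmetric_form_le_mat_abs hk_bounded symmetric_hankel_h symmetric_hankel_k) auto
    also have "\<dots> = Re (\<Sum>i<N. \<Sum>j<N. H i j * cnj (?x i) * ?x j)
        + Re (of_real (cmod s) * (\<Sum>i<N. \<Sum>j<N. K i j * cnj (?y i) * ?y j))" by simp
    also have "\<dots> = Re (V N s)"
      unfolding V_def plus_complex.sel sum_distrib_left
      by (intro arg_cong2[of _ _ _ _ "(+)"] arg_cong[of _ _ Re] sum.cong refl) (simp_all add: mult_ac)
    finally show ?thesis .
  qed
  have V_integral: "(\<integral>s. Re (V N s) \<partial>disc_measure) \<le> C" for N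
  proof -
    have "(\<integral>s. V N s \<partial>disc_measure) = (\<Sum>i<N. \<Sum>j<N. H i j * of_real (e i * e j) * (if i = j then 1 / (of_nat (2 * i + 0) + 1) else 0))
        + (\<Sum>i<N. \<Sum>j<N. K i j * of_real (o' i * o' j) * (if i = j then 1 / (of_nat (2 * i + 1) + 1) else 0))"
      unfolding V_def
      by (subst Bochner_Integration.integral_add)
         (simp_all only: Bochner_Integration.integral_sum Bochner_Integration.integrable_sum
            integrable_mult_right integrable_disc_monomial integral_mult_right_zero integral_disc_monomial)
    also have "\<dots> = (\<Sum>i<N. H i i * of_real ((e i)\<^sup>2 / (2 * real i + 1))) + (\<Sum>i<N. K i i * of_real ((o' i)\<^sup>2 / (2 * real i + 2)))"
      by (intro arg_cong2[of _ _ _ _ "(+)"] sum.cong refl)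
         (simp_all add: if_distrib[of "\<lambda>c. _ * c"] power2_eq_square cong: if_cong)
    finally have "Re (\<integral>s. V N s \<partial>disc_measure)
        = (\<Sum>i<N. Re (H i i) * ((e i)\<^sup>2 / (2 * real i + 1))) + (\<Sum>i<N. Re (K i i) * ((o' i)\<^sup>2 / (2 * real i + 2)))"
      by (simp only: plus_complex.sel Re_sum Re_complex_of_real times_complex.sel Im_complex_of_real mult_zero_right diff_zero)
    also have "\<dots> \<le> (\<Sum>i<N. Re (H i i) * (4 / pi)) + (\<Sum>i<N. Re (K i i) * (4 / pi))"
    proof (intro add_mono sum_mono mult_left_mono)
      fix i
      show "(e i)\<^sup>2 / (2 * real i + 1) \<le> 4 / pi"
        using p_coeff_square_le[of "2 * i"] by (simp add: e_def divide_le_eq)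
      have "(o' i)\<^sup>2 \<le> 4 / pi * (2 * real i + 2)"
        using p_coeff_square_le[of "2 * i + 1"] by (simp add: o'_def add.commute)
      then show "(o' i)\<^sup>2 / (2 * real i + 2) \<le> 4 / pi"
        by (subst divide_le_eq) simp
    qed (simp_all add: H_def K_def h_trace(2) k_trace(2))
    also have "\<dots> = 4 / pi * ((\<Sum>i<N. Re (H i i)) + (\<Sum>i<N. Re (K i i)))"
      by (simp only: sum_distrib_right[symmetric] distrib_left mult.commute)
    also have "\<dots> \<le> C"
      unfolding C_def h_trace(3) k_trace(3) H_def K_def
      by (intro mult_left_mono add_mono sum_le_suminf h_trace k_trace) auto
    finally show ?thesis using V_int by (simp add: integral_Re)
  qed
  have "(\<integral>\<^sup>+ s. ennreal (cmod (S N (cnj s))) \<partial>disc_measure) \<le> ennreal C" for N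
  proof -
    have pos: "0 \<le> Re (V N s)" for s using S_le[of N s] by (rule order_trans[OF norm_ge_zero])
    have "(\<integral>\<^sup>+ s. ennreal (cmod (S N (cnj s))) \<partial>disc_measure) \<le> (\<integral>\<^sup>+ s. ennreal (Re (V N s)) \<partial>disc_measure)"
      by (intro nn_integral_mono ennreal_leI S_le)
    also have "\<dots> = ennreal (\<integral>s. Re (V N s) \<partial>disc_measure)"
      using V_int pos by (intro nn_integral_eq_integral) auto
    also have "\<dots> \<le> ennreal C" by (intro ennreal_leI V_integral)
    finally show ?thesis .
  qed
  then have lim: "liminf (\<lambda>N. \<integral>\<^sup>+ s. ennreal (cmod (S N (cnj s))) \<partial>disc_measure) \<le> ennreal C"
    by (intro Liminf_le) auto
  have "(\<integral>\<^sup>+ s. ennreal (cmod (gam a (cnj s))) \<partial>disc_measure)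
      = (\<integral>\<^sup>+ s. liminf (\<lambda>N. ennreal (cmod (S N (cnj s)))) \<partial>disc_measure)"
  proof (rule nn_integral_cong)
    fix s assume "s \<in> space disc_measure"
    then have s: "cmod (cnj s) < 1" by simp
    have "(\<lambda>N. S N (cnj s)) \<longlonglongrightarrow> gam a (cnj s)"
      using gam_square_sums[OF a_bounded s] by (simp only: S_def e_def o'_def)
    then have "(\<lambda>N. ennreal (cmod (S N (cnj s)))) \<longlonglongrightarrow> ennreal (cmod (gam a (cnj s)))"
      by (intro tendsto_ennrealI tendsto_norm)
    then show "ennreal (cmod (gam a (cnj s))) = liminf (\<lambda>N. ennreal (cmod (S N (cnj s))))"
      by (intro lim_imp_Liminf[symmetric]) auto
  qed
  also have "\<dots> \<le> liminf (\<lambda>N. \<integral>\<^sup>+ s. ennreal (cmod (S N (cnj s))) \<partial>disc_measure)"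
  proof (rule nn_integral_liminf)
    fix N
    have "(\<lambda>s. S N (cnj s)) \<in> borel_measurable borel"
      unfolding S_def by (intro borel_measurable_continuous_onI continuous_intros)
    then have "(\<lambda>s. S N (cnj s)) \<in> borel_measurable disc_measure" by (rule disc_measure_measurable)
    then show "(\<lambda>s. ennreal (cmod (S N (cnj s)))) \<in> borel_measurable disc_measure" by measurable
  qed
  also note lim
  finally show ?thesis by (simp add: C_def)
qed

lemma integrable_gam: "integrable disc_measure (\<lambda>s. gam a (cnj s))"
proof (rule integrableI_bounded)
  show "(\<lambda>s. gam a (cnj s)) \<in> borel_measurable disc_measure"
    by (intro disc_measure_measurable gam_cnj_measurable)
  show "(\<integral>\<^sup>+ s. ennreal (norm (gam a (cnj s))) \<partial>disc_measure) < \<infinity>"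
    using nn_integral_gam_le by (rule le_less_trans) simp
qed

lemma integral_disc_norm_power: "(\<integral>s. cmod s ^ k \<partial>disc_measure) = 1 / (real k + 1)"
proof -
  have "complex_of_real (\<integral>s. cmod s ^ k \<partial>disc_measure) = (\<integral>s. s ^ 0 * cnj s ^ 0 * of_real (cmod s ^ k) \<partial>disc_measure)"
    by (simp flip: of_real_power)
  also have "\<dots> = complex_of_real (1 / (real k + 1))" unfolding integral_disc_monomial by simp
  finally show ?thesis by (simp only: of_real_eq_iff)
qed

lemma integrable_disc_norm_power: "integrable disc_measure (\<lambda>s. cmod s ^ k)"
  by (rule integrable_disc_measure_bounded[where B = 1])
     (auto intro!: borel_measurable_continuous_onI continuous_intros simp: power_le_one)

text \<open>Against $1 - |s|$ the monomial $|s|^{2n}$ integrates to $((2n+1)(2n+2))^{-1}$, which cancels the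
  coefficient of $2\,$\<open>gam\<close>. Termwise integration is justified by the absolute summability of
  the sequence.\<close>

lemma gam_reproducing:
  "(\<integral>s. s ^ m * (2 * gam a (cnj s) * (1 - of_real (cmod s))) \<partial>disc_measure) = a m"
proof -
  define c where "c n = real ((2 * n + 1) * (n + 1))" for n
  define f where "f n s = 2 * of_real (c n) * a n * (s ^ m * cnj s ^ n * of_real (cmod s ^ 0) - s ^ m * cnj s ^ n * of_real (cmod s ^ 1))"
    for n and s :: complex
  have c0: "c n \<ge> 0" for n by (simp add: c_def)
  have f_int: "integrable disc_measure (f n)" for n
    unfolding f_def by (intro integrable_mult_right Bochner_Integration.integrable_diff integrable_disc_monomial)
  have f_integral: "(\<integral>s. f n s \<partial>disc_measure) = (if n = m then a m else 0)" for n
  proof -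
    have "(\<integral>s. f n s \<partial>disc_measure) = 2 * of_real (c n) * a n *
        ((if m = n then 1 / (of_nat (2 * m + 0) + 1) else 0) - (if m = n then 1 / (of_nat (2 * m + 1) + 1) else 0))"
      unfolding f_def integral_mult_right_zero
      by (subst Bochner_Integration.integral_diff) (simp_all only: integrable_disc_monomial integral_disc_monomial)
    also have "\<dots> = (if n = m then a m else 0)"
    proof (cases "n = m")
      case True
      have "2 * c m * (1 / (real (2 * m + 0) + 1) - 1 / (real (2 * m + 1) + 1)) = 1"
      proof -
        define p where "p = real (2 * m + 0) + 1"
        have p: "p > 0" "real (2 * m + 1) + 1 = p + 1" by (simp_all add: p_def)
        then have "1 / p - 1 / (p + 1) = 1 / (p * (p + 1))" by (simp add: diff_frac_eq)
        moreover have "2 * c m = p * (p + 1)" by (simp add: c_def p_def algebra_simps)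
        ultimately show ?thesis using p(1) unfolding p(2) p_def[symmetric] by simp
      qed
      then have "complex_of_real (2 * c m * (1 / (real (2 * m + 0) + 1) - 1 / (real (2 * m + 1) + 1))) = 1"
        by (simp only: of_real_1)
      then have *: "2 * of_real (c m) * (1 / (of_nat (2 * m + 0) + 1) - 1 / (of_nat (2 * m + 1) + 1)) = (1 :: complex)"
        by simp
      have "2 * of_real (c m) * a m * (1 / (of_nat (2 * m + 0) + 1) - 1 / (of_nat (2 * m + 1) + 1))
          = (2 * of_real (c m) * (1 / (of_nat (2 * m + 0) + 1) - 1 / (of_nat (2 * m + 1) + 1))) * a m"
        by (simp only: mult_ac)
      also have "\<dots> = a m" unfolding * by (rule mult_1)
      finally show ?thesis unfolding True by (simp only: simp_thms if_True)
    qed simp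
    finally show ?thesis .
  qed
  have f_norm: "norm (f n s) \<le> 2 * c n * cmod (a n) * (cmod s ^ n - cmod s ^ Suc n)" if s: "cmod s < 1" for n s
  proof -
    have "f n s = 2 * of_real (c n) * a n * (s ^ m * cnj s ^ n * of_real (1 - cmod s))"
      by (simp add: f_def algebra_simps)
    then have "norm (f n s) = (2 * c n * cmod (a n)) * (cmod s ^ m * (cmod s ^ n * (1 - cmod s)))"
      using c0 s by (simp only: norm_mult norm_power complex_mod_cnj norm_of_real norm_numeral) simp
    also have "\<dots> \<le> (2 * c n * cmod (a n)) * (1 * (cmod s ^ n * (1 - cmod s)))"
      using s c0 by (intro mult_left_mono mult_right_mono power_le_one mult_nonneg_nonneg) auto
    finally show ?thesis by (simp add: algebra_simps)
  qed
  have norms: "(\<integral>s. norm (f n s) \<partial>disc_measure) \<le> 4 * cmod (a n)" for n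
  proof -
    have "(\<integral>s. norm (f n s) \<partial>disc_measure) \<le> (\<integral>s. 2 * c n * cmod (a n) * (cmod s ^ n - cmod s ^ Suc n) \<partial>disc_measure)"
      using f_norm f_int
      by (intro integral_mono integrable_mult_right Bochner_Integration.integrable_diff integrable_norm integrable_disc_norm_power) auto
    also have "\<dots> = 2 * c n * cmod (a n) * (1 / (real n + 1) - 1 / (real (Suc n) + 1))"
      unfolding integral_mult_right_zero
      by (subst Bochner_Integration.integral_diff) (simp_all only: integrable_disc_norm_power integral_disc_norm_power)
    also have "\<dots> = 2 * cmod (a n) * (c n * (1 / (real n + 1) - 1 / (real (Suc n) + 1)))" by simp
    also have "c n * (1 / (real n + 1) - 1 / (real (Suc n) + 1)) = (2 * real n + 1) / (real n + 2)"
    proof -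
      define p where "p = real n + 1"
      have p: "p > 0" "real (Suc n) + 1 = p + 1" "real n + 2 = p + 1" by (simp_all add: p_def)
      then have "1 / p - 1 / (p + 1) = 1 / (p * (p + 1))" by (simp add: diff_frac_eq)
      moreover have "c n = (2 * real n + 1) * p" by (simp add: c_def p_def algebra_simps)
      ultimately show ?thesis using p(1) unfolding p(2,3) p_def[symmetric] by simp
    qed
    also have "2 * cmod (a n) * ((2 * real n + 1) / (real n + 2)) \<le> 2 * cmod (a n) * 2"
      by (intro mult_left_mono) (auto simp: field_simps)
    finally show ?thesis by simp
  qed
  have AE: "summable (\<lambda>n. norm (f n s))" if s: "cmod s < 1" for s
  proof (rule summable_comparison_test')
    show "summable (\<lambda>n. 2 * (c n * cmod (a n) * cmod s ^ n))"
      unfolding c_def by (intro summable_mult summable_gam[OF a_bounded s])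
    fix n
    have "norm (f n s) \<le> 2 * c n * cmod (a n) * (cmod s ^ n - cmod s ^ Suc n)" by (rule f_norm[OF s])
    also have "\<dots> \<le> 2 * c n * cmod (a n) * cmod s ^ n" using c0 by (intro mult_left_mono) auto
    finally show "norm (norm (f n s)) \<le> 2 * (c n * cmod (a n) * cmod s ^ n)" by (simp add: mult.assoc)
  qed
  have sum_eq: "s ^ m * (2 * gam a (cnj s) * (1 - of_real (cmod s))) = (\<Sum>n. f n s)" if s: "cmod s < 1" for s
  proof -
    have summ: "summable (\<lambda>n. of_real (c n) * a n * cnj s ^ n)"
    proof (rule summable_comparison_test'[OF summable_gam[OF a_bounded s, folded c_def]])
      fix n
      show "norm (of_real (c n) * a n * cnj s ^ n) \<le> c n * cmod (a n) * cmod s ^ n"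
        using c0 by (simp add: norm_mult norm_power)
    qed
    have "(\<Sum>n. f n s) = (\<Sum>n. (2 * s ^ m * (1 - of_real (cmod s))) * (of_real (c n) * a n * cnj s ^ n))"
      by (intro suminf_cong) (simp add: f_def algebra_simps)
    also have "\<dots> = (2 * s ^ m * (1 - of_real (cmod s))) * (\<Sum>n. of_real (c n) * a n * cnj s ^ n)"
      by (rule suminf_mult[OF summ])
    also have "(\<Sum>n. of_real (c n) * a n * cnj s ^ n) = gam a (cnj s)"
      unfolding gam_def c_def by (simp only: of_real_of_nat_eq)
    finally show ?thesis by (simp add: mult_ac)
  qed
  have "(\<integral>s. s ^ m * (2 * gam a (cnj s) * (1 - of_real (cmod s))) \<partial>disc_measure) = (\<integral>s. (\<Sum>n. f n s) \<partial>disc_measure)"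
    by (intro Bochner_Integration.integral_cong refl sum_eq) simp
  also have "\<dots> = (\<Sum>n. \<integral>s. f n s \<partial>disc_measure)"
  proof (rule integral_suminf[OF f_int])
    show "AE s in disc_measure. summable (\<lambda>n. norm (f n s))"
      by (rule AE_I2) (simp add: AE)
    show "summable (\<lambda>n. \<integral>s. norm (f n s) \<partial>disc_measure)"
      by (rule summable_comparison_test'[OF summable_mult[OF summable_cmod_a, of 4]]) (simp add: norms)
  qed
  also have "\<dots> = a m"
    unfolding f_integral using sums_unique[OF sums_single[of m "\<lambda>_. a m"]] by simp
  finally show ?thesis .
qed

end

lemma disc_measure_notions:
  "complex_measure disc_borel = complex_measure disc_measure"
  "total_variation disc_borel = total_variation disc_measure"
  "complex_measure_integral disc_borel = complex_measure_integral disc_measure"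
  by (intro ext; simp add: complex_measure_def total_variation_def complex_measure_integral_def positive_part_def)+

theorem class_C_imp_representable:
  assumes "\<phi> \<in> class_C"
  shows "\<exists>c \<nu>. complex_measure disc_borel \<nu> \<and> represents c \<nu> \<phi> \<and> weighted_variation \<nu> < \<infinity> \<and>
    ennreal (cmod c) + weighted_variation \<nu> \<le> ennreal (8 / pi * norm_C \<phi>)"
proof -
  have tc: "trace_class (hankel_h \<phi>)" using assms by (simp add: class_C_def)
  define a where "a = (\<lambda>n. \<phi> n - \<phi> (Suc n))"
  define T where "T = trace_norm (hankel_h \<phi>) + trace_norm (hankel_k \<phi>)"
  have T0: "T \<ge> 0" using trace_norms_nonneg[OF tc] by (simp add: T_def)
  define g where "g s = 2 * gam a (cnj s) * (1 - of_real (cmod s)) / (1 - s)" for s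
  have g_meas: "g \<in> borel_measurable disc_measure"
    unfolding g_def[abs_def] using gam_cnj_measurable[of a]
    by (intro disc_measure_measurable borel_measurable_divide borel_measurable_times) auto
  have one_minus: "1 - s \<noteq> 0" "1 - cmod s \<le> cmod (1 - s)" if "cmod s < 1" for s
    using that norm_triangle_ineq2[of 1 s] by auto
  have g_norm: "cmod (g s) * disc_weight s = 2 * cmod (gam a (cnj s))" if s: "cmod s < 1" for s
  proof -
    have "1 - complex_of_real (cmod s) = of_real (1 - cmod s)" by simp
    then have "cmod (1 - complex_of_real (cmod s)) = 1 - cmod s" using s by (simp only: norm_of_real)
    then show ?thesis using s one_minus[OF s] by (simp add: g_def norm_mult norm_divide disc_weight_def)
  qed
  have g_le: "cmod (g s) \<le> 2 * cmod (gam a (cnj s))" if s: "cmod s < 1" for s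
    using mult_left_mono[OF disc_weight_ge_one[OF s], of "cmod (g s)"] g_norm[OF s] by simp
  have g_int: "integrable disc_measure g"
    using integrable_gam[OF tc, folded a_def]
    by (rule Bochner_Integration.integrable_bound[OF integrable_mult_right[of 2]])
       (use g_meas g_le in \<open>auto simp: norm_mult\<close>)
  define \<nu> where "\<nu> E = (\<integral>s. indicator E s *\<^sub>R g s \<partial>disc_measure)" for E
  have cm: "complex_measure disc_borel \<nu>"
    unfolding disc_measure_notions \<nu>_def by (rule complex_measure_density[OF g_int])
  have wv: "weighted_variation \<nu> \<le> ennreal (8 / pi * T)"
  proof -
    have [measurable]: "g \<in> borel_measurable disc_measure" by (rule g_meas)
    have [measurable]: "disc_weight \<in> borel_measurable disc_measure"
      by (intro disc_measure_measurable) (simp add: disc_weight_def[abs_def])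
    have "weighted_variation \<nu> \<le> (\<integral>\<^sup>+ s. ennreal (disc_weight s) \<partial>density disc_measure (\<lambda>s. ennreal (cmod (g s))))"
      unfolding weighted_variation_def disc_weight_def[symmetric] disc_measure_notions \<nu>_def
      by (intro nn_integral_mono_measure total_variation_density_le g_int) simp
    also have "\<dots> = (\<integral>\<^sup>+ s. ennreal (cmod (g s)) * ennreal (disc_weight s) \<partial>disc_measure)"
      by (rule nn_integral_density) auto
    also have "\<dots> = (\<integral>\<^sup>+ s. 2 * ennreal (cmod (gam a (cnj s))) \<partial>disc_measure)"
    proof (rule nn_integral_cong)
      fix s assume "s \<in> space disc_measure"
      then have s: "cmod s < 1" by simp
      have "ennreal (cmod (g s)) * ennreal (disc_weight s) = ennreal (cmod (g s) * disc_weight s)"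
        using disc_weight_ge_one[OF s] by (intro ennreal_mult[symmetric]) auto
      then show "ennreal (cmod (g s)) * ennreal (disc_weight s) = 2 * ennreal (cmod (gam a (cnj s)))"
        by (simp add: g_norm[OF s] ennreal_mult)
    qed
    also have "\<dots> = 2 * (\<integral>\<^sup>+ s. ennreal (cmod (gam a (cnj s))) \<partial>disc_measure)"
      using disc_measure_measurable[OF gam_cnj_measurable[of a]] by (intro nn_integral_cmult) auto
    also have "\<dots> \<le> 2 * ennreal (4 / pi * T)"
      using nn_integral_gam_le[OF tc, folded a_def T_def] by (rule mult_left_mono) simp
    also have "\<dots> = ennreal (8 / pi * T)"
      using T0 by (simp add: ennreal_mult[symmetric] flip: ennreal_numeral)
    finally show ?thesis .
  qed
  define \<psi> where "\<psi> n = (\<integral>s. g s * s ^ n \<partial>disc_measure)" for n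
  have pow_meas: "(\<lambda>s. s ^ n) \<in> borel_measurable disc_measure" for n :: nat
    by (intro disc_measure_measurable) auto
  have pow_le: "cmod (g s * s ^ n) \<le> cmod (g s)" if "cmod s < 1" for s n
    using that by (simp add: norm_mult norm_power power_le_one mult_left_le)
  have gs_int: "integrable disc_measure (\<lambda>s. g s * s ^ n)" for n
    by (rule Bochner_Integration.integrable_bound[OF g_int])
       (use g_meas pow_meas pow_le in auto)
  have rep: "complex_measure_integral disc_borel \<nu> (\<lambda>s. s ^ n) = \<psi> n" for n
    unfolding disc_measure_notions \<nu>_def \<psi>_def
    by (rule complex_measure_integral_density[OF g_int pow_meas]) (simp add: norm_power power_le_one)
  have diff: "\<psi> n - \<psi> (Suc n) = \<phi> n - \<phi> (Suc n)" for n
  proof -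
    have "\<psi> n - \<psi> (Suc n) = (\<integral>s. g s * s ^ n - g s * s ^ Suc n \<partial>disc_measure)"
      unfolding \<psi>_def by (rule Bochner_Integration.integral_diff[symmetric, OF gs_int gs_int])
    also have "\<dots> = (\<integral>s. s ^ n * (2 * gam a (cnj s) * (1 - of_real (cmod s))) \<partial>disc_measure)"
    proof (rule Bochner_Integration.integral_cong[OF refl])
      fix s assume "s \<in> space disc_measure"
      then have ne: "1 - s \<noteq> 0" using one_minus by auto
      have "g s * s ^ n - g s * s ^ Suc n = s ^ n * (g s * (1 - s))" by (simp add: algebra_simps)
      also have "g s * (1 - s) = 2 * gam a (cnj s) * (1 - of_real (cmod s))"
        unfolding g_def using ne by simp
      finally show "g s * s ^ n - g s * s ^ Suc n = s ^ n * (2 * gam a (cnj s) * (1 - of_real (cmod s)))" .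
    qed
    also have "\<dots> = \<phi> n - \<phi> (Suc n)" by (rule gam_reproducing[OF tc, folded a_def])
    finally show ?thesis .
  qed
  \<comment> \<open>equal differences leave a constant, which is the limit because \<open>\<psi>\<close> tends to zero\<close>
  define c where "c = \<phi> 0 - \<psi> 0"
  have phi: "\<phi> n = c + \<psi> n" for n
  proof (induction n)
    case (Suc n)
    then show ?case using diff[of n] by (simp add: algebra_simps)
  qed (simp add: c_def)
  have "\<psi> \<longlonglongrightarrow> (\<integral>s. 0 \<partial>disc_measure)"
    unfolding \<psi>_def
  proof (rule integral_dominated_convergence[where w = "\<lambda>s. cmod (g s)"])
    show "AE s in disc_measure. (\<lambda>n. g s * s ^ n) \<longlonglongrightarrow> 0"
      by (intro AE_I2 tendsto_mult_right_zero LIMSEQ_power_zero) simp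
    show "AE s in disc_measure. norm (g s * s ^ n) \<le> cmod (g s)" for n
      by (rule AE_I2) (simp add: pow_le)
  qed (use g_int g_meas pow_meas in auto)
  then have "\<phi> \<longlonglongrightarrow> c"
    using tendsto_add[of "\<lambda>_. c" c sequentially \<psi> 0] by (simp add: phi[abs_def])
  then have lim: "lim \<phi> = c" by (rule limI)
  have "represents c \<nu> \<phi>" by (simp add: represents_def rep phi)
  moreover have "weighted_variation \<nu> < \<infinity>" using wv by (rule le_less_trans) simp
  moreover have "ennreal (cmod c) + weighted_variation \<nu> \<le> ennreal (8 / pi * norm_C \<phi>)"
  proof -
    have "8 / pi \<ge> 1" using pi_less_4 by (simp add: le_divide_eq)
    have "ennreal (cmod c) + weighted_variation \<nu> \<le> ennreal (8 / pi * cmod c) + ennreal (8 / pi * T)"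
      using mult_right_mono[OF \<open>8 / pi \<ge> 1\<close>, of "cmod c"] by (intro add_mono wv ennreal_leI) auto
    also have "\<dots> = ennreal (8 / pi * cmod c + 8 / pi * T)"
      using T0 by (intro ennreal_plus[symmetric]) auto
    also have "8 / pi * cmod c + 8 / pi * T = 8 / pi * norm_C \<phi>"
      by (simp add: norm_C_def T_def lim distrib_left)
    finally show ?thesis .
  qed
  ultimately show ?thesis using cm by blast
qed

section \<open>The characterisation of the class C\<close>

theorem theorem7p2:
  fixes \<phi> :: "nat \<Rightarrow> complex"
  shows "(\<phi> \<in> class_C \<longleftrightarrow>
            (\<exists>c \<nu>. complex_measure disc_borel \<nu> \<and> represents c \<nu> \<phi> \<and> weighted_variation \<nu> < \<infinity>))
       \<and> (\<phi> \<in> class_C \<longrightarrow>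
            (\<exists>c \<nu>. complex_measure disc_borel \<nu> \<and> represents c \<nu> \<phi> \<and> weighted_variation \<nu> < \<infinity> \<and>
               ennreal (cmod c) + weighted_variation \<nu> \<le> ennreal (8 / pi * norm_C \<phi>)))"
proof -
  have "\<phi> \<in> class_C" if "complex_measure disc_borel \<nu>" "represents c \<nu> \<phi>" "weighted_variation \<nu> < \<infinity>" for c \<nu>
    using that by (rule representable_imp_class_C)
  moreover note class_C_imp_representable[of \<phi>]
  ultimately show ?thesis by blast
qed

end
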